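(* Let $f\in C^{2}([0,\infty))$ be convex and satisfy $f(0)>0$, $f'\ge0$ and $\lim_{s\to\infty}f(s)/s=\infty$. Assume in addition that, for some $0\le\gamma\le2$ and $\epsilon>0$ such that $\epsilon-\gamma>\frac12$, we have $$\liminf_{t\to\infty}\frac{t^{2-\gamma}f(t)^{1+\gamma}f''(t)}{f'(t)^{1+\epsilon}}>0 .$$ Then if $u$ is a positive semistable solution of the problem $Lu+f(u)=0$ in $\Omega$, $u=0$ on $\partial\Omega$, we have $\|u\|_{L^\infty(\Omega)}\le C$ for $n\le 5$, where $C$ is a constant independent of $u$. In particular (taking $\gamma=0$), if for some $\epsilon>\frac12$ we have $$\liminf_{t\to\infty}\frac{t^{2}f(t)f''(t)}{f'(t)^{1+\epsilon}}>0,$$ then $\|u\|_{L^\infty(\Omega)}\le C$ for $n\le5$.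
   Context: Setting: $n\ge 2$, $\Omega\subset\mathbb{R}^n$ is a smooth bounded domain, and $Lu:=\partial_i(a^{ij}(x)u_j)$ (summation over repeated indices, $u_j=\partial_j u$) is uniformly elliptic: $(a^{ij}(x))$ is a symmetric $n\times n$ matrix with bounded measurable coefficients, $a^{ij}=a^{ji}\in L^\infty(\Omega)$, and there are positive constants $c_0,C_0$ with $c_0|\xi|^2\le a^{ij}(x)\xi_i\xi_j\le C_0|\xi|^2$ for all $\xi\in\mathbb{R}^n$, $x\in\Omega$. A solution $u$ is semistable if the lowest Dirichlet eigenvalue of the linearized operator at $u$ is nonnegative, that is, $\int_\Omega f'(u)\eta^2\,dx\le\int_\Omega a^{ij}(x)\eta_i\eta_j\,dx$ for all $\eta\in H^1_0(\Omega)$. *)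

theory Defs
  imports "HOL-Analysis.Analysis" "HOL-Probability.Essential_Supremum"
begin

text \<open>
  \<open>Ck_on k U g\<close> is the class of \<open>k\<close> times continuously differentiable functions on \<open>U\<close>;
  it is meant for open \<open>U\<close> only. The second equation asks for all directional derivatives
  of \<open>g\<close>, as functions of the base point, to be in the class of order \<open>k\<close>.
\<close>

fun Ck_on :: "nat \<Rightarrow> (real ^ 'n) set \<Rightarrow> (real ^ 'n \<Rightarrow> real) \<Rightarrow> bool" where
  "Ck_on 0 U g \<longleftrightarrow> continuous_on U g"
| "Ck_on (Suc k) U g \<longleftrightarrow>
     (\<forall>x\<in>U. g differentiable (at x)) \<and>
     (\<forall>v. Ck_on k U (\<lambda>x. frechet_derivative g (at x) v))"

definition smooth_fun_on :: "(real ^ 'n) set \<Rightarrow> (real ^ 'n \<Rightarrow> real) \<Rightarrow> bool" where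
  "smooth_fun_on U g \<longleftrightarrow> (\<forall>k. Ck_on k U g)"

definition gradient :: "(real ^ 'n \<Rightarrow> real) \<Rightarrow> real ^ 'n \<Rightarrow> real ^ 'n" where
  "gradient g x = (\<chi> i. frechet_derivative g (at x) (axis i 1))"

text \<open>
  Smoothness of the boundary is expressed by local defining functions: near each boundary
  point the domain is a strict sublevel set of a smooth function without critical points.
\<close>

definition smooth_bounded_domain :: "(real ^ 'n) set \<Rightarrow> bool" where
  "smooth_bounded_domain \<Omega> \<longleftrightarrow>
     \<Omega> \<noteq> {} \<and> open \<Omega> \<and> connected \<Omega> \<and> bounded \<Omega> \<and>
     (\<forall>p\<in>frontier \<Omega>. \<exists>U \<rho>. open U \<and> p \<in> U \<and> smooth_fun_on U \<rho> \<and>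
        (\<forall>x\<in>U. gradient \<rho> x \<noteq> 0) \<and> \<Omega> \<inter> U = {x\<in>U. \<rho> x < 0})"

definition quad_form :: "real ^ 'n ^ 'n \<Rightarrow> real ^ 'n \<Rightarrow> real ^ 'n \<Rightarrow> real" where
  "quad_form A \<xi> \<zeta> = (\<Sum>i\<in>UNIV. \<Sum>j\<in>UNIV. A $ i $ j * \<xi> $ i * \<zeta> $ j)"

definition uniformly_elliptic :: "(real ^ 'n) set \<Rightarrow> (real ^ 'n \<Rightarrow> real ^ 'n ^ 'n) \<Rightarrow> bool" where
  "uniformly_elliptic \<Omega> a \<longleftrightarrow>
     (\<forall>i j. (\<lambda>x. a x $ i $ j) \<in> borel_measurable (lebesgue_on \<Omega>)) \<and>
     (\<forall>i j. \<exists>M. AE x in lebesgue_on \<Omega>. \<bar>a x $ i $ j\<bar> \<le> M) \<and>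
     (\<forall>x\<in>\<Omega>. \<forall>i j. a x $ i $ j = a x $ j $ i) \<and>
     (\<exists>c\<^sub>0 C\<^sub>0. 0 < c\<^sub>0 \<and> 0 < C\<^sub>0 \<and>
        (\<forall>x\<in>\<Omega>. \<forall>\<xi>. c\<^sub>0 * (norm \<xi>)\<^sup>2 \<le> quad_form (a x) \<xi> \<xi> \<and>
                     quad_form (a x) \<xi> \<xi> \<le> C\<^sub>0 * (norm \<xi>)\<^sup>2))"

definition test_function :: "(real ^ 'n) set \<Rightarrow> (real ^ 'n \<Rightarrow> real) \<Rightarrow> bool" where
  "test_function \<Omega> \<phi> \<longleftrightarrow>
     smooth_fun_on UNIV \<phi> \<and> compact (closure {x. \<phi> x \<noteq> 0}) \<and> closure {x. \<phi> x \<noteq> 0} \<subseteq> \<Omega>"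

definition locally_integrable :: "(real ^ 'n) set \<Rightarrow> (real ^ 'n \<Rightarrow> 'b::euclidean_space) \<Rightarrow> bool" where
  "locally_integrable \<Omega> g \<longleftrightarrow> (\<forall>K. compact K \<and> K \<subseteq> \<Omega> \<longrightarrow> integrable (lebesgue_on K) g)"

definition square_integrable :: "(real ^ 'n) set \<Rightarrow> (real ^ 'n \<Rightarrow> 'b::euclidean_space) \<Rightarrow> bool" where
  "square_integrable \<Omega> g \<longleftrightarrow>
     g \<in> borel_measurable (lebesgue_on \<Omega>) \<and> integrable (lebesgue_on \<Omega>) (\<lambda>x. (norm (g x))\<^sup>2)"

definition has_weak_gradient ::
  "(real ^ 'n) set \<Rightarrow> (real ^ 'n \<Rightarrow> real) \<Rightarrow> (real ^ 'n \<Rightarrow> real ^ 'n) \<Rightarrow> bool" where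
  "has_weak_gradient \<Omega> u Du \<longleftrightarrow>
     locally_integrable \<Omega> u \<and> locally_integrable \<Omega> Du \<and>
     (\<forall>\<phi>. test_function \<Omega> \<phi> \<longrightarrow>
        (LINT x|lebesgue_on \<Omega>. u x *\<^sub>R gradient \<phi> x) = - (LINT x|lebesgue_on \<Omega>. \<phi> x *\<^sub>R Du x))"

text \<open>
  \<open>H1_0 \<Omega> u Du\<close>: the function \<open>u\<close> has (a representative of) its weak gradient \<open>Du\<close>, both
  are in \<open>L\<^sup>2(\<Omega>)\<close>, and \<open>u\<close> is in the closure of the test functions in the \<open>H\<^sup>1(\<Omega>)\<close> norm.
  The weak gradient is carried as an argument since it is unique only almost everywhere.
\<close>

definition H1_0 ::
  "(real ^ 'n) set \<Rightarrow> (real ^ 'n \<Rightarrow> real) \<Rightarrow> (real ^ 'n \<Rightarrow> real ^ 'n) \<Rightarrow> bool" where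
  "H1_0 \<Omega> u Du \<longleftrightarrow>
     square_integrable \<Omega> u \<and> square_integrable \<Omega> Du \<and> has_weak_gradient \<Omega> u Du \<and>
     (\<exists>\<phi>. (\<forall>k::nat. test_function \<Omega> (\<phi> k)) \<and>
        (\<lambda>k. (LINT x|lebesgue_on \<Omega>. (u x - \<phi> k x)\<^sup>2) +
             (LINT x|lebesgue_on \<Omega>. (norm (Du x - gradient (\<phi> k) x))\<^sup>2)) \<longlonglongrightarrow> 0)"

text \<open>
  Weak solutions of \<open>\<partial>\<^sub>i(a\<^sup>i\<^sup>j u\<^sub>j) + f(u) = 0\<close> in \<open>\<Omega>\<close>, \<open>u = 0\<close> on the boundary. The coefficients
  are only bounded and measurable, so the equation is read in divergence form against test
  functions, and the boundary condition is membership in \<open>H\<^sup>1\<^sub>0(\<Omega>)\<close>. No a priori bound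
  on \<open>u\<close> is part of the notion. The nonlinearity is a total function of which only the values
  on the nonnegative reals matter, because the solutions considered are positive.
\<close>

definition weak_solution ::
  "(real ^ 'n) set \<Rightarrow> (real ^ 'n \<Rightarrow> real ^ 'n ^ 'n) \<Rightarrow> (real \<Rightarrow> real) \<Rightarrow> (real ^ 'n \<Rightarrow> real) \<Rightarrow> bool" where
  "weak_solution \<Omega> a f u \<longleftrightarrow>
     (\<exists>Du. H1_0 \<Omega> u Du \<and> locally_integrable \<Omega> (\<lambda>x. f (u x)) \<and>
        (\<forall>\<phi>. test_function \<Omega> \<phi> \<longrightarrow>
           (LINT x|lebesgue_on \<Omega>. quad_form (a x) (gradient \<phi> x) (Du x)) =
           (LINT x|lebesgue_on \<Omega>. f (u x) * \<phi> x)))"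

text \<open>
  The argument \<open>f'\<close> is the derivative of the nonlinearity. Integrability of the left-hand side is
  part of the condition because the Bochner integral of a nonintegrable function is \<open>0\<close>; for
  \<open>f' \<ge> 0\<close> this is the inequality between integrals with values in \<open>[0,\<infinity>]\<close>.
\<close>

definition semistable ::
  "(real ^ 'n) set \<Rightarrow> (real ^ 'n \<Rightarrow> real ^ 'n ^ 'n) \<Rightarrow> (real \<Rightarrow> real) \<Rightarrow> (real ^ 'n \<Rightarrow> real) \<Rightarrow> bool" where
  "semistable \<Omega> a f' u \<longleftrightarrow>
     (\<forall>\<eta> D\<eta>. H1_0 \<Omega> \<eta> D\<eta> \<longrightarrow>
        integrable (lebesgue_on \<Omega>) (\<lambda>x. f' (u x) * (\<eta> x)\<^sup>2) \<and>
        (LINT x|lebesgue_on \<Omega>. f' (u x) * (\<eta> x)\<^sup>2) \<le>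
        (LINT x|lebesgue_on \<Omega>. quad_form (a x) (D\<eta> x) (D\<eta> x)))"

definition positive_semistable_solution ::
  "(real ^ 'n) set \<Rightarrow> (real ^ 'n \<Rightarrow> real ^ 'n ^ 'n) \<Rightarrow> (real \<Rightarrow> real) \<Rightarrow> (real \<Rightarrow> real) \<Rightarrow>
   (real ^ 'n \<Rightarrow> real) \<Rightarrow> bool" where
  "positive_semistable_solution \<Omega> a f f' u \<longleftrightarrow>
     weak_solution \<Omega> a f u \<and> (AE x in lebesgue_on \<Omega>. 0 < u x) \<and> semistable \<Omega> a f' u"

definition Linfty_norm :: "(real ^ 'n) set \<Rightarrow> (real ^ 'n \<Rightarrow> real) \<Rightarrow> ereal" where
  "Linfty_norm \<Omega> u = esssup (lebesgue_on \<Omega>) (\<lambda>x. ereal \<bar>u x\<bar>)"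

end

theory Submission
  imports Defs
begin

text \<open>
  Put \<open>V = f(u)/u\<close>, so that the equation reads \<open>- L u = V u\<close>. A solution of such an equation is
  bounded as soon as \<open>V\<close> is in \<open>L\<^sup>q\<close> on some level set \<open>{u > k}\<close> with \<open>q > n/2\<close>, and for \<open>n \<le> 5\<close> any
  \<open>q > 5/2\<close> will do. The proof produces such an \<open>L\<^sup>q\<close> bound from semistability, with
  constants that do not depend on \<open>u\<close>, and then runs a De Giorgi iteration.

  \<^emph>\<open>The integral bound.\<close> Semistability tested with \<open>g(u)\<close> and the equation tested with
  \<open>H(u)\<close>, where \<open>H(s) = \<integral>\<^sub>0\<^sup>s g'\<^sup>2\<close>, give \<open>\<integral> (f'(u) g(u)\<^sup>2 - f(u) H(u)) \<le> 0\<close>. For \<open>g = f - f(0)\<close> the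
  integrand equals \<open>f G - f(0) f' g\<close> with \<open>G(t) = \<integral>\<^sub>0\<^sup>t f'' (f - f(0))\<close>; since \<open>G\<close> dominates
  \<open>2 f(0) f'\<close> for large arguments (\<open>G_large\<close>), \<open>f(u) G(u)\<close> is bounded in \<open>L\<^sup>1\<close>. The growth condition, normalised to
  \<open>t\<^sup>2 f f'' \<ge> c f'\<^sup>p\<close> with \<open>p > 3/2\<close> (\<open>growth_condition_normalised\<close>), makes \<open>G\<close> grow at least like
  \<open>f\<^sup>p / t\<^sup>p\<^sup>+\<^sup>1\<close> (\<open>G_growth\<close>), hence \<open>f G \<ge> c (f/t)\<^sup>q\<close> with \<open>q = p + 1 > 5/2\<close>. As \<open>u\<close> is not known to
  be bounded, \<open>g\<close> is continued linearly beyond a level \<open>m\<close>; convexity of \<open>f\<close> keeps the integrand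
  bounded below by a constant that does not depend on \<open>m\<close> (\<open>semistability_gain\<close>).

  \<^emph>\<open>Admissible test functions.\<close> The weak equation only allows smooth test functions of compact
  support. Composing the test functions that approximate \<open>u\<close> with polynomials in \<open>tanh\<close> stays within
  that class and yields bounded functions of \<open>u\<close>; Fatou's lemma then shows that \<open>f(u)\<close> is integrable
  over \<open>\<Omega>\<close>, and Weierstrass approximation together with dominated convergence extends the equation
  to all the functions of \<open>u\<close> that occur (\<open>admissible_bounded\<close>, \<open>admissible_pos_part\<close>).

  \<^emph>\<open>Boundedness.\<close> The Sobolev inequality is replaced by a direct bound of \<open>\<integral> V w\<^sup>2\<close> by the energy of
  \<open>w\<close> for potentials whose means over cubes of side \<open>t\<close> are at most \<open>N t powr (- \<sigma>)\<close>, \<open>\<sigma> < 2\<close>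
  (\<open>trace_inequality_test_function\<close>). A potential in \<open>L\<^sup>q\<close>, \<open>q > n/2\<close>, is of this type, with \<open>N\<close> small
  when its total mass is small (\<open>morrey_bound\<close>). Applied to \<open>w = (u - k)\<^sup>+\<close> this gives a superlinear
  recursion for the masses of \<open>V\<close> over \<open>{u > k}\<close>. They are small for large \<open>k\<close>, uniformly in \<open>u\<close>,
  because \<open>f(s)/s \<rightarrow> \<infinity>\<close>; so they vanish at a level that depends only on the data
  (\<open>essentially_bounded\<close>).
\<close>

section \<open>Test functions and their compositions with bounded smooth functions\<close>

lemma Ck_on_Suc_imp: "Ck_on (Suc k) U g \<Longrightarrow> Ck_on k U g"
proof (induction k arbitrary: g)
  case 0
  then show ?case
    by (auto intro!: continuous_at_imp_continuous_on differentiable_imp_continuous_within)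
next
  case (Suc k)
  then show ?case by (metis Ck_on.simps(2))
qed

lemma Ck_on_add:
  "Ck_on k UNIV g \<Longrightarrow> Ck_on k UNIV h \<Longrightarrow> Ck_on k UNIV (\<lambda>x. g x + h x)"
proof (induction k arbitrary: g h)
  case 0
  then show ?case by (auto intro: continuous_intros)
next
  case (Suc k)
  have d: "g differentiable (at x)" "h differentiable (at x)" for x
    using Suc.prems by auto
  have "frechet_derivative (\<lambda>x. g x + h x) (at x) v
      = frechet_derivative g (at x) v + frechet_derivative h (at x) v" for x v
    using frechet_derivative_at[OF has_derivative_add[OF d[THEN frechet_derivative_works[THEN iffD1]]]]
    by (rule fun_cong[OF sym])
  then show ?case using Suc by (auto intro!: differentiable_add)
qed

lemma Ck_on_mult:
  "Ck_on k UNIV g \<Longrightarrow> Ck_on k UNIV h \<Longrightarrow> Ck_on k UNIV (\<lambda>x. g x * h x)"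
proof (induction k arbitrary: g h)
  case 0
  then show ?case by (auto intro: continuous_intros)
next
  case (Suc k)
  have d: "g differentiable (at x)" "h differentiable (at x)" for x
    using Suc.prems by auto
  have e: "frechet_derivative (\<lambda>x. g x * h x) (at x) v
      = g x * frechet_derivative h (at x) v + frechet_derivative g (at x) v * h x" for x v
    using frechet_derivative_at[OF has_derivative_mult[OF d[THEN frechet_derivative_works[THEN iffD1]]]]
    by (rule fun_cong[OF sym])
  have "Ck_on k UNIV g" "Ck_on k UNIV h"
    using Suc.prems by (metis Ck_on_Suc_imp)+
  then show ?case using Suc by (auto intro!: differentiable_mult Ck_on_add simp: e)
qed

lemma has_real_derivative_poly_tanh:
  "((\<lambda>s. poly P (tanh s)) has_real_derivative poly (pderiv P * [:1, 0, -1:]) (tanh s)) (at s)"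
  for s :: real
  by (auto intro!: derivative_eq_intros simp: power2_eq_square algebra_simps)

lemma has_derivative_poly_tanh_comp:
  assumes "(g has_derivative g') (at x)"
  shows "((\<lambda>x. poly P (tanh (g x :: real))) has_derivative
     (\<lambda>v. poly (pderiv P * [:1, 0, -1:]) (tanh (g x)) * g' v)) (at x)"
  using has_derivative_compose[OF assms has_real_derivative_poly_tanh[unfolded has_field_derivative_def]]
  by simp

text \<open>
  \<open>tanh' = 1 - tanh\<^sup>2\<close> is again a polynomial in \<open>tanh\<close>. A derivative of the composition is therefore
  a composition of the same kind times a derivative of \<open>g\<close>, and the induction is over all \<open>P\<close> at once.
\<close>

lemma Ck_on_poly_tanh:
  "Ck_on k UNIV g \<Longrightarrow> Ck_on k UNIV (\<lambda>x. poly P (tanh (g x)))"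
proof (induction k arbitrary: P)
  case 0
  then show ?case by (auto intro!: continuous_intros)
next
  case (Suc k)
  have d: "g differentiable (at x)" for x
    using Suc.prems by auto
  have D: "((\<lambda>x. poly P (tanh (g x))) has_derivative
     (\<lambda>v. poly (pderiv P * [:1, 0, -1:]) (tanh (g x)) * frechet_derivative g (at x) v)) (at x)" for x
    using has_derivative_poly_tanh_comp d frechet_derivative_works by blast
  have e: "frechet_derivative (\<lambda>x. poly P (tanh (g x))) (at x) v =
      poly (pderiv P * [:1, 0, -1:]) (tanh (g x)) * frechet_derivative g (at x) v"
    and d': "(\<lambda>x. poly P (tanh (g x))) differentiable (at x)" for x v
    using fun_cong[OF frechet_derivative_at[OF D, symmetric]] differentiableI[OF D] by blast+
  have "Ck_on k UNIV g" using Suc.prems by (rule Ck_on_Suc_imp)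
  then have "Ck_on k UNIV (\<lambda>x. poly (pderiv P * [:1, 0, -1:]) (tanh (g x)) * frechet_derivative g (at x) v)" for v
    using Suc.prems by (intro Ck_on_mult Suc.IH) auto
  then show ?case using d' unfolding Ck_on.simps e by blast
qed

lemma test_function_poly_tanh:
  assumes "test_function \<Omega> \<phi>" "poly P 0 = 0"
  shows "test_function \<Omega> (\<lambda>x. poly P (tanh (\<phi> x)))"
proof -
  have "{x. poly P (tanh (\<phi> x)) \<noteq> 0} \<subseteq> {x. \<phi> x \<noteq> 0}"
    using assms(2) by auto
  then have "closure {x. poly P (tanh (\<phi> x)) \<noteq> 0} \<subseteq> closure {x. \<phi> x \<noteq> 0}"
    by (rule closure_mono)
  moreover have "compact (closure {x. \<phi> x \<noteq> 0})" "closure {x. \<phi> x \<noteq> 0} \<subseteq> \<Omega>"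
    using assms(1) by (simp_all add: test_function_def)
  ultimately have "compact (closure {x. poly P (tanh (\<phi> x)) \<noteq> 0})"
    "closure {x. poly P (tanh (\<phi> x)) \<noteq> 0} \<subseteq> \<Omega>"
    using compact_Int_closed[OF _ closed_closure, of "closure {x. \<phi> x \<noteq> 0}"
        "{x. poly P (tanh (\<phi> x)) \<noteq> 0}"] by (simp_all add: inf_absorb2)
  moreover have "smooth_fun_on UNIV (\<lambda>x. poly P (tanh (\<phi> x)))"
    using assms(1) unfolding test_function_def smooth_fun_on_def by (blast intro: Ck_on_poly_tanh)
  ultimately show ?thesis
    unfolding test_function_def by blast
qed

lemma test_function_has_derivative:
  assumes "test_function \<Omega> \<phi>"
  shows "(\<phi> has_derivative (\<lambda>v. gradient \<phi> x \<bullet> v)) (at x)"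
proof -
  have "Ck_on (Suc 0) UNIV \<phi>"
    using assms by (auto simp: test_function_def smooth_fun_on_def)
  then have d: "(\<phi> has_derivative frechet_derivative \<phi> (at x)) (at x)"
    by (auto intro: frechet_derivative_works[THEN iffD1])
  then interpret linear "frechet_derivative \<phi> (at x)"
    by (rule has_derivative_linear)
  have "frechet_derivative \<phi> (at x) v = gradient \<phi> x \<bullet> v" for v
  proof -
    have "frechet_derivative \<phi> (at x) v = frechet_derivative \<phi> (at x) (\<Sum>i\<in>UNIV. v $ i *\<^sub>R axis i 1)"
      by (metis basis_expansion scalar_mult_eq_scaleR)
    also have "\<dots> = gradient \<phi> x \<bullet> v"
      by (simp add: sum scale inner_vec_def gradient_def mult.commute)
    finally show ?thesis .
  qed
  then show ?thesis using d by presburger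
qed

lemma gradient_eqI:
  assumes "(\<phi> has_derivative (\<lambda>v. w \<bullet> v)) (at x)"
  shows "gradient \<phi> x = w"
  using frechet_derivative_at[OF assms, symmetric]
  by (simp add: gradient_def vec_eq_iff inner_axis)

lemma test_function_continuous:
  assumes "test_function \<Omega> \<phi>"
  shows "continuous_on UNIV \<phi>" "continuous_on UNIV (gradient \<phi>)"
proof -
  have "Ck_on (Suc 0) UNIV \<phi>" "Ck_on 0 UNIV \<phi>"
    using assms unfolding test_function_def smooth_fun_on_def by blast+
  then show "continuous_on UNIV \<phi>" "continuous_on UNIV (gradient \<phi>)"
    unfolding gradient_def by (auto intro!: continuous_on_vec_lambda)
qed

lemma test_function_support:
  assumes "test_function \<Omega> \<phi>"
  obtains K where "compact K" "K \<subseteq> \<Omega>" "\<And>x. x \<notin> K \<Longrightarrow> \<phi> x = 0" "\<And>x. x \<notin> K \<Longrightarrow> gradient \<phi> x = 0"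
proof
  let ?K = "closure {x. \<phi> x \<noteq> 0}"
  show "compact ?K" "?K \<subseteq> \<Omega>" using assms unfolding test_function_def by blast+
  show z: "\<phi> x = 0" if "x \<notin> ?K" for x
    using that closure_subset[of "{x. \<phi> x \<noteq> 0}"] by auto
  show "gradient \<phi> x = 0" if "x \<notin> ?K" for x
  proof (rule gradient_eqI)
    have "((\<lambda>_. 0) has_derivative (\<lambda>v. 0)) (at x)" by simp
    then have "(\<phi> has_derivative (\<lambda>v. 0)) (at x)"
    proof (rule has_derivative_transform_within_open)
      show "open (- ?K)" by (rule open_Compl[OF closed_closure])
      show "x \<in> - ?K" using that by simp
      show "0 = \<phi> y" if "y \<in> - ?K" for y using z[OF ComplD[OF that]] by (rule sym)
    qed
    then show "(\<phi> has_derivative (\<lambda>v. 0 \<bullet> v)) (at x)" by simp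
  qed
qed

lemma gradient_poly_tanh:
  assumes "test_function \<Omega> \<phi>"
  shows "gradient (\<lambda>x. poly P (tanh (\<phi> x))) x
    = poly (pderiv P * [:1, 0, -1:]) (tanh (\<phi> x)) *\<^sub>R gradient \<phi> x"
  using has_derivative_poly_tanh_comp[OF test_function_has_derivative[OF assms], of P x]
  by (intro gradient_eqI) (simp only: inner_scaleR_left)

lemma integral_lebesgue_on_eq_lborel:
  fixes F :: "'a::euclidean_space \<Rightarrow> 'b::{banach, second_countable_topology}"
  assumes "F \<in> borel_measurable borel" "open \<Omega>" "\<And>x. x \<notin> \<Omega> \<Longrightarrow> F x = 0"
  shows "(LINT x|lebesgue_on \<Omega>. F x) = (LINT x|lborel. F x)"
proof -
  have "(LINT x|lebesgue_on \<Omega>. F x) = (LINT x|lebesgue. indicator \<Omega> x *\<^sub>R F x)"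
    using assms(2) by (intro integral_restrict_space) simp
  also have "\<dots> = (LINT x|lebesgue. F x)"
    using assms(3) by (intro Bochner_Integration.integral_cong) (auto simp: indicator_def)
  also have "\<dots> = (LINT x|lborel. F x)"
    using assms(1) by (intro integral_completion) simp
  finally show ?thesis .
qed

lemma continuous_compact_support_bounded:
  fixes g :: "'a::t2_space \<Rightarrow> 'b::real_normed_vector"
  assumes "continuous_on UNIV g" "compact K" "\<And>x. x \<notin> K \<Longrightarrow> g x = 0"
  obtains B where "0 < B" "\<And>x. norm (g x) \<le> B"
proof -
  have "bounded (g ` K)"
    using assms by (intro compact_imp_bounded compact_continuous_image) (auto intro: continuous_on_subset)
  then obtain B where "0 < B" and B: "\<And>y. y \<in> g ` K \<Longrightarrow> norm y \<le> B"
    unfolding bounded_pos by blast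
  show thesis
  proof (rule that[OF \<open>0 < B\<close>])
    show "norm (g x) \<le> B" for x
      using B[of "g x"] assms(3)[of x] \<open>0 < B\<close> by (cases "x \<in> K") auto
  qed
qed

lemma continuous_compact_support_integrable:
  fixes g :: "'a::euclidean_space \<Rightarrow> 'b::{banach, second_countable_topology}"
  assumes "continuous_on UNIV g" "compact K" "\<And>x. x \<notin> K \<Longrightarrow> g x = 0"
  shows "integrable lborel g"
proof -
  obtain B where B: "\<And>x. norm (g x) \<le> B"
    using continuous_compact_support_bounded[OF assms] by metis
  have "integrable lborel (\<lambda>x. indicator K x *\<^sub>R g x)"
    by (rule borel_integrable_compact[OF assms(2) continuous_on_subset[OF assms(1) subset_UNIV]])
  also have "(\<lambda>x. indicator K x *\<^sub>R g x) = g"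
    using assms(3) by (auto simp: indicator_def fun_eq_iff)
  finally show ?thesis .
qed

text \<open>
  The difference quotients integrate to zero, by translation invariance of Lebesgue measure, and they
  converge boundedly and with supports in a fixed ball.
\<close>

lemma integral_derivative_compact_support:
  fixes g :: "'a::euclidean_space \<Rightarrow> real"
  assumes der: "\<And>x. (g has_derivative (\<lambda>v. G x \<bullet> v)) (at x)"
    and cont: "continuous_on UNIV G" and K: "compact K"
    and g0: "\<And>x. x \<notin> K \<Longrightarrow> g x = 0" and G0: "\<And>x. x \<notin> K \<Longrightarrow> G x = 0"
  shows "(LINT x|lborel. G x \<bullet> e) = 0"
proof -
  obtain B where B: "0 < B" "\<And>x. norm (G x) \<le> B"
    using continuous_compact_support_bounded[OF cont K G0] by metis
  have cg: "continuous_on UNIV g"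
    using der by (meson continuous_at_imp_continuous_on has_derivative_continuous)
  have ig: "integrable lborel g"
    by (rule continuous_compact_support_integrable[OF cg K g0])
  have [measurable]: "g \<in> borel_measurable borel" "G \<in> borel_measurable borel"
    using cg cont by (auto intro: borel_measurable_continuous_onI)
  have shift: "integrable lborel (\<lambda>x. g (c + x))" "(LINT x|lborel. g (c + x)) = (LINT x|lborel. g x)" for c
  proof -
    have "integrable (distr lborel borel ((+) c)) g"
      unfolding lborel_distr_plus by (rule ig)
    then show "integrable lborel (\<lambda>x. g (c + x))"
      by (subst (asm) integrable_distr_eq) auto
    have "(LINT x|distr lborel borel ((+) c). g x) = (LINT x|lborel. g (c + x))"
      by (subst integral_distr) auto
    then show "(LINT x|lborel. g (c + x)) = (LINT x|lborel. g x)"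
      unfolding lborel_distr_plus by simp
  qed
  define D where "D k x = real (Suc k) * (g ((1 / real (Suc k)) *\<^sub>R e + x) - g x)" for k x
  have D0: "(LINT x|lborel. D k x) = 0" for k
    unfolding D_def using shift ig by (subst integral_mult_right_zero, subst Bochner_Integration.integral_diff) auto
  obtain R where R: "\<And>x. x \<in> K \<Longrightarrow> norm x \<le> R"
    using compact_imp_bounded[OF K] unfolding bounded_iff by blast
  have lim: "(\<lambda>k. D k x) \<longlonglongrightarrow> G x \<bullet> e" for x
  proof -
    have "((\<lambda>t. g (x + t *\<^sub>R e)) has_real_derivative G x \<bullet> e) (at 0)"
    proof -
      have "((\<lambda>t::real. x + t *\<^sub>R e) has_derivative (\<lambda>t. t *\<^sub>R e)) (at 0)"
        by (auto intro!: derivative_eq_intros)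
      moreover have "(g has_derivative (\<lambda>v. G x \<bullet> v)) (at (x + 0 *\<^sub>R e))"
        using der[of x] by simp
      ultimately have "((\<lambda>t. g (x + t *\<^sub>R e)) has_derivative (\<lambda>t. G x \<bullet> (t *\<^sub>R e))) (at 0)"
        by (rule has_derivative_compose)
      then show ?thesis
        by (simp add: has_field_derivative_def mult_commute_abs)
    qed
    then have "((\<lambda>h. (g (x + h *\<^sub>R e) - g x) / h) \<longlongrightarrow> G x \<bullet> e) (at 0)"
      unfolding DERIV_def by simp
    moreover have "filterlim (\<lambda>k. 1 / real (Suc k)) (at 0) sequentially"
      using LIMSEQ_Suc[OF lim_1_over_n[where 'a = real]] by (intro filterlim_atI) simp_all
    ultimately have "(\<lambda>k. (g (x + (1 / real (Suc k)) *\<^sub>R e) - g x) / (1 / real (Suc k))) \<longlonglongrightarrow> G x \<bullet> e"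
      by (rule filterlim_compose)
    moreover have "(g (x + (1 / real (Suc k)) *\<^sub>R e) - g x) / (1 / real (Suc k)) = D k x" for k
      by (simp add: D_def add.commute)
    ultimately show ?thesis by simp
  qed
  have lip: "\<bar>g y - g x\<bar> \<le> B * norm (y - x)" for x y
  proof -
    have "norm (g y - g x) \<le> B * norm (y - x)"
    proof (rule differentiable_bound[of UNIV g "\<lambda>x v. G x \<bullet> v"])
      show "onorm (\<lambda>v. G z \<bullet> v) \<le> B" for z
      proof (rule onorm_le)
        show "norm (G z \<bullet> v) \<le> B * norm v" for v
          using Cauchy_Schwarz_ineq2[of "G z" v] mult_right_mono[OF B(2)[of z] norm_ge_zero[of v]] by simp
      qed
      show "(g has_derivative (\<lambda>v. G z \<bullet> v)) (at z within UNIV)" for z by (rule der)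
    qed simp_all
    then show ?thesis by simp
  qed
  have bound: "norm (D k x) \<le> indicator (cball 0 (R + norm e)) x *\<^sub>R (B * norm e)" for k x
  proof (cases "norm x \<le> R + norm e")
    case True
    have "\<bar>D k x\<bar> = real (Suc k) * \<bar>g ((1 / real (Suc k)) *\<^sub>R e + x) - g x\<bar>"
      by (simp add: D_def abs_mult)
    also have "\<dots> \<le> real (Suc k) * (B * norm ((1 / real (Suc k)) *\<^sub>R e + x - x))"
      by (intro mult_left_mono lip) simp
    also have "\<dots> = B * norm e" by simp
    finally show ?thesis using True by simp
  next
    case False
    have "norm ((1 / real (Suc k)) *\<^sub>R e) \<le> norm e"
      using mult_right_mono[of "1 / real (Suc k)" 1 "norm e"] by simp
    then have "norm ((1 / real (Suc k)) *\<^sub>R e + x) > R" "norm x > R"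
      using False norm_triangle_ineq2[of x "- ((1 / real (Suc k)) *\<^sub>R e)"] norm_ge_zero[of e]
      unfolding norm_minus_cancel diff_minus_eq_add add.commute[of x] by linarith+
    then have "g ((1 / real (Suc k)) *\<^sub>R e + x) = 0" "g x = 0"
      using R g0 by (meson not_le)+
    then have "D k x = 0" by (simp add: D_def)
    then show ?thesis using B(1) by simp
  qed
  have "(\<lambda>k. LINT x|lborel. D k x) \<longlonglongrightarrow> (LINT x|lborel. G x \<bullet> e)"
  proof (rule integral_dominated_convergence[where w = "\<lambda>x. indicator (cball 0 (R + norm e)) x *\<^sub>R (B * norm e)"])
    show "integrable lborel (\<lambda>x. indicator (cball 0 (R + norm e)) x *\<^sub>R (B * norm e))"
      by (intro borel_integrable_compact compact_cball continuous_on_const)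
    show "AE x in lborel. (\<lambda>k. D k x) \<longlonglongrightarrow> G x \<bullet> e" using lim by simp
    show "AE x in lborel. norm (D k x) \<le> indicator (cball 0 (R + norm e)) x *\<^sub>R (B * norm e)" for k
      using bound by (rule AE_I2)
    show "(\<lambda>x. G x \<bullet> e) \<in> borel_measurable lborel" by measurable
    show "D k \<in> borel_measurable lborel" for k unfolding D_def by measurable
  qed
  then show ?thesis
    unfolding D0 by (rule LIMSEQ_unique[OF tendsto_const, symmetric])
qed

lemma test_function_borel:
  assumes "test_function \<Omega> \<phi>"
  shows "\<phi> \<in> borel_measurable borel" "gradient \<phi> \<in> borel_measurable borel"
  by (rule borel_measurable_continuous_onI, rule test_function_continuous[OF assms])+


lemma test_function_integration_by_parts:
  assumes \<phi>: "test_function \<Omega> \<phi>" and \<psi>: "test_function \<Omega> \<psi>" and "open \<Omega>"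
  shows "(LINT x|lebesgue_on \<Omega>. \<phi> x *\<^sub>R gradient \<psi> x) = - (LINT x|lebesgue_on \<Omega>. \<psi> x *\<^sub>R gradient \<phi> x)"
proof -
  note [measurable] = test_function_borel[OF \<phi>] test_function_borel[OF \<psi>]
  note cont = test_function_continuous[OF \<phi>] test_function_continuous[OF \<psi>]
  obtain K where K: "compact K" "K \<subseteq> \<Omega>" "\<And>x. x \<notin> K \<Longrightarrow> \<phi> x = 0" "\<And>x. x \<notin> K \<Longrightarrow> gradient \<phi> x = 0"
    using test_function_support[OF \<phi>] by metis
  have i1: "integrable lborel (\<lambda>x. \<phi> x *\<^sub>R gradient \<psi> x)"
    by (rule continuous_compact_support_integrable[OF _ K(1)]) (use K cont in \<open>auto intro: continuous_on_add continuous_on_scaleR\<close>)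
  have i2: "integrable lborel (\<lambda>x. \<psi> x *\<^sub>R gradient \<phi> x)"
    by (rule continuous_compact_support_integrable[OF _ K(1)]) (use K cont in \<open>auto intro: continuous_on_add continuous_on_scaleR\<close>)
  let ?G = "\<lambda>x. \<phi> x *\<^sub>R gradient \<psi> x + \<psi> x *\<^sub>R gradient \<phi> x"
  have "(LINT x|lborel. ?G x \<bullet> e) = 0" for e
  proof (rule integral_derivative_compact_support[OF _ _ K(1)])
    show "((\<lambda>x. \<phi> x * \<psi> x) has_derivative (\<lambda>v. ?G x \<bullet> v)) (at x)" for x
      using has_derivative_mult[OF test_function_has_derivative[OF \<phi>] test_function_has_derivative[OF \<psi>]]
      by (simp add: inner_add_left mult.commute)
  qed (use K cont in \<open>auto intro: continuous_on_add continuous_on_scaleR\<close>)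
  then have "(LINT x|lborel. ?G x) \<bullet> e = 0" for e
    using i1 i2 by (subst integral_inner_left[symmetric]) auto
  then have "(LINT x|lborel. ?G x) = 0"
    by (rule iffD1[OF inner_eq_zero_iff])
  then have "(LINT x|lborel. \<phi> x *\<^sub>R gradient \<psi> x) = - (LINT x|lborel. \<psi> x *\<^sub>R gradient \<phi> x)"
    using i1 i2 by (simp add: eq_neg_iff_add_eq_0)
  moreover have "x \<notin> \<Omega> \<Longrightarrow> x \<notin> K" for x using K(2) by blast
  ultimately show ?thesis
    using K \<open>open \<Omega>\<close>
    by (subst (1 2) integral_lebesgue_on_eq_lborel) auto
qed

section \<open>Closedness of the Sobolev space under approximation\<close>

lemma tendsto_zero_upper_bound:
  fixes a b :: "nat \<Rightarrow> real"
  assumes "\<And>k. 0 \<le> a k" "\<And>k. a k \<le> b k" "b \<longlonglongrightarrow> 0"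
  shows "a \<longlonglongrightarrow> 0"
  by (rule tendsto_sandwich[OF _ _ tendsto_const assms(3)]) (simp_all add: assms)

lemma L2_pairing:
  fixes f :: "'a \<Rightarrow> 'b::{banach, second_countable_topology}"
    and g :: "'a \<Rightarrow> 'c::{banach, second_countable_topology}"
  assumes [measurable]: "f \<in> borel_measurable M" "g \<in> borel_measurable M"
    and f: "integrable M (\<lambda>x. (norm (f x))\<^sup>2)" and g: "integrable M (\<lambda>x. (norm (g x))\<^sup>2)"
  shows "integrable M (\<lambda>x. norm (f x) * norm (g x))"
    and "(LINT x|M. norm (f x) * norm (g x))\<^sup>2 \<le> (LINT x|M. (norm (f x))\<^sup>2) * (LINT x|M. (norm (g x))\<^sup>2)"
proof -
  have "norm (f x) * norm (g x) \<le> (norm (f x))\<^sup>2 + (norm (g x))\<^sup>2" for x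
    using sum_squares_bound[of "norm (f x)" "norm (g x)"] mult_nonneg_nonneg[OF norm_ge_zero[of "f x"] norm_ge_zero[of "g x"]]
    by linarith
  then have "AE x in M. norm (norm (f x) * norm (g x)) \<le> norm ((norm (f x))\<^sup>2 + (norm (g x))\<^sup>2)"
    by (intro AE_I2) simp
  then show int: "integrable M (\<lambda>x. norm (f x) * norm (g x))"
    by (intro Bochner_Integration.integrable_bound[OF Bochner_Integration.integrable_add[OF f g]]) measurable
  have "(\<integral>\<^sup>+x. ennreal (norm (f x)) * ennreal (norm (g x)) \<partial>M) = ennreal (LINT x|M. norm (f x) * norm (g x))"
    using nn_integral_eq_integral[OF int] by (simp add: ennreal_mult)
  then have "ennreal ((LINT x|M. norm (f x) * norm (g x))\<^sup>2) = (\<integral>\<^sup>+x. ennreal (norm (f x)) * ennreal (norm (g x)) \<partial>M)\<^sup>2"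
    by (simp add: ennreal_power)
  also have "\<dots> \<le> (\<integral>\<^sup>+x. (ennreal (norm (f x)))\<^sup>2 \<partial>M) * (\<integral>\<^sup>+x. (ennreal (norm (g x)))\<^sup>2 \<partial>M)"
    by (rule Cauchy_Schwarz_nn_integral) measurable
  also have "\<dots> = (\<integral>\<^sup>+x. ennreal ((norm (f x))\<^sup>2) \<partial>M) * (\<integral>\<^sup>+x. ennreal ((norm (g x))\<^sup>2) \<partial>M)"
    by (simp add: ennreal_power)
  also have "\<dots> = ennreal ((LINT x|M. (norm (f x))\<^sup>2) * (LINT x|M. (norm (g x))\<^sup>2))"
    by (simp add: nn_integral_eq_integral[OF f] nn_integral_eq_integral[OF g] ennreal_mult)
  finally show "(LINT x|M. norm (f x) * norm (g x))\<^sup>2 \<le> (LINT x|M. (norm (f x))\<^sup>2) * (LINT x|M. (norm (g x))\<^sup>2)"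
    by (subst (asm) ennreal_le_iff) simp_all
qed

text \<open>
  By Cauchy-Schwarz, convergence in \<open>L\<^sup>2\<close> is enough to pass to the limit in an integral against a
  fixed \<open>L\<^sup>2\<close> function \<open>g\<close>. Integrands that are not literally products, such as \<open>quad_form\<close>, are
  covered by asking only for a pointwise bound of the difference.
\<close>

lemma tendsto_integral_L2_bound:
  fixes v :: "nat \<Rightarrow> 'a \<Rightarrow> 'b::{banach, second_countable_topology}"
    and g :: "'a \<Rightarrow> 'c::{banach, second_countable_topology}"
    and F :: "'a \<Rightarrow> 'd::{banach, second_countable_topology}"
  assumes v: "\<And>k. v k \<in> borel_measurable M" "\<And>k. integrable M (\<lambda>x. (norm (v k x))\<^sup>2)"
    and v0: "(\<lambda>k. LINT x|M. (norm (v k x))\<^sup>2) \<longlonglongrightarrow> 0"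
    and g: "g \<in> borel_measurable M" "integrable M (\<lambda>x. (norm (g x))\<^sup>2)"
    and F: "\<And>k. integrable M (Fk k)" "integrable M F"
    and le: "\<And>k. AE x in M. norm (Fk k x - F x) \<le> C * (norm (v k x) * norm (g x))"
  shows "(\<lambda>k. LINT x|M. Fk k x) \<longlonglongrightarrow> (LINT x|M. F x)"
proof -
  let ?P = "\<lambda>k. LINT x|M. norm (v k x) * norm (g x)"
  have "(\<lambda>k. sqrt ((LINT x|M. (norm (v k x))\<^sup>2) * (LINT x|M. (norm (g x))\<^sup>2))) \<longlonglongrightarrow> sqrt (0 * (LINT x|M. (norm (g x))\<^sup>2))"
    by (intro tendsto_intros v0)
  then have "?P \<longlonglongrightarrow> 0"
    by (intro tendsto_zero_upper_bound[OF _ real_le_rsqrt[OF L2_pairing(2)[OF v(1) g(1) v(2) g(2)]]]) simp_all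
  then have lim: "(\<lambda>k. C * ?P k) \<longlonglongrightarrow> 0"
    by (rule tendsto_mult_right_zero)
  have "norm ((LINT x|M. Fk k x) - (LINT x|M. F x)) \<le> C * ?P k" for k
  proof -
    have "norm ((LINT x|M. Fk k x) - (LINT x|M. F x)) = norm (LINT x|M. Fk k x - F x)"
      using F by simp
    also have "\<dots> \<le> (LINT x|M. norm (Fk k x - F x))"
      by (rule integral_norm_bound)
    also have "\<dots> \<le> (LINT x|M. C * (norm (v k x) * norm (g x)))"
      using F L2_pairing(1)[OF v(1) g(1) v(2) g(2)] le by (intro integral_mono_AE) simp_all
    finally show ?thesis by simp
  qed
  then have "(\<lambda>k. (LINT x|M. Fk k x) - (LINT x|M. F x)) \<longlonglongrightarrow> 0"
    by (intro Lim_null_comparison[OF _ lim]) simp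
  then show ?thesis by (rule LIM_zero_cancel)
qed

lemma borel_measurable_lebesgue_onI:
  "g \<in> borel_measurable borel \<Longrightarrow> g \<in> borel_measurable (lebesgue_on \<Omega>)"
  by (rule measurable_restrict_space1, rule measurable_completion) (simp only: measurable_lborel1 measurable_lborel2)

lemma (in finite_measure) integrable_if_norm_square_integrable:
  fixes g :: "'a \<Rightarrow> 'b::{banach, second_countable_topology}"
  assumes "g \<in> borel_measurable M" "integrable M (\<lambda>x. (norm (g x))\<^sup>2)"
  shows "integrable M g"
proof (rule Bochner_Integration.integrable_bound[OF Bochner_Integration.integrable_add[OF integrable_const[of "1::real"] assms(2)] assms(1)])
  have "norm (g x) \<le> 1 + (norm (g x))\<^sup>2" for x
    using sum_squares_bound[of "norm (g x)" 1] norm_ge_zero[of "g x"]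
    unfolding mult_1_right power_one by linarith
  then show "AE x in M. norm (g x) \<le> norm (1 + (norm (g x))\<^sup>2)"
    by (intro AE_I2) simp
qed

lemma integrable_lebesgue_on_subset:
  fixes g :: "'a::euclidean_space \<Rightarrow> 'b::{banach, second_countable_topology}"
  assumes "integrable (lebesgue_on \<Omega>) g" "\<Omega> \<in> sets lebesgue" "K \<in> sets lebesgue" "K \<subseteq> \<Omega>"
  shows "integrable (lebesgue_on K) g"
proof -
  have "integrable lebesgue (\<lambda>x. indicator \<Omega> x *\<^sub>R g x)"
    using assms by (simp add: integrable_restrict_space)
  from integrable_mult_indicator[OF assms(3) this]
  have "integrable lebesgue (\<lambda>x. indicator K x *\<^sub>R g x)"
    using assms(4) by (elim back_subst[of "integrable lebesgue"]) (auto simp: indicator_def fun_eq_iff)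
  then show ?thesis
    using assms by (simp add: integrable_restrict_space)
qed

lemma square_integrable_bounded:
  fixes g :: "real ^ 'n \<Rightarrow> 'b::euclidean_space"
  assumes "\<Omega> \<in> lmeasurable" "g \<in> borel_measurable (lebesgue_on \<Omega>)" "\<And>x. norm (g x) \<le> B"
  shows "square_integrable \<Omega> g"
proof -
  interpret finite_measure "lebesgue_on \<Omega>"
    by (rule finite_measure_lebesgue_on[OF assms(1)])
  have [measurable]: "g \<in> borel_measurable (lebesgue_on \<Omega>)" by fact
  have "integrable (lebesgue_on \<Omega>) (\<lambda>x. (norm (g x))\<^sup>2)"
  proof (rule integrable_const_bound[of _ "B\<^sup>2"])
    show "AE x in lebesgue_on \<Omega>. norm ((norm (g x))\<^sup>2) \<le> B\<^sup>2"
      using assms(3) by (intro AE_I2) (simp add: power_mono)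
  qed measurable
  then show ?thesis using assms(2) by (simp add: square_integrable_def)
qed

lemma test_function_bounded:
  assumes "test_function \<Omega> \<phi>"
  obtains B where "\<And>x. \<bar>\<phi> x\<bar> \<le> B" "\<And>x. norm (gradient \<phi> x) \<le> B"
proof -
  obtain K where K: "compact K" "\<And>x. x \<notin> K \<Longrightarrow> \<phi> x = 0" "\<And>x. x \<notin> K \<Longrightarrow> gradient \<phi> x = 0"
    using test_function_support[OF assms] by metis
  obtain B1 where B1: "\<And>x. norm (\<phi> x) \<le> B1"
    using continuous_compact_support_bounded[OF test_function_continuous(1)[OF assms] K(1,2)] by metis
  obtain B2 where B2: "\<And>x. norm (gradient \<phi> x) \<le> B2"
    using continuous_compact_support_bounded[OF test_function_continuous(2)[OF assms] K(1,3)] by metis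
  show thesis
  proof (rule that)
    show "\<bar>\<phi> x\<bar> \<le> max B1 B2" for x using B1[of x] by simp
    show "norm (gradient \<phi> x) \<le> max B1 B2" for x using B2[of x] by simp
  qed
qed

lemma test_function_square_integrable:
  assumes "test_function \<Omega> \<phi>" "\<Omega> \<in> lmeasurable"
  shows "square_integrable \<Omega> \<phi>" "square_integrable \<Omega> (gradient \<phi>)"
proof -
  obtain B where B: "\<And>x. \<bar>\<phi> x\<bar> \<le> B" "\<And>x. norm (gradient \<phi> x) \<le> B"
    using test_function_bounded[OF assms(1)] by metis
  show "square_integrable \<Omega> \<phi>"
    by (rule square_integrable_bounded[OF assms(2) borel_measurable_lebesgue_onI[OF test_function_borel(1)[OF assms(1)]], of B])
      (simp add: B)
  show "square_integrable \<Omega> (gradient \<phi>)"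
    by (rule square_integrable_bounded[OF assms(2) borel_measurable_lebesgue_onI[OF test_function_borel(2)[OF assms(1)]] B(2)])
qed

lemma square_integrable_add:
  fixes g h :: "real ^ 'n \<Rightarrow> 'b::euclidean_space"
  assumes "square_integrable \<Omega> g" "square_integrable \<Omega> h"
  shows "square_integrable \<Omega> (\<lambda>x. g x + h x)"
    and "(LINT x|lebesgue_on \<Omega>. (norm (g x + h x))\<^sup>2)
      \<le> 2 * (LINT x|lebesgue_on \<Omega>. (norm (g x))\<^sup>2) + 2 * (LINT x|lebesgue_on \<Omega>. (norm (h x))\<^sup>2)"
proof -
  have [measurable]: "g \<in> borel_measurable (lebesgue_on \<Omega>)" "h \<in> borel_measurable (lebesgue_on \<Omega>)"
    and i: "integrable (lebesgue_on \<Omega>) (\<lambda>x. 2 * (norm (g x))\<^sup>2 + 2 * (norm (h x))\<^sup>2)"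
    using assms by (simp_all add: square_integrable_def)
  have le: "(norm (g x + h x))\<^sup>2 \<le> 2 * (norm (g x))\<^sup>2 + 2 * (norm (h x))\<^sup>2" for x
  proof -
    have "(norm (g x + h x))\<^sup>2 \<le> (norm (g x) + norm (h x))\<^sup>2"
      by (rule power_mono[OF norm_triangle_ineq norm_ge_zero])
    also have "\<dots> \<le> 2 * (norm (g x))\<^sup>2 + 2 * (norm (h x))\<^sup>2"
      using sum_squares_bound[of "norm (g x)" "norm (h x)"] by (simp add: power2_sum)
    finally show ?thesis .
  qed
  have i': "integrable (lebesgue_on \<Omega>) (\<lambda>x. (norm (g x + h x))\<^sup>2)"
  proof (rule Bochner_Integration.integrable_bound[OF i])
    show "AE x in lebesgue_on \<Omega>. norm ((norm (g x + h x))\<^sup>2) \<le> norm (2 * (norm (g x))\<^sup>2 + 2 * (norm (h x))\<^sup>2)"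
      using le by (intro AE_I2) simp
  qed measurable
  then show "square_integrable \<Omega> (\<lambda>x. g x + h x)"
    by (simp add: square_integrable_def)
  have "(LINT x|lebesgue_on \<Omega>. (norm (g x + h x))\<^sup>2) \<le> (LINT x|lebesgue_on \<Omega>. 2 * (norm (g x))\<^sup>2 + 2 * (norm (h x))\<^sup>2)"
    using i i' le by (intro integral_mono) simp_all
  also have "\<dots> = 2 * (LINT x|lebesgue_on \<Omega>. (norm (g x))\<^sup>2) + 2 * (LINT x|lebesgue_on \<Omega>. (norm (h x))\<^sup>2)"
    using assms by (subst Bochner_Integration.integral_add) (simp_all add: square_integrable_def)
  finally show "(LINT x|lebesgue_on \<Omega>. (norm (g x + h x))\<^sup>2)
      \<le> 2 * (LINT x|lebesgue_on \<Omega>. (norm (g x))\<^sup>2) + 2 * (LINT x|lebesgue_on \<Omega>. (norm (h x))\<^sup>2)" .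
qed

lemma square_integrable_diff:
  fixes g h :: "real ^ 'n \<Rightarrow> 'b::euclidean_space"
  assumes "square_integrable \<Omega> g" "square_integrable \<Omega> h"
  shows "square_integrable \<Omega> (\<lambda>x. g x - h x)"
    and "(LINT x|lebesgue_on \<Omega>. (norm (g x - h x))\<^sup>2)
      \<le> 2 * (LINT x|lebesgue_on \<Omega>. (norm (g x))\<^sup>2) + 2 * (LINT x|lebesgue_on \<Omega>. (norm (h x))\<^sup>2)"
proof -
  have "square_integrable \<Omega> (\<lambda>x. - h x)"
    using assms(2) by (simp add: square_integrable_def)
  from square_integrable_add[OF assms(1) this]
  show "square_integrable \<Omega> (\<lambda>x. g x - h x)"
    "(LINT x|lebesgue_on \<Omega>. (norm (g x - h x))\<^sup>2)
      \<le> 2 * (LINT x|lebesgue_on \<Omega>. (norm (g x))\<^sup>2) + 2 * (LINT x|lebesgue_on \<Omega>. (norm (h x))\<^sup>2)"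
    by simp_all
qed

text \<open>
  Membership in \<open>H1_0\<close> only has to be checked by approximation: the weak gradient of the limit
  is inherited from the classical gradients of the approximating test functions.
\<close>

lemma H1_0_limit:
  fixes \<Omega> :: "(real ^ 'n) set"
  assumes \<Omega>: "open \<Omega>" "\<Omega> \<in> lmeasurable"
    and w: "square_integrable \<Omega> w" "square_integrable \<Omega> Dw"
    and \<psi>: "\<And>k. test_function \<Omega> (\<psi> k)"
    and lim: "(\<lambda>k. LINT x|lebesgue_on \<Omega>. (norm (\<psi> k x - w x))\<^sup>2) \<longlonglongrightarrow> 0"
      "(\<lambda>k. LINT x|lebesgue_on \<Omega>. (norm (gradient (\<psi> k) x - Dw x))\<^sup>2) \<longlonglongrightarrow> 0"
  shows "H1_0 \<Omega> w Dw"
proof -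
  interpret finite_measure "lebesgue_on \<Omega>"
    by (rule finite_measure_lebesgue_on[OF \<Omega>(2)])
  have s\<Omega>: "\<Omega> \<in> sets lebesgue" using \<Omega>(2) by (rule fmeasurableD)
  have int: "integrable (lebesgue_on \<Omega>) w" "integrable (lebesgue_on \<Omega>) Dw"
    using w by (auto simp: square_integrable_def intro: integrable_if_norm_square_integrable)
  have loc: "locally_integrable \<Omega> w" "locally_integrable \<Omega> Dw"
    unfolding locally_integrable_def
    using integrable_lebesgue_on_subset[OF int(1) s\<Omega>] integrable_lebesgue_on_subset[OF int(2) s\<Omega>]
    by (auto intro: lmeasurable_compact[THEN fmeasurableD])
  note sq\<psi> = test_function_square_integrable[OF \<psi> \<Omega>(2)]
  have weak: "(LINT x|lebesgue_on \<Omega>. w x *\<^sub>R gradient \<zeta> x) = - (LINT x|lebesgue_on \<Omega>. \<zeta> x *\<^sub>R Dw x)"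
    if \<zeta>: "test_function \<Omega> \<zeta>" for \<zeta>
  proof -
    note sq\<zeta> = test_function_square_integrable[OF \<zeta> \<Omega>(2)]
    have prod: "integrable (lebesgue_on \<Omega>) (\<lambda>x. g x *\<^sub>R h x)"
      if "square_integrable \<Omega> g" "square_integrable \<Omega> h" for g :: "real ^ 'n \<Rightarrow> real" and h :: "real ^ 'n \<Rightarrow> real ^ 'n"
    proof (rule Bochner_Integration.integrable_bound)
      have [measurable]: "g \<in> borel_measurable (lebesgue_on \<Omega>)" "h \<in> borel_measurable (lebesgue_on \<Omega>)"
        using that by (simp_all add: square_integrable_def)
      show "integrable (lebesgue_on \<Omega>) (\<lambda>x. norm (g x) * norm (h x))"
        using that by (intro L2_pairing) (simp_all add: square_integrable_def)
      show "(\<lambda>x. g x *\<^sub>R h x) \<in> borel_measurable (lebesgue_on \<Omega>)"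
        by measurable
    qed simp
    have "(\<lambda>k. LINT x|lebesgue_on \<Omega>. \<psi> k x *\<^sub>R gradient \<zeta> x) \<longlonglongrightarrow> (LINT x|lebesgue_on \<Omega>. w x *\<^sub>R gradient \<zeta> x)"
    proof (rule tendsto_integral_L2_bound[where v = "\<lambda>k x. \<psi> k x - w x" and g = "gradient \<zeta>" and C = 1])
      show "AE x in lebesgue_on \<Omega>. norm (\<psi> k x *\<^sub>R gradient \<zeta> x - w x *\<^sub>R gradient \<zeta> x)
          \<le> 1 * (norm (\<psi> k x - w x) * norm (gradient \<zeta> x))" for k
        by (simp add: scaleR_left_diff_distrib[symmetric])
    qed (use square_integrable_diff(1)[OF sq\<psi>(1) w(1)] sq\<zeta>(2) lim(1) prod[OF sq\<psi>(1) sq\<zeta>(2)] prod[OF w(1) sq\<zeta>(2)]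
        in \<open>simp_all add: square_integrable_def\<close>)
    moreover have "(\<lambda>k. LINT x|lebesgue_on \<Omega>. \<zeta> x *\<^sub>R gradient (\<psi> k) x) \<longlonglongrightarrow> (LINT x|lebesgue_on \<Omega>. \<zeta> x *\<^sub>R Dw x)"
    proof (rule tendsto_integral_L2_bound[where v = "\<lambda>k x. gradient (\<psi> k) x - Dw x" and g = \<zeta> and C = 1])
      show "AE x in lebesgue_on \<Omega>. norm (\<zeta> x *\<^sub>R gradient (\<psi> k) x - \<zeta> x *\<^sub>R Dw x)
          \<le> 1 * (norm (gradient (\<psi> k) x - Dw x) * norm (\<zeta> x))" for k
        by (simp add: scaleR_right_diff_distrib[symmetric])
    qed (use square_integrable_diff(1)[OF sq\<psi>(2) w(2)] sq\<zeta>(1) lim(2) prod[OF sq\<zeta>(1) sq\<psi>(2)] prod[OF sq\<zeta>(1) w(2)]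
        in \<open>simp_all add: square_integrable_def\<close>)
    then have "(\<lambda>k. - (LINT x|lebesgue_on \<Omega>. \<zeta> x *\<^sub>R gradient (\<psi> k) x)) \<longlonglongrightarrow> - (LINT x|lebesgue_on \<Omega>. \<zeta> x *\<^sub>R Dw x)"
      by (rule tendsto_minus)
    ultimately show ?thesis
      unfolding test_function_integration_by_parts[OF \<psi> \<zeta> \<Omega>(1)] by (rule LIMSEQ_unique)
  qed
  have "(\<lambda>k. (LINT x|lebesgue_on \<Omega>. (w x - \<psi> k x)\<^sup>2) +
             (LINT x|lebesgue_on \<Omega>. (norm (Dw x - gradient (\<psi> k) x))\<^sup>2)) \<longlonglongrightarrow> 0"
    using tendsto_add[OF lim] by (simp add: norm_minus_commute power2_commute)
  then show ?thesis
    unfolding H1_0_def has_weak_gradient_def using w loc weak \<psi> by blast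
qed

text \<open>One good test function is chosen for each member of the sequence.\<close>

lemma H1_0_closed:
  fixes \<Omega> :: "(real ^ 'n) set"
  assumes \<Omega>: "open \<Omega>" "\<Omega> \<in> lmeasurable"
    and w: "square_integrable \<Omega> w" "square_integrable \<Omega> Dw"
    and H: "\<And>k. H1_0 \<Omega> (v k) (Dv k)"
    and lim: "(\<lambda>k. LINT x|lebesgue_on \<Omega>. (norm (v k x - w x))\<^sup>2) \<longlonglongrightarrow> 0"
      "(\<lambda>k. LINT x|lebesgue_on \<Omega>. (norm (Dv k x - Dw x))\<^sup>2) \<longlonglongrightarrow> 0"
  shows "H1_0 \<Omega> w Dw"
proof -
  have "\<exists>\<psi>. test_function \<Omega> \<psi> \<and> (LINT x|lebesgue_on \<Omega>. (norm (\<psi> x - v k x))\<^sup>2) \<le> 1 / real (Suc k)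
      \<and> (LINT x|lebesgue_on \<Omega>. (norm (gradient \<psi> x - Dv k x))\<^sup>2) \<le> 1 / real (Suc k)" for k
  proof -
    obtain \<phi> where \<phi>: "\<And>j::nat. test_function \<Omega> (\<phi> j)"
      and l: "(\<lambda>j. (LINT x|lebesgue_on \<Omega>. (v k x - \<phi> j x)\<^sup>2) +
             (LINT x|lebesgue_on \<Omega>. (norm (Dv k x - gradient (\<phi> j) x))\<^sup>2)) \<longlonglongrightarrow> 0"
      using H[of k] unfolding H1_0_def by blast
    obtain j where j: "(LINT x|lebesgue_on \<Omega>. (v k x - \<phi> j x)\<^sup>2) +
             (LINT x|lebesgue_on \<Omega>. (norm (Dv k x - gradient (\<phi> j) x))\<^sup>2) < 1 / real (Suc k)"
      using eventually_happens[OF order_tendstoD(2)[OF l, of "1 / real (Suc k)"]] by auto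
    moreover have "0 \<le> (LINT x|lebesgue_on \<Omega>. (v k x - \<phi> j x)\<^sup>2)"
      "0 \<le> (LINT x|lebesgue_on \<Omega>. (norm (Dv k x - gradient (\<phi> j) x))\<^sup>2)"
      by simp_all
    ultimately have "(LINT x|lebesgue_on \<Omega>. (v k x - \<phi> j x)\<^sup>2) \<le> 1 / real (Suc k)"
      "(LINT x|lebesgue_on \<Omega>. (norm (Dv k x - gradient (\<phi> j) x))\<^sup>2) \<le> 1 / real (Suc k)"
      by linarith+
    then show ?thesis using \<phi>[of j] by (auto simp: norm_minus_commute power2_commute)
  qed
  then have "\<exists>\<psi>. \<forall>k. test_function \<Omega> (\<psi> k) \<and> (LINT x|lebesgue_on \<Omega>. (norm (\<psi> k x - v k x))\<^sup>2) \<le> 1 / real (Suc k)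
      \<and> (LINT x|lebesgue_on \<Omega>. (norm (gradient (\<psi> k) x - Dv k x))\<^sup>2) \<le> 1 / real (Suc k)"
    by (intro choice allI)
  then obtain \<psi> where \<psi>': "\<forall>k. test_function \<Omega> (\<psi> k) \<and> (LINT x|lebesgue_on \<Omega>. (norm (\<psi> k x - v k x))\<^sup>2) \<le> 1 / real (Suc k)
      \<and> (LINT x|lebesgue_on \<Omega>. (norm (gradient (\<psi> k) x - Dv k x))\<^sup>2) \<le> 1 / real (Suc k)" ..
  then have \<psi>: "\<And>k. test_function \<Omega> (\<psi> k)"
    and b1: "\<And>k. (LINT x|lebesgue_on \<Omega>. (norm (\<psi> k x - v k x))\<^sup>2) \<le> 1 / real (Suc k)"
    and b2: "\<And>k. (LINT x|lebesgue_on \<Omega>. (norm (gradient (\<psi> k) x - Dv k x))\<^sup>2) \<le> 1 / real (Suc k)"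
    by blast+
  have sqv: "square_integrable \<Omega> (v k)" "square_integrable \<Omega> (Dv k)" for k
    using H[of k] by (simp_all add: H1_0_def)
  note sq\<psi> = test_function_square_integrable[OF \<psi> \<Omega>(2)]
  have inv: "(\<lambda>k. 1 / real (Suc k)) \<longlonglongrightarrow> 0"
    using LIMSEQ_Suc[OF lim_1_over_n[where 'a = real]] by simp
  show ?thesis
  proof (rule H1_0_limit[OF \<Omega> w \<psi>])
    have le: "(LINT x|lebesgue_on \<Omega>. (norm (\<psi> k x - w x))\<^sup>2)
        \<le> 2 * (1 / real (Suc k)) + 2 * (LINT x|lebesgue_on \<Omega>. (norm (v k x - w x))\<^sup>2)" for k
      using square_integrable_add(2)[OF square_integrable_diff(1)[OF sq\<psi>(1)[of k] sqv(1)[of k]]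
          square_integrable_diff(1)[OF sqv(1)[of k] w(1)]] b1[of k] by simp
    have "(\<lambda>k. 2 * (1 / real (Suc k)) + 2 * (LINT x|lebesgue_on \<Omega>. (norm (v k x - w x))\<^sup>2)) \<longlonglongrightarrow> 2 * 0 + 2 * 0"
      by (intro tendsto_intros inv lim)
    then show "(\<lambda>k. LINT x|lebesgue_on \<Omega>. (norm (\<psi> k x - w x))\<^sup>2) \<longlonglongrightarrow> 0"
      by (intro tendsto_zero_upper_bound[OF _ le]) simp_all
    have le: "(LINT x|lebesgue_on \<Omega>. (norm (gradient (\<psi> k) x - Dw x))\<^sup>2)
        \<le> 2 * (1 / real (Suc k)) + 2 * (LINT x|lebesgue_on \<Omega>. (norm (Dv k x - Dw x))\<^sup>2)" for k
      using square_integrable_add(2)[OF square_integrable_diff(1)[OF sq\<psi>(2)[of k] sqv(2)[of k]]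
          square_integrable_diff(1)[OF sqv(2)[of k] w(2)]] b2[of k] by simp
    have "(\<lambda>k. 2 * (1 / real (Suc k)) + 2 * (LINT x|lebesgue_on \<Omega>. (norm (Dv k x - Dw x))\<^sup>2)) \<longlonglongrightarrow> 2 * 0 + 2 * 0"
      by (intro tendsto_intros inv lim)
    then show "(\<lambda>k. LINT x|lebesgue_on \<Omega>. (norm (gradient (\<psi> k) x - Dw x))\<^sup>2) \<longlonglongrightarrow> 0"
      by (intro tendsto_zero_upper_bound[OF _ le]) simp_all
  qed
qed

section \<open>Quadratic forms and local integrability\<close>

lemma quad_form_scaleR:
  "quad_form A (c *\<^sub>R \<xi>) \<zeta> = c * quad_form A \<xi> \<zeta>"
  "quad_form A \<xi> (c *\<^sub>R \<zeta>) = c * quad_form A \<xi> \<zeta>"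
  by (simp_all add: quad_form_def sum_distrib_left mult_ac)

lemma quad_form_diff: "quad_form A (\<xi> - \<xi>') \<zeta> = quad_form A \<xi> \<zeta> - quad_form A \<xi>' \<zeta>"
  by (simp add: quad_form_def sum_subtractf algebra_simps)

lemma quad_form_measurable:
  assumes "\<And>i j. (\<lambda>x. a x $ i $ j) \<in> borel_measurable M"
    and v: "v \<in> borel_measurable M" "w \<in> borel_measurable M"
  shows "(\<lambda>x. quad_form (a x) (v x) (w x)) \<in> borel_measurable M"
proof -
  have "(\<lambda>x. v x $ i) \<in> borel_measurable M" "(\<lambda>x. w x $ i) \<in> borel_measurable M" for i
    using borel_measurable_inner[OF v(1) borel_measurable_const[of "axis i 1"]]
      borel_measurable_inner[OF v(2) borel_measurable_const[of "axis i 1"]]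
    by (simp_all add: inner_axis)
  with assms(1) show ?thesis
    unfolding quad_form_def by (intro borel_measurable_sum borel_measurable_times)
qed

lemma quad_form_bounded:
  fixes A :: "real ^ 'n ^ 'n"
  assumes "\<And>i j. \<bar>A $ i $ j\<bar> \<le> m"
  shows "\<bar>quad_form A \<xi> \<zeta>\<bar> \<le> real (CARD('n)) * real (CARD('n)) * m * (norm \<xi> * norm \<zeta>)"
proof -
  have "\<bar>A $ i $ j * \<xi> $ i * \<zeta> $ j\<bar> \<le> m * (norm \<xi> * norm \<zeta>)" for i j
  proof -
    have "\<bar>A $ i $ j\<bar> * (\<bar>\<xi> $ i\<bar> * \<bar>\<zeta> $ j\<bar>) \<le> m * (norm \<xi> * norm \<zeta>)"
      using assms[of i j] component_le_norm_cart[of \<xi> i] component_le_norm_cart[of \<zeta> j]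
      by (intro mult_mono) auto
    then show ?thesis by (simp add: abs_mult mult.assoc)
  qed
  then have "(\<Sum>i\<in>UNIV. \<Sum>j\<in>UNIV. \<bar>A $ i $ j * \<xi> $ i * \<zeta> $ j\<bar>) \<le> (\<Sum>i\<in>(UNIV::'n set). \<Sum>j\<in>(UNIV::'n set). m * (norm \<xi> * norm \<zeta>))"
    by (intro sum_mono)
  moreover have "\<bar>quad_form A \<xi> \<zeta>\<bar> \<le> (\<Sum>i\<in>UNIV. \<Sum>j\<in>UNIV. \<bar>A $ i $ j * \<xi> $ i * \<zeta> $ j\<bar>)"
    unfolding quad_form_def by (rule order_trans[OF sum_abs sum_mono[OF sum_abs]])
  ultimately show ?thesis by simp
qed

lemma uniformly_elliptic_bounded:
  fixes a :: "real ^ 'n \<Rightarrow> real ^ 'n ^ 'n"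
  assumes "uniformly_elliptic \<Omega> a"
  obtains M where "0 \<le> M"
    "AE x in lebesgue_on \<Omega>. \<forall>\<xi> \<zeta>. \<bar>quad_form (a x) \<xi> \<zeta>\<bar> \<le> M * (norm \<xi> * norm \<zeta>)"
proof -
  have ex: "\<forall>i j. \<exists>m. AE x in lebesgue_on \<Omega>. \<bar>a x $ i $ j\<bar> \<le> m"
    using assms unfolding uniformly_elliptic_def by blast
  define m where "m i j = (SOME m. AE x in lebesgue_on \<Omega>. \<bar>a x $ i $ j\<bar> \<le> m)" for i j
  have m: "AE x in lebesgue_on \<Omega>. \<bar>a x $ i $ j\<bar> \<le> m i j" for i j
    unfolding m_def by (rule someI_ex[OF ex[rule_format]])
  define m' where "m' = Max (insert 0 (range (\<lambda>(i, j). m i j)))"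
  have fin: "finite (insert 0 (range (\<lambda>(i, j). m i j)))" by simp
  have m': "m i j \<le> m'" "0 \<le> m'" for i j
    unfolding m'_def by (rule Max_ge[OF fin], force)+
  have "AE x in lebesgue_on \<Omega>. \<forall>i\<in>UNIV. \<forall>j\<in>UNIV. \<bar>a x $ i $ j\<bar> \<le> m i j"
    by (intro AE_finite_allI finite m)
  then have ae: "AE x in lebesgue_on \<Omega>. \<forall>\<xi> \<zeta>. \<bar>quad_form (a x) \<xi> \<zeta>\<bar> \<le> real (CARD('n)) * real (CARD('n)) * m' * (norm \<xi> * norm \<zeta>)"
  proof (rule AE_mp, intro AE_I2 impI allI)
    fix x \<xi> \<zeta> assume "\<forall>i\<in>UNIV. \<forall>j\<in>UNIV. \<bar>a x $ i $ j\<bar> \<le> m i j"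
    then have "\<bar>a x $ i $ j\<bar> \<le> m'" for i j
      using m'(1)[of i j] order_trans by blast
    then show "\<bar>quad_form (a x) \<xi> \<zeta>\<bar> \<le> real (CARD('n)) * real (CARD('n)) * m' * (norm \<xi> * norm \<zeta>)"
      by (rule quad_form_bounded)
  qed
  show thesis by (rule that[OF _ ae]) (use m'(2) in simp)
qed

lemma integrable_locally_times_test_function:
  assumes \<Omega>: "open \<Omega>" and g: "locally_integrable \<Omega> g"
    and \<phi>: "test_function \<Omega> \<phi>"
  shows "integrable (lebesgue_on \<Omega>) (\<lambda>x. g x * \<phi> x)"
proof -
  obtain K where K: "compact K" "K \<subseteq> \<Omega>" "\<And>x. x \<notin> K \<Longrightarrow> \<phi> x = 0"
    using test_function_support[OF \<phi>] by metis
  obtain B where B: "\<And>x. \<bar>\<phi> x\<bar> \<le> B" using test_function_bounded[OF \<phi>] by metis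
  have sK: "K \<in> sets lebesgue" using K(1) by (rule lmeasurable_compact[THEN fmeasurableD])
  have s\<Omega>: "\<Omega> \<in> sets lebesgue" using \<Omega> by simp
  have "integrable (lebesgue_on K) g" using g K(1,2) by (simp add: locally_integrable_def)
  then have i: "integrable lebesgue (\<lambda>x. indicator K x *\<^sub>R g x)"
    using sK by (simp add: integrable_restrict_space)
  have m: "\<phi> \<in> borel_measurable lebesgue"
    using borel_measurable_lebesgue_onI[OF test_function_borel(1)[OF \<phi>], of UNIV] by (simp add: lebesgue_on_UNIV_eq)
  have "integrable lebesgue (\<lambda>x. (indicator K x *\<^sub>R g x) * \<phi> x)"
  proof (rule Bochner_Integration.integrable_bound[OF integrable_mult_right[OF i, of B]])
    show "(\<lambda>x. (indicator K x *\<^sub>R g x) * \<phi> x) \<in> borel_measurable lebesgue"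
      by (rule borel_measurable_times[OF borel_measurable_integrable[OF i] m])
    have "\<bar>(indicator K x *\<^sub>R g x) * \<phi> x\<bar> \<le> \<bar>B * (indicator K x *\<^sub>R g x)\<bar>" for x
    proof -
      have "\<bar>\<phi> x\<bar> \<le> \<bar>B\<bar>" using B[of x] by linarith
      then show ?thesis
        unfolding abs_mult by (metis abs_ge_zero mult.commute mult_right_mono)
    qed
    then show "AE x in lebesgue. norm ((indicator K x *\<^sub>R g x) * \<phi> x) \<le> norm (B * (indicator K x *\<^sub>R g x))"
      by (intro AE_I2) simp
  qed
  also have "(\<lambda>x. (indicator K x *\<^sub>R g x) * \<phi> x) = (\<lambda>x. indicator \<Omega> x *\<^sub>R (g x * \<phi> x))"
    using K(2,3) by (auto simp: indicator_def fun_eq_iff)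
  finally show ?thesis
    using s\<Omega> by (simp add: integrable_restrict_space)
qed

text \<open>
  Pointwise convergence, obtained by passing to a subsequence, is what Fatou's lemma and dominated
  convergence will act on.
\<close>

lemma H1_0_approx_AE:
  assumes "H1_0 \<Omega> u Du" "\<Omega> \<in> lmeasurable"
  obtains \<phi> where "\<And>k::nat. test_function \<Omega> (\<phi> k)"
    "(\<lambda>k. LINT x|lebesgue_on \<Omega>. (norm (\<phi> k x - u x))\<^sup>2) \<longlonglongrightarrow> 0"
    "(\<lambda>k. LINT x|lebesgue_on \<Omega>. (norm (gradient (\<phi> k) x - Du x))\<^sup>2) \<longlonglongrightarrow> 0"
    "AE x in lebesgue_on \<Omega>. (\<lambda>k. \<phi> k x) \<longlonglongrightarrow> u x"
proof -
  obtain \<phi> where \<phi>: "\<And>k::nat. test_function \<Omega> (\<phi> k)"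
    and lim: "(\<lambda>k. (LINT x|lebesgue_on \<Omega>. (u x - \<phi> k x)\<^sup>2) +
             (LINT x|lebesgue_on \<Omega>. (norm (Du x - gradient (\<phi> k) x))\<^sup>2)) \<longlonglongrightarrow> 0"
    using assms(1) unfolding H1_0_def by blast
  have lim1: "(\<lambda>k. LINT x|lebesgue_on \<Omega>. (norm (\<phi> k x - u x))\<^sup>2) \<longlonglongrightarrow> 0"
    by (rule tendsto_zero_upper_bound[OF _ _ lim]) (simp_all add: power2_commute)
  have lim2: "(\<lambda>k. LINT x|lebesgue_on \<Omega>. (norm (gradient (\<phi> k) x - Du x))\<^sup>2) \<longlonglongrightarrow> 0"
    by (rule tendsto_zero_upper_bound[OF _ _ lim]) (simp_all add: norm_minus_commute)
  have "square_integrable \<Omega> (\<lambda>x. \<phi> k x - u x)" for k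
    using assms test_function_square_integrable(1)[OF \<phi>] by (intro square_integrable_diff) (auto simp: H1_0_def)
  then have "\<exists>r::nat\<Rightarrow>nat. strict_mono r \<and> (AE x in lebesgue_on \<Omega>. (\<lambda>k. (norm (\<phi> (r k) x - u x))\<^sup>2) \<longlonglongrightarrow> 0)"
    using lim1 by (intro tendsto_L1_AE_subseq) (simp_all add: square_integrable_def)
  then obtain r where r: "strict_mono (r::nat\<Rightarrow>nat)"
    and ae: "AE x in lebesgue_on \<Omega>. (\<lambda>k. (norm (\<phi> (r k) x - u x))\<^sup>2) \<longlonglongrightarrow> 0" by blast
  show thesis
  proof (rule that[of "\<lambda>k. \<phi> (r k)"])
    show "(\<lambda>k. LINT x|lebesgue_on \<Omega>. (norm (\<phi> (r k) x - u x))\<^sup>2) \<longlonglongrightarrow> 0"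
      "(\<lambda>k. LINT x|lebesgue_on \<Omega>. (norm (gradient (\<phi> (r k)) x - Du x))\<^sup>2) \<longlonglongrightarrow> 0"
      using LIMSEQ_subseq_LIMSEQ[OF lim1 r] LIMSEQ_subseq_LIMSEQ[OF lim2 r] by (simp_all add: comp_def)
    have *: "(\<lambda>k. \<phi> (r k) x) \<longlonglongrightarrow> u x" if "(\<lambda>k. (norm (\<phi> (r k) x - u x))\<^sup>2) \<longlonglongrightarrow> 0" for x
    proof -
      have "(\<lambda>k. sqrt ((norm (\<phi> (r k) x - u x))\<^sup>2)) \<longlonglongrightarrow> sqrt 0"
        using that by (rule tendsto_real_sqrt)
      then have "(\<lambda>k. norm (\<phi> (r k) x - u x)) \<longlonglongrightarrow> 0" by simp
      then show ?thesis by (rule LIM_zero_cancel[OF tendsto_norm_zero_cancel])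
    qed
    show "AE x in lebesgue_on \<Omega>. (\<lambda>k. \<phi> (r k) x) \<longlonglongrightarrow> u x"
      by (rule eventually_mono[OF ae *])
  qed (rule \<phi>)
qed

lemma poly_tanh_bounded:
  obtains B where "0 \<le> B" "\<And>s::real. \<bar>poly Q (tanh s)\<bar> \<le> B"
proof -
  have "compact (poly Q ` {-1..1})"
    by (intro compact_continuous_image continuous_intros) simp
  then obtain B where B: "\<And>y. y \<in> poly Q ` {-1..1} \<Longrightarrow> norm y \<le> B"
    using compact_imp_bounded bounded_iff by metis
  have "\<bar>poly Q (tanh s)\<bar> \<le> B" for s :: real
    using B[of "poly Q (tanh s)"] tanh_real_bounds[of s] by auto
  moreover from this[of 0] have "0 \<le> B" by linarith
  ultimately show thesis using that by blast
qed

section \<open>Testing the equation with functions of the solution\<close>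

text \<open>
  A positive weak solution with a chosen representative \<open>Du\<close> of its weak gradient. The nonlinearity
  \<open>F\<close> is continuous on the whole line, so that \<open>F(u)\<close> is measurable whatever \<open>u\<close> does on a null set.
\<close>

locale elliptic_solution =
  fixes \<Omega> :: "(real ^ 'n) set" and a :: "real ^ 'n \<Rightarrow> real ^ 'n ^ 'n"
    and F :: "real \<Rightarrow> real" and u :: "real ^ 'n \<Rightarrow> real" and Du :: "real ^ 'n \<Rightarrow> real ^ 'n"
    and M\<^sub>0 :: real
  assumes open_dom: "open \<Omega>" and lmeas_dom: "\<Omega> \<in> lmeasurable"
    and a_meas: "\<And>i j. (\<lambda>x. a x $ i $ j) \<in> borel_measurable (lebesgue_on \<Omega>)"
    and a_bound: "AE x in lebesgue_on \<Omega>. \<forall>\<xi> \<zeta>. \<bar>quad_form (a x) \<xi> \<zeta>\<bar> \<le> M\<^sub>0 * (norm \<xi> * norm \<zeta>)"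
    and a_nonneg: "\<And>x \<xi>. x \<in> \<Omega> \<Longrightarrow> 0 \<le> quad_form (a x) \<xi> \<xi>"
    and H1: "H1_0 \<Omega> u Du"
    and u_pos: "AE x in lebesgue_on \<Omega>. 0 < u x"
    and F_cont: "continuous_on UNIV F" and F_nonneg: "\<And>s. 0 \<le> F s"
    and F_loc: "locally_integrable \<Omega> (\<lambda>x. F (u x))"
    and weak_eq: "\<And>\<phi>. test_function \<Omega> \<phi> \<Longrightarrow>
           (LINT x|lebesgue_on \<Omega>. quad_form (a x) (gradient \<phi> x) (Du x)) =
           (LINT x|lebesgue_on \<Omega>. F (u x) * \<phi> x)"
begin

sublocale dom: finite_measure "lebesgue_on \<Omega>"
  by (rule finite_measure_lebesgue_on[OF lmeas_dom])

abbreviation "Om \<equiv> lebesgue_on \<Omega>"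

lemma u_meas[measurable]: "u \<in> borel_measurable Om" "Du \<in> borel_measurable Om"
  and u_int: "integrable Om (\<lambda>x. (u x)\<^sup>2)" "integrable Om (\<lambda>x. (norm (Du x))\<^sup>2)"
  using H1 by (simp_all add: H1_0_def square_integrable_def)

lemma F_meas[measurable]: "F \<in> borel_measurable borel"
  by (rule borel_measurable_continuous_onI[OF F_cont])

lemma quad_meas[measurable]:
  "v \<in> borel_measurable Om \<Longrightarrow> w \<in> borel_measurable Om \<Longrightarrow> (\<lambda>x. quad_form (a x) (v x) (w x)) \<in> borel_measurable Om"
  by (rule quad_form_measurable[OF a_meas])

lemma quad_integrable:
  assumes "square_integrable \<Omega> v" "square_integrable \<Omega> w"
  shows "integrable Om (\<lambda>x. quad_form (a x) (v x) (w x))"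
proof (rule Bochner_Integration.integrable_bound)
  have m: "v \<in> borel_measurable Om" "w \<in> borel_measurable Om"
    using assms by (simp_all add: square_integrable_def)
  show "integrable Om (\<lambda>x. M\<^sub>0 * (norm (v x) * norm (w x)))"
    using assms by (intro integrable_mult_right L2_pairing m) (simp_all add: square_integrable_def)
  show "(\<lambda>x. quad_form (a x) (v x) (w x)) \<in> borel_measurable Om"
    by (rule quad_meas[OF m])
  show "AE x in Om. norm (quad_form (a x) (v x) (w x)) \<le> norm (M\<^sub>0 * (norm (v x) * norm (w x)))"
  proof (rule eventually_mono[OF a_bound])
    fix x assume "\<forall>\<xi> \<zeta>. \<bar>quad_form (a x) \<xi> \<zeta>\<bar> \<le> M\<^sub>0 * (norm \<xi> * norm \<zeta>)"
    then have "\<bar>quad_form (a x) (v x) (w x)\<bar> \<le> M\<^sub>0 * (norm (v x) * norm (w x))" by blast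
    then show "norm (quad_form (a x) (v x) (w x)) \<le> norm (M\<^sub>0 * (norm (v x) * norm (w x)))" by simp
  qed
qed

lemma sq_u: "square_integrable \<Omega> u" "square_integrable \<Omega> Du"
  using H1 by (simp_all add: H1_0_def)

lemma square_integrable_mult_bounded:
  fixes v :: "real ^ 'n \<Rightarrow> real ^ 'n"
  assumes "p \<in> borel_measurable Om" "AE x in Om. \<bar>p x\<bar> \<le> B" "square_integrable \<Omega> v"
  shows "square_integrable \<Omega> (\<lambda>x. p x *\<^sub>R v x)"
proof -
  have [measurable]: "p \<in> borel_measurable Om" "v \<in> borel_measurable Om"
    using assms by (simp_all add: square_integrable_def)
  have "integrable Om (\<lambda>x. (norm (p x *\<^sub>R v x))\<^sup>2)"
  proof (rule Bochner_Integration.integrable_bound[OF integrable_mult_right[of "B\<^sup>2" Om "\<lambda>x. (norm (v x))\<^sup>2"]])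
    show "AE x in Om. norm ((norm (p x *\<^sub>R v x))\<^sup>2) \<le> norm (B\<^sup>2 * (norm (v x))\<^sup>2)"
    proof (rule eventually_mono[OF assms(2)])
      fix x assume "\<bar>p x\<bar> \<le> B"
      then have "(p x)\<^sup>2 \<le> B\<^sup>2" by (metis abs_ge_zero power2_abs power_mono)
      then show "norm ((norm (p x *\<^sub>R v x))\<^sup>2) \<le> norm (B\<^sup>2 * (norm (v x))\<^sup>2)"
        by (simp add: power_mult_distrib mult_right_mono)
    qed
  qed (use assms(3) in \<open>simp_all add: square_integrable_def\<close>)
  then show ?thesis by (simp add: square_integrable_def)
qed

lemma quad_tendsto:
  assumes \<psi>: "\<And>k. square_integrable \<Omega> (w k)" "square_integrable \<Omega> Dw"
    and lim: "(\<lambda>k. LINT x|Om. (norm (w k x - Dw x))\<^sup>2) \<longlonglongrightarrow> 0"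
  shows "(\<lambda>k. LINT x|Om. quad_form (a x) (w k x) (Du x)) \<longlonglongrightarrow> (LINT x|Om. quad_form (a x) (Dw x) (Du x))"
proof (rule tendsto_integral_L2_bound[where v = "\<lambda>k x. w k x - Dw x" and g = Du and C = M\<^sub>0])
  show "AE x in Om. norm (quad_form (a x) (w k x) (Du x) - quad_form (a x) (Dw x) (Du x))
      \<le> M\<^sub>0 * (norm (w k x - Dw x) * norm (Du x))" for k
    by (rule eventually_mono[OF a_bound]) (simp add: quad_form_diff[symmetric])
  show "integrable Om (\<lambda>x. (norm (w k x - Dw x))\<^sup>2)" for k
    using square_integrable_diff(1)[OF \<psi>] by (simp add: square_integrable_def)
  show "(\<lambda>x. w k x - Dw x) \<in> borel_measurable Om" for k
    using square_integrable_diff(1)[OF \<psi>] by (simp add: square_integrable_def)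
qed (use u_meas u_int quad_integrable[OF \<psi>(1) sq_u(2)] quad_integrable[OF \<psi>(2) sq_u(2)] lim in simp_all)

text \<open>
  The equation may be tested with \<open>h(u)\<close>, whose gradient is \<open>p(u) Du\<close>. The function \<open>p\<close> stands for
  \<open>h'\<close> but is carried separately, since \<open>h\<close> may have corners.
\<close>

definition admissible :: "(real \<Rightarrow> real) \<Rightarrow> (real \<Rightarrow> real) \<Rightarrow> bool" where
  "admissible h p \<longleftrightarrow>
     H1_0 \<Omega> (\<lambda>x. h (u x)) (\<lambda>x. p (u x) *\<^sub>R Du x) \<and>
     integrable Om (\<lambda>x. F (u x) * h (u x)) \<and>
     (LINT x|Om. p (u x) * quad_form (a x) (Du x) (Du x)) = (LINT x|Om. F (u x) * h (u x))"

text \<open>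
  With \<open>h(s) = Q(tanh s)\<close>, \<open>p = h'\<close> and test functions \<open>\<phi>\<^sub>k\<close> approximating \<open>u\<close>, the test functions
  \<open>\<psi>\<^sub>k = h(\<phi>\<^sub>k)\<close> approximate \<open>h(u)\<close>, as \<open>h\<close> is Lipschitz. Their gradients differ from \<open>p(u) Du\<close> by
  \<open>p(\<phi>\<^sub>k) (\<nabla>\<phi>\<^sub>k - Du)\<close>, which is small since \<open>p\<close> is bounded, and \<open>(p(\<phi>\<^sub>k) - p(u)) Du\<close>, which is small by
  dominated convergence. The last conclusion is the weak equation for \<open>\<psi>\<^sub>k\<close> in the limit.
\<close>

lemma poly_tanh_approx:
  fixes Q :: "real poly"
  assumes Q0: "poly Q 0 = 0"
  defines "P \<equiv> pderiv Q * [:1, 0, -1:]"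
  obtains \<psi> B where "\<And>k::nat. test_function \<Omega> (\<psi> k)" "\<And>k x. \<bar>\<psi> k x\<bar> \<le> B"
    "\<And>k x. \<exists>s. \<psi> k x = poly Q (tanh s)"
    "AE x in Om. (\<lambda>k. \<psi> k x) \<longlonglongrightarrow> poly Q (tanh (u x))"
    "H1_0 \<Omega> (\<lambda>x. poly Q (tanh (u x))) (\<lambda>x. poly P (tanh (u x)) *\<^sub>R Du x)"
    "(\<lambda>k. LINT x|Om. F (u x) * \<psi> k x) \<longlonglongrightarrow>
      (LINT x|Om. poly P (tanh (u x)) * quad_form (a x) (Du x) (Du x))"
proof -
  obtain \<phi> where \<phi>: "\<And>k::nat. test_function \<Omega> (\<phi> k)"
    and l1: "(\<lambda>k. LINT x|Om. (norm (\<phi> k x - u x))\<^sup>2) \<longlonglongrightarrow> 0"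
    and l2: "(\<lambda>k. LINT x|Om. (norm (gradient (\<phi> k) x - Du x))\<^sup>2) \<longlonglongrightarrow> 0"
    and ae: "AE x in Om. (\<lambda>k. \<phi> k x) \<longlonglongrightarrow> u x"
    by (rule H1_0_approx_AE[OF H1 lmeas_dom]) blast
  obtain BQ where BQ: "0 \<le> BQ" "\<And>s::real. \<bar>poly Q (tanh s)\<bar> \<le> BQ" using poly_tanh_bounded by metis
  obtain B where B: "0 \<le> B" "\<And>s::real. \<bar>poly P (tanh s)\<bar> \<le> B" using poly_tanh_bounded by metis
  define h where "h s = poly Q (tanh s)" for s :: real
  define p where "p s = poly P (tanh s)" for s :: real
  have ch: "continuous_on UNIV h" "continuous_on UNIV p"
    unfolding h_def p_def by (intro continuous_intros; simp)+
  have [measurable]: "h \<in> borel_measurable borel" "p \<in> borel_measurable borel"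
    by (rule borel_measurable_continuous_onI[OF ch(1)], rule borel_measurable_continuous_onI[OF ch(2)])
  have lip: "\<bar>h s - h t\<bar> \<le> B * \<bar>s - t\<bar>" for s t
  proof -
    have "norm (h s - h t) \<le> B * norm (s - t)"
    proof (rule field_differentiable_bound[of UNIV h p])
      show "(h has_field_derivative p z) (at z within UNIV)" for z
        unfolding h_def p_def P_def by (rule has_real_derivative_poly_tanh)
      show "norm (p z) \<le> B" for z using B(2)[of z] by (simp add: p_def)
    qed simp_all
    then show ?thesis by simp
  qed
  define \<psi> where "\<psi> k x = h (\<phi> k x)" for k x
  have test: "test_function \<Omega> (\<psi> k)" for k
    unfolding \<psi>_def h_def by (rule test_function_poly_tanh[OF \<phi> Q0])
  have grad: "gradient (\<psi> k) x = p (\<phi> k x) *\<^sub>R gradient (\<phi> k) x" for k x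
    unfolding \<psi>_def h_def p_def P_def by (rule gradient_poly_tanh[OF \<phi>])
  have [measurable]: "\<phi> k \<in> borel_measurable Om" "gradient (\<phi> k) \<in> borel_measurable Om" for k
    using test_function_borel[OF \<phi>] by (simp_all add: borel_measurable_lebesgue_onI)
  have hp_meas: "(\<lambda>x. h (u x)) \<in> borel_measurable Om" "(\<lambda>x. p (u x)) \<in> borel_measurable Om"
    "(\<lambda>x. p (\<phi> k x)) \<in> borel_measurable Om" for k
    by measurable
  have bounds: "norm (h s) \<le> BQ" "\<bar>p s\<bar> \<le> B" for s
    using BQ(2) B(2) by (simp_all add: h_def p_def)
  have sqh: "square_integrable \<Omega> (\<lambda>x. h (u x))"
    by (rule square_integrable_bounded[OF lmeas_dom hp_meas(1) bounds(1)])
  have sqp: "square_integrable \<Omega> (\<lambda>x. p (u x) *\<^sub>R Du x)"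
    by (rule square_integrable_mult_bounded[OF hp_meas(2) AE_I2[OF bounds(2)] sq_u(2)])
  note sq\<phi> = test_function_square_integrable[OF \<phi> lmeas_dom]
  note sq\<psi> = test_function_square_integrable[OF test lmeas_dom]
  have L1: "(\<lambda>k. LINT x|Om. (norm (\<psi> k x - h (u x)))\<^sup>2) \<longlonglongrightarrow> 0"
  proof (rule tendsto_zero_upper_bound)
    show "(\<lambda>k. B\<^sup>2 * (LINT x|Om. (norm (\<phi> k x - u x))\<^sup>2)) \<longlonglongrightarrow> 0"
      by (rule tendsto_mult_right_zero[OF l1])
    show "(LINT x|Om. (norm (\<psi> k x - h (u x)))\<^sup>2) \<le> B\<^sup>2 * (LINT x|Om. (norm (\<phi> k x - u x))\<^sup>2)" for k
    proof -
      have "(LINT x|Om. (norm (\<psi> k x - h (u x)))\<^sup>2) \<le> (LINT x|Om. B\<^sup>2 * (norm (\<phi> k x - u x))\<^sup>2)"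
      proof (rule integral_mono)
        show "integrable Om (\<lambda>x. (norm (\<psi> k x - h (u x)))\<^sup>2)"
          using square_integrable_diff(1)[OF sq\<psi>(1) sqh] by (simp add: square_integrable_def)
        show "integrable Om (\<lambda>x. B\<^sup>2 * (norm (\<phi> k x - u x))\<^sup>2)"
          using square_integrable_diff(1)[OF sq\<phi>(1) sq_u(1)] by (simp add: square_integrable_def)
        show "(norm (\<psi> k x - h (u x)))\<^sup>2 \<le> B\<^sup>2 * (norm (\<phi> k x - u x))\<^sup>2" for x
          using power_mono[OF lip[of "\<phi> k x" "u x"], of 2] by (simp add: \<psi>_def power_mult_distrib)
      qed
      then show ?thesis by simp
    qed
  qed simp
  define e where "e k x = (p (\<phi> k x) - p (u x)) *\<^sub>R Du x" for k x
  have e_meas[measurable]: "e k \<in> borel_measurable Om" for k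
    unfolding e_def by measurable
  have e_le: "(norm (e k x))\<^sup>2 \<le> (2 * B)\<^sup>2 * (norm (Du x))\<^sup>2" for k x
  proof -
    have "\<bar>p (\<phi> k x) - p (u x)\<bar> \<le> 2 * B"
      using B(2)[of "\<phi> k x"] B(2)[of "u x"] unfolding p_def by linarith
    then have "\<bar>p (\<phi> k x) - p (u x)\<bar>\<^sup>2 \<le> (2 * B)\<^sup>2" by (intro power_mono) simp_all
    then show ?thesis by (simp add: e_def power_mult_distrib mult_right_mono)
  qed
  have lim_e: "(\<lambda>k. LINT x|Om. (norm (e k x))\<^sup>2) \<longlonglongrightarrow> (LINT x|Om. 0)"
  proof (rule integral_dominated_convergence[where w = "\<lambda>x. (2 * B)\<^sup>2 * (norm (Du x))\<^sup>2"])
    show "integrable Om (\<lambda>x. (2 * B)\<^sup>2 * (norm (Du x))\<^sup>2)" using u_int(2) by simp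
    show "AE x in Om. (\<lambda>k. (norm (e k x))\<^sup>2) \<longlonglongrightarrow> 0"
    proof (rule eventually_mono[OF ae])
      fix x assume x: "(\<lambda>k. \<phi> k x) \<longlonglongrightarrow> u x"
      have "isCont p (u x)" using ch(2) by (simp add: continuous_on_eq_continuous_at)
      then have "(\<lambda>k. p (\<phi> k x)) \<longlonglongrightarrow> p (u x)" using x by (rule isCont_tendsto_compose)
      then have "(\<lambda>k. (norm ((p (\<phi> k x) - p (u x)) *\<^sub>R Du x))\<^sup>2) \<longlonglongrightarrow> (norm ((p (u x) - p (u x)) *\<^sub>R Du x))\<^sup>2"
        by (intro tendsto_intros)
      then show "(\<lambda>k. (norm (e k x))\<^sup>2) \<longlonglongrightarrow> 0" by (simp add: e_def)
    qed
    show "AE x in Om. norm ((norm (e k x))\<^sup>2) \<le> (2 * B)\<^sup>2 * (norm (Du x))\<^sup>2" for k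
      using e_le[of k] by (intro AE_I2) simp
  qed measurable
  have sq_e: "square_integrable \<Omega> (e k)" for k
  proof -
    have "integrable Om (\<lambda>x. (norm (e k x))\<^sup>2)"
      using e_le[of k] by (intro Bochner_Integration.integrable_bound[OF integrable_mult_right[OF u_int(2), of "(2*B)\<^sup>2"]])
         (auto intro!: AE_I2)
    then show ?thesis by (simp add: square_integrable_def)
  qed
  define d where "d k x = p (\<phi> k x) *\<^sub>R (gradient (\<phi> k) x - Du x)" for k x
  have d_meas[measurable]: "d k \<in> borel_measurable Om" for k
    unfolding d_def by measurable
  have sq_d: "square_integrable \<Omega> (d k)" for k
    unfolding d_def
    by (rule square_integrable_mult_bounded[OF hp_meas(3) AE_I2[OF bounds(2)] square_integrable_diff(1)[OF sq\<phi>(2) sq_u(2)]])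
  have lim_d: "(\<lambda>k. LINT x|Om. (norm (d k x))\<^sup>2) \<longlonglongrightarrow> 0"
  proof (rule tendsto_zero_upper_bound)
    show "(\<lambda>k. B\<^sup>2 * (LINT x|Om. (norm (gradient (\<phi> k) x - Du x))\<^sup>2)) \<longlonglongrightarrow> 0"
      by (rule tendsto_mult_right_zero[OF l2])
    show "(LINT x|Om. (norm (d k x))\<^sup>2) \<le> B\<^sup>2 * (LINT x|Om. (norm (gradient (\<phi> k) x - Du x))\<^sup>2)" for k
    proof -
      have "(LINT x|Om. (norm (d k x))\<^sup>2) \<le> (LINT x|Om. B\<^sup>2 * (norm (gradient (\<phi> k) x - Du x))\<^sup>2)"
      proof (rule integral_mono)
        show "integrable Om (\<lambda>x. (norm (d k x))\<^sup>2)" using sq_d[of k] by (simp add: square_integrable_def)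
        show "integrable Om (\<lambda>x. B\<^sup>2 * (norm (gradient (\<phi> k) x - Du x))\<^sup>2)"
          using square_integrable_diff(1)[OF sq\<phi>(2) sq_u(2)] by (simp add: square_integrable_def)
        have "\<bar>p (\<phi> k x)\<bar>\<^sup>2 \<le> B\<^sup>2" for x
          using B(2)[of "\<phi> k x"] by (intro power_mono) (simp_all add: p_def)
        then show "(norm (d k x))\<^sup>2 \<le> B\<^sup>2 * (norm (gradient (\<phi> k) x - Du x))\<^sup>2" for x
          by (simp add: d_def power_mult_distrib mult_right_mono)
      qed
      then show ?thesis by simp
    qed
  qed simp
  have L2: "(\<lambda>k. LINT x|Om. (norm (gradient (\<psi> k) x - p (u x) *\<^sub>R Du x))\<^sup>2) \<longlonglongrightarrow> 0"
  proof (rule tendsto_zero_upper_bound)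
    show "(\<lambda>k. 2 * (LINT x|Om. (norm (d k x))\<^sup>2) + 2 * (LINT x|Om. (norm (e k x))\<^sup>2)) \<longlonglongrightarrow> 0"
      using tendsto_add[OF tendsto_mult_right_zero[OF lim_d, of 2] tendsto_mult_right_zero[of "\<lambda>k. LINT x|Om. (norm (e k x))\<^sup>2" _ 2]] lim_e
      by simp
    have "gradient (\<psi> k) x - p (u x) *\<^sub>R Du x = d k x + e k x" for k x
      by (simp add: grad d_def e_def algebra_simps)
    then show "(LINT x|Om. (norm (gradient (\<psi> k) x - p (u x) *\<^sub>R Du x))\<^sup>2)
        \<le> 2 * (LINT x|Om. (norm (d k x))\<^sup>2) + 2 * (LINT x|Om. (norm (e k x))\<^sup>2)" for k
      using square_integrable_add(2)[OF sq_d sq_e] by simp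
  qed simp
  show thesis
  proof (rule that[of \<psi> BQ])
    show "test_function \<Omega> (\<psi> k)" for k by (rule test)
    show "\<bar>\<psi> k x\<bar> \<le> BQ" for k x using BQ(2)[of "\<phi> k x"] by (simp add: \<psi>_def h_def)
    show "\<exists>s. \<psi> k x = poly Q (tanh s)" for k x unfolding \<psi>_def h_def by blast
    show "AE x in Om. (\<lambda>k. \<psi> k x) \<longlonglongrightarrow> poly Q (tanh (u x))"
    proof (rule eventually_mono[OF ae])
      fix x assume x: "(\<lambda>k. \<phi> k x) \<longlonglongrightarrow> u x"
      have "isCont h (u x)" using ch(1) by (simp add: continuous_on_eq_continuous_at)
      then show "(\<lambda>k. \<psi> k x) \<longlonglongrightarrow> poly Q (tanh (u x))"
        unfolding \<psi>_def h_def[symmetric] using x by (rule isCont_tendsto_compose)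
    qed
    show "H1_0 \<Omega> (\<lambda>x. poly Q (tanh (u x))) (\<lambda>x. poly P (tanh (u x)) *\<^sub>R Du x)"
      using H1_0_limit[OF open_dom lmeas_dom sqh sqp test L1 L2] by (simp add: h_def p_def)
    show "(\<lambda>k. LINT x|Om. F (u x) * \<psi> k x) \<longlonglongrightarrow>
        (LINT x|Om. poly P (tanh (u x)) * quad_form (a x) (Du x) (Du x))"
      using quad_tendsto[OF sq\<psi>(2) sqp L2] unfolding weak_eq[OF test] quad_form_scaleR by (simp add: p_def)
  qed
qed

end

lemma Fatou_integrable:
  fixes g :: "nat \<Rightarrow> 'a \<Rightarrow> real"
  assumes g: "\<And>k. integrable M (g k)" and nn: "\<And>k. AE x in M. 0 \<le> g k x"
    and ae: "AE x in M. (\<lambda>k. g k x) \<longlonglongrightarrow> G x" and G: "G \<in> borel_measurable M"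
    and le: "\<And>k. (LINT x|M. g k x) \<le> L k" and L: "L \<longlonglongrightarrow> l"
  shows "integrable M G" "(LINT x|M. G x) \<le> l"
proof -
  have [measurable]: "g k \<in> borel_measurable M" for k using g by (rule borel_measurable_integrable)
  have nn_all: "AE x in M. \<forall>k. 0 \<le> g k x" using nn by (simp add: AE_all_countable)
  have Gnn: "AE x in M. 0 \<le> G x"
    using ae nn_all
  proof eventually_elim
    case (elim x)
    then show ?case by (intro LIMSEQ_le_const[of "\<lambda>k. g k x" "G x" 0]) auto
  qed
  have "(\<integral>\<^sup>+x. ennreal (G x) \<partial>M) = (\<integral>\<^sup>+x. liminf (\<lambda>k. ennreal (g k x)) \<partial>M)"
  proof (rule nn_integral_cong_AE, rule eventually_mono[OF ae])
    fix x assume "(\<lambda>k. g k x) \<longlonglongrightarrow> G x"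
    then have "(\<lambda>k. ennreal (g k x)) \<longlonglongrightarrow> ennreal (G x)" by (rule tendsto_ennrealI)
    then show "ennreal (G x) = liminf (\<lambda>k. ennreal (g k x))"
      by (intro lim_imp_Liminf[symmetric]) simp_all
  qed
  also have "\<dots> \<le> liminf (\<lambda>k. \<integral>\<^sup>+x. ennreal (g k x) \<partial>M)"
    by (rule nn_integral_liminf) measurable
  also have "\<dots> \<le> liminf (\<lambda>k. ennreal (L k))"
  proof (rule Liminf_mono, intro always_eventually allI)
    fix k
    show "(\<integral>\<^sup>+x. ennreal (g k x) \<partial>M) \<le> ennreal (L k)"
      using nn_integral_eq_integral[OF g[of k] nn[of k]] le[of k] by (simp add: ennreal_leI)
  qed
  also have "\<dots> = ennreal l"
    using L by (intro lim_imp_Liminf tendsto_ennrealI) simp_all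
  finally have bd: "(\<integral>\<^sup>+x. ennreal (G x) \<partial>M) \<le> ennreal l" .
  show int: "integrable M G"
    using bd by (intro integrableI_nonneg G Gnn) (simp add: order_le_less_trans ennreal_less_top)
  have "0 \<le> (LINT x|M. g k x)" for k using nn by (rule integral_nonneg_AE)
  then have "0 \<le> l" using L le by (intro LIMSEQ_le_const[OF L]) (meson order_trans)
  then show "(LINT x|M. G x) \<le> l"
    using bd nn_integral_eq_integral[OF int Gnn] by (simp add: ennreal_le_iff)
qed

lemma poly_antiderivative:
  fixes P :: "real poly"
  obtains Q where "pderiv Q = P" "poly Q 0 = 0"
proof
  let ?Q = "pCons 0 (Poly (map (\<lambda>i. coeff P i / real (Suc i)) [0..<Suc (degree P)]))"
  show "pderiv ?Q = P"
  proof (rule poly_eqI)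
    fix n
    show "coeff (pderiv ?Q) n = coeff P n"
      by (simp add: coeff_pderiv coeff_Poly_eq nth_default_def coeff_eq_0 del: upt_Suc)
  qed
  show "poly ?Q 0 = 0" by simp
qed

text \<open>The argument is truncated at \<open>0\<close> so that a primitive is continuous on the whole line.\<close>

definition primitive :: "(real \<Rightarrow> real) \<Rightarrow> real \<Rightarrow> real" where
  "primitive p s = integral {0..max 0 s} p"

lemma primitive_0[simp]: "primitive p 0 = 0"
  by (simp add: primitive_def)

lemma primitive_has_derivative:
  assumes "continuous_on UNIV p" "0 \<le> s"
  shows "(primitive p has_real_derivative p s) (at s within {0..})"
proof -
  have "((\<lambda>y. integral {0..y} p) has_real_derivative p s) (at s within {0..s + 1})"
    using assms by (intro integral_has_real_derivative continuous_on_subset[OF assms(1)]) auto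
  moreover have "at s within {0..s + 1} = at s within {0..}"
    by (rule at_within_nhd[of s "{..<s + 1}"]) auto
  ultimately have "((\<lambda>y. integral {0..y} p) has_real_derivative p s) (at s within {0..})" by simp
  then show ?thesis
    by (rule has_field_derivative_transform_within[of _ _ _ _ 1]) (use assms(2) in \<open>auto simp: primitive_def max_def\<close>)
qed

lemma primitive_continuous:
  assumes "continuous_on UNIV p"
  shows "continuous_on UNIV (primitive p)"
proof -
  have "continuous_on {0..} (primitive p)"
    using primitive_has_derivative[OF assms] by (auto intro!: DERIV_continuous_on)
  then have "continuous_on UNIV (\<lambda>s. primitive p (max 0 s))"
    by (rule continuous_on_compose2) (auto intro!: continuous_intros)
  moreover have "primitive p (max 0 s) = primitive p s" for s by (simp add: primitive_def)
  ultimately show ?thesis by simp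
qed

lemma derivative_bound_nonneg_axis:
  fixes h p :: "real \<Rightarrow> real"
  assumes "\<And>s. 0 \<le> s \<Longrightarrow> (h has_real_derivative p s) (at s within {0..})"
    and "\<And>s. 0 \<le> s \<Longrightarrow> \<bar>p s\<bar> \<le> B" "h 0 = 0" "0 \<le> s"
  shows "\<bar>h s\<bar> \<le> B * s"
proof -
  have "norm (h s - h 0) \<le> B * norm (s - 0)"
    by (rule field_differentiable_bound[of "{0..}" h p]) (use assms in auto)
  with assms show ?thesis by simp
qed

lemma primitive_cong:
  "0 \<le> s \<Longrightarrow> (\<And>t. 0 \<le> t \<Longrightarrow> t \<le> s \<Longrightarrow> p t = q t) \<Longrightarrow> primitive p s = primitive q s"
  unfolding primitive_def by (rule integral_cong) simp

lemma primitive_nonneg: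
  "continuous_on UNIV p \<Longrightarrow> (\<And>t. 0 \<le> t \<Longrightarrow> 0 \<le> p t) \<Longrightarrow> 0 \<le> primitive p s"
  unfolding primitive_def
  by (rule integral_nonneg) (auto intro: integrable_continuous_real continuous_on_subset)

lemma primitive_1: "0 \<le> s \<Longrightarrow> primitive (\<lambda>_. 1) s = s"
  by (simp add: primitive_def)

context elliptic_solution
begin

text \<open>
  Testing with the nonnegative \<open>tanh\<^sup>2(u)\<close> makes sense up to Fatou's lemma, which only needs local
  integrability of \<open>F(u)\<close>. It controls \<open>F(u)\<close> where \<open>u > 1\<close>; elsewhere \<open>F(u)\<close> is bounded.
\<close>

lemma F_integrable: "integrable Om (\<lambda>x. F (u x))"
proof -
  obtain \<psi> B where \<psi>: "\<And>k::nat. test_function \<Omega> (\<psi> k)"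
    and val: "\<And>k x. \<exists>s. \<psi> k x = poly [:0, 0, 1:] (tanh s)"
    and ae: "AE x in Om. (\<lambda>k. \<psi> k x) \<longlonglongrightarrow> poly [:0, 0, 1:] (tanh (u x))"
    and lim: "(\<lambda>k. LINT x|Om. F (u x) * \<psi> k x) \<longlonglongrightarrow>
      (LINT x|Om. poly (pderiv [:0, 0, 1:] * [:1, 0, -1:]) (tanh (u x)) * quad_form (a x) (Du x) (Du x))"
    by (rule poly_tanh_approx[of "[:0, 0, 1:]"]) (simp, blast)
  have int: "integrable Om (\<lambda>x. F (u x) * (tanh (u x))\<^sup>2)"
  proof (rule Fatou_integrable(1)[OF _ _ _ _ order_refl lim])
    show "integrable Om (\<lambda>x. F (u x) * \<psi> k x)" for k
      by (rule integrable_locally_times_test_function[OF open_dom F_loc \<psi>])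
    have "0 \<le> \<psi> k x" for k x
      using val[of k x] by auto
    then show "AE x in Om. 0 \<le> F (u x) * \<psi> k x" for k
      using F_nonneg by (intro AE_I2) simp
    show "AE x in Om. (\<lambda>k. F (u x) * \<psi> k x) \<longlonglongrightarrow> F (u x) * (tanh (u x))\<^sup>2"
      by (rule eventually_mono[OF ae]) (simp add: tendsto_mult_left power2_eq_square)
    show "(\<lambda>x. F (u x) * (tanh (u x))\<^sup>2) \<in> borel_measurable Om"
    proof -
      have "continuous_on UNIV (\<lambda>s::real. (tanh s)\<^sup>2)" by (intro continuous_intros) simp
      from borel_measurable_continuous_onI[OF this] have [measurable]: "(\<lambda>s::real. (tanh s)\<^sup>2) \<in> borel_measurable borel" .
      have "(\<lambda>x. F (u x) * (\<lambda>s. (tanh s)\<^sup>2) (u x)) \<in> borel_measurable Om" by measurable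
      then show ?thesis by simp
    qed
  qed
  have "compact (F ` {0..1})"
    by (intro compact_continuous_image continuous_on_subset[OF F_cont]) auto
  then obtain C where C: "\<And>y. y \<in> F ` {0..1} \<Longrightarrow> norm y \<le> C"
    using compact_imp_bounded bounded_iff by metis
  define \<tau> where "\<tau> = (tanh (1::real))\<^sup>2"
  have \<tau>: "0 < \<tau>" by (simp add: \<tau>_def)
  have le: "F s \<le> C + inverse \<tau> * (F s * (tanh s)\<^sup>2)" if "0 < s" for s
  proof (cases "s \<le> 1")
    case True
    then have "F s \<le> C" using C[of "F s"] that by auto
    moreover have "0 \<le> inverse \<tau> * (F s * (tanh s)\<^sup>2)" using \<tau> F_nonneg by simp
    ultimately show ?thesis by linarith
  next
    case False
    have "0 \<le> C" using C[of "F 0"] by (auto intro: order_trans[OF abs_ge_zero])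
    moreover have "tanh 1 \<le> tanh s" using False by simp
    then have "\<tau> \<le> (tanh s)\<^sup>2" unfolding \<tau>_def by (intro power_mono) simp_all
    then have "1 \<le> inverse \<tau> * (tanh s)\<^sup>2" using \<tau> by (simp add: field_simps)
    then have "F s * 1 \<le> F s * (inverse \<tau> * (tanh s)\<^sup>2)" by (intro mult_left_mono F_nonneg)
    ultimately show ?thesis by (simp add: mult_ac)
  qed
  show ?thesis
  proof (rule Bochner_Integration.integrable_bound)
    show "integrable Om (\<lambda>x. C + inverse \<tau> * (F (u x) * (tanh (u x))\<^sup>2))"
      using int by simp
    show "AE x in Om. norm (F (u x)) \<le> norm (C + inverse \<tau> * (F (u x) * (tanh (u x))\<^sup>2))"
    proof (rule eventually_mono[OF u_pos])
      fix x assume "0 < u x"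
      from le[OF this] F_nonneg[of "u x"]
      show "norm (F (u x)) \<le> norm (C + inverse \<tau> * (F (u x) * (tanh (u x))\<^sup>2))" by simp
    qed
  qed measurable
qed

lemma admissible_poly_tanh:
  assumes "poly Q 0 = 0"
  shows "admissible (\<lambda>s. poly Q (tanh s)) (\<lambda>s. poly (pderiv Q * [:1, 0, -1:]) (tanh s))"
proof -
  let ?P = "pderiv Q * [:1, 0, -1:]"
  obtain \<psi> B where \<psi>: "\<And>k::nat. test_function \<Omega> (\<psi> k)" and B: "\<And>k x. \<bar>\<psi> k x\<bar> \<le> B"
    and ae: "AE x in Om. (\<lambda>k. \<psi> k x) \<longlonglongrightarrow> poly Q (tanh (u x))"
    and H: "H1_0 \<Omega> (\<lambda>x. poly Q (tanh (u x))) (\<lambda>x. poly ?P (tanh (u x)) *\<^sub>R Du x)"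
    and lim: "(\<lambda>k. LINT x|Om. F (u x) * \<psi> k x) \<longlonglongrightarrow>
      (LINT x|Om. poly ?P (tanh (u x)) * quad_form (a x) (Du x) (Du x))"
    by (rule poly_tanh_approx[OF assms]) blast
  have m: "(\<lambda>x. poly Q (tanh (u x))) \<in> borel_measurable Om"
    using H by (simp add: H1_0_def square_integrable_def)
  have m\<psi>: "\<psi> k \<in> borel_measurable Om" for k
    by (rule borel_measurable_lebesgue_onI[OF test_function_borel(1)[OF \<psi>]])
  note [measurable] = m m\<psi>
  have dom: "integrable Om (\<lambda>x. B * F (u x))" using F_integrable by simp
  have bd: "AE x in Om. norm (F (u x) * \<psi> k x) \<le> B * F (u x)" for k
    using mult_right_mono[OF B F_nonneg] F_nonneg by (intro AE_I2) (simp add: abs_mult mult.commute)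
  have conv: "AE x in Om. (\<lambda>k. F (u x) * \<psi> k x) \<longlonglongrightarrow> F (u x) * poly Q (tanh (u x))"
    by (rule eventually_mono[OF ae]) (rule tendsto_mult_left)
  have m1: "(\<lambda>x. F (u x) * poly Q (tanh (u x))) \<in> borel_measurable Om" 
    by (rule borel_measurable_times[OF _ m]) measurable
  have m2: "(\<lambda>x. F (u x) * \<psi> k x) \<in> borel_measurable Om" for k
    by (rule borel_measurable_times[OF _ m\<psi>]) measurable
  have "(\<lambda>k. LINT x|Om. F (u x) * \<psi> k x) \<longlonglongrightarrow> (LINT x|Om. F (u x) * poly Q (tanh (u x)))"
    by (rule integral_dominated_convergence[OF m1 m2 dom conv bd])
  moreover have "integrable Om (\<lambda>x. F (u x) * poly Q (tanh (u x)))"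
    by (rule integrable_dominated_convergence[OF m1 m2 dom conv bd])
  ultimately show ?thesis
    unfolding admissible_def using H LIMSEQ_unique[OF lim] by simp
qed

text \<open>
  All three conditions in \<open>admissible\<close> pass to the limit by dominated convergence. The majorant \<open>H\<close> is
  kept general: it is a constant as long as only \<open>F(u)\<close> is known to be integrable, and the
  identity once \<open>F(u) u\<close> is.
\<close>

lemma admissible_limit:
  assumes adm: "\<And>j. admissible (h j) (p j)"
    and meas: "h' \<in> borel_measurable borel" "p' \<in> borel_measurable borel"
      "\<And>j::nat. h j \<in> borel_measurable borel" "\<And>j. p j \<in> borel_measurable borel"
    and lim: "\<And>s. 0 < s \<Longrightarrow> (\<lambda>j. h j s) \<longlonglongrightarrow> h' s" "\<And>s. 0 < s \<Longrightarrow> (\<lambda>j. p j s) \<longlonglongrightarrow> p' s"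
    and bd: "\<And>j s. 0 < s \<Longrightarrow> \<bar>p j s\<bar> \<le> B" "\<And>j s. 0 < s \<Longrightarrow> \<bar>h j s\<bar> \<le> B * s"
      "\<And>j s. 0 < s \<Longrightarrow> \<bar>h j s\<bar> \<le> H s"
    and H: "integrable Om (\<lambda>x. F (u x) * H (u x))"
  shows "admissible h' p'"
proof -
  note [measurable] = meas
  have bd': "\<bar>p' s\<bar> \<le> B" "\<bar>h' s\<bar> \<le> B * s" if "0 < s" for s
    using LIMSEQ_le_const2[OF tendsto_rabs[OF lim(2)[OF that]]] bd(1)[OF that]
      LIMSEQ_le_const2[OF tendsto_rabs[OF lim(1)[OF that]]] bd(2)[OF that] by blast+
  have posE: "AE x in Om. R x" if "\<And>x. 0 < u x \<Longrightarrow> R x" for R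
    by (rule eventually_mono[OF u_pos that])
  have mc: "(\<lambda>x. h' (u x)) \<in> borel_measurable Om" "(\<lambda>x. p' (u x)) \<in> borel_measurable Om"
    "(\<lambda>x. h j (u x)) \<in> borel_measurable Om" "(\<lambda>x. p j (u x)) \<in> borel_measurable Om" for j
    by measurable
  have sqh: "square_integrable \<Omega> (\<lambda>x. h' (u x))"
  proof -
    have "integrable Om (\<lambda>x. (norm (h' (u x)))\<^sup>2)"
    proof (rule Bochner_Integration.integrable_bound[OF integrable_mult_right[OF u_int(1), of "B\<^sup>2"]])
      show "AE x in Om. norm ((norm (h' (u x)))\<^sup>2) \<le> norm (B\<^sup>2 * (u x)\<^sup>2)"
      proof (rule posE)
        fix x assume "0 < u x"
        from power_mono[OF bd'(2)[OF this], of 2]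
        show "norm ((norm (h' (u x)))\<^sup>2) \<le> norm (B\<^sup>2 * (u x)\<^sup>2)" by (simp add: power_mult_distrib)
      qed
    qed measurable
    then show ?thesis using mc by (simp add: square_integrable_def)
  qed
  have sqp: "square_integrable \<Omega> (\<lambda>x. p' (u x) *\<^sub>R Du x)"
    by (rule square_integrable_mult_bounded[OF mc(2) posE[OF bd'(1)] sq_u(2)])
  have l1: "(\<lambda>j. LINT x|Om. (norm (h j (u x) - h' (u x)))\<^sup>2) \<longlonglongrightarrow> (LINT x|Om. 0)"
  proof (rule integral_dominated_convergence)
    show "integrable Om (\<lambda>x. (2 * B)\<^sup>2 * (u x)\<^sup>2)" using u_int(1) by simp
    show "AE x in Om. (\<lambda>j. (norm (h j (u x) - h' (u x)))\<^sup>2) \<longlonglongrightarrow> 0"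
    proof (rule posE)
      fix x assume "0 < u x"
      from lim(1)[OF this] have "(\<lambda>j. (norm (h j (u x) - h' (u x)))\<^sup>2) \<longlonglongrightarrow> (norm (h' (u x) - h' (u x)))\<^sup>2"
        by (intro tendsto_intros)
      then show "(\<lambda>j. (norm (h j (u x) - h' (u x)))\<^sup>2) \<longlonglongrightarrow> 0" by simp
    qed
    show "AE x in Om. norm ((norm (h j (u x) - h' (u x)))\<^sup>2) \<le> (2 * B)\<^sup>2 * (u x)\<^sup>2" for j
    proof (rule posE)
      fix x assume x: "0 < u x"
      have "\<bar>h j (u x) - h' (u x)\<bar> \<le> (2 * B) * u x"
        using bd(2)[OF x, of j] bd'(2)[OF x] by linarith
      from power_mono[OF this, of 2]
      show "norm ((norm (h j (u x) - h' (u x)))\<^sup>2) \<le> (2 * B)\<^sup>2 * (u x)\<^sup>2" by (simp add: power_mult_distrib)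
    qed
  qed measurable
  have l2: "(\<lambda>j. LINT x|Om. (norm (p j (u x) *\<^sub>R Du x - p' (u x) *\<^sub>R Du x))\<^sup>2) \<longlonglongrightarrow> (LINT x|Om. 0)"
  proof (rule integral_dominated_convergence)
    show "integrable Om (\<lambda>x. (2 * B)\<^sup>2 * (norm (Du x))\<^sup>2)" using u_int(2) by simp
    show "AE x in Om. (\<lambda>j. (norm (p j (u x) *\<^sub>R Du x - p' (u x) *\<^sub>R Du x))\<^sup>2) \<longlonglongrightarrow> 0"
    proof (rule posE)
      fix x assume "0 < u x"
      from lim(2)[OF this] have "(\<lambda>j. (norm (p j (u x) *\<^sub>R Du x - p' (u x) *\<^sub>R Du x))\<^sup>2)
          \<longlonglongrightarrow> (norm (p' (u x) *\<^sub>R Du x - p' (u x) *\<^sub>R Du x))\<^sup>2"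
        by (intro tendsto_intros)
      then show "(\<lambda>j. (norm (p j (u x) *\<^sub>R Du x - p' (u x) *\<^sub>R Du x))\<^sup>2) \<longlonglongrightarrow> 0" by simp
    qed
    show "AE x in Om. norm ((norm (p j (u x) *\<^sub>R Du x - p' (u x) *\<^sub>R Du x))\<^sup>2) \<le> (2 * B)\<^sup>2 * (norm (Du x))\<^sup>2" for j
    proof (rule posE)
      fix x assume x: "0 < u x"
      have "\<bar>p j (u x) - p' (u x)\<bar> \<le> 2 * B"
        using bd(1)[OF x, of j] bd'(1)[OF x] by linarith
      from power_mono[OF this, of 2]
      show "norm ((norm (p j (u x) *\<^sub>R Du x - p' (u x) *\<^sub>R Du x))\<^sup>2) \<le> (2 * B)\<^sup>2 * (norm (Du x))\<^sup>2"
        by (simp add: power_mult_distrib scaleR_left_diff_distrib[symmetric] mult_right_mono)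
    qed
  qed measurable
  have H1': "H1_0 \<Omega> (\<lambda>x. h' (u x)) (\<lambda>x. p' (u x) *\<^sub>R Du x)"
    using adm l1 l2 by (intro H1_0_closed[OF open_dom lmeas_dom sqh sqp]) (simp_all add: admissible_def)
  have bdF: "AE x in Om. norm (F (u x) * h j (u x)) \<le> F (u x) * H (u x)" for j
    using bd(3) F_nonneg by (intro posE) (simp add: abs_mult mult_left_mono)
  have convF: "AE x in Om. (\<lambda>j. F (u x) * h j (u x)) \<longlonglongrightarrow> F (u x) * h' (u x)"
    by (intro posE tendsto_mult_left lim)
  have mF: "(\<lambda>x. F (u x) * h' (u x)) \<in> borel_measurable Om" "(\<lambda>x. F (u x) * h j (u x)) \<in> borel_measurable Om" for j
    by measurable
  have iq: "integrable Om (\<lambda>x. quad_form (a x) (Du x) (Du x))"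
    by (rule quad_integrable[OF sq_u(2) sq_u(2)])
  have mq: "(\<lambda>x. quad_form (a x) (Du x) (Du x)) \<in> borel_measurable Om" using iq by (rule borel_measurable_integrable)
  have "(\<lambda>j. LINT x|Om. p j (u x) * quad_form (a x) (Du x) (Du x)) \<longlonglongrightarrow>
      (LINT x|Om. p' (u x) * quad_form (a x) (Du x) (Du x))"
  proof (rule integral_dominated_convergence)
    show "integrable Om (\<lambda>x. B * quad_form (a x) (Du x) (Du x))" using iq by simp
    show "AE x in Om. (\<lambda>j. p j (u x) * quad_form (a x) (Du x) (Du x)) \<longlonglongrightarrow> p' (u x) * quad_form (a x) (Du x) (Du x)"
      by (intro posE tendsto_mult_right lim)
    have nnq: "AE x in Om. 0 \<le> quad_form (a x) (Du x) (Du x)"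
      using a_nonneg by (intro AE_I2) simp
    show "AE x in Om. norm (p j (u x) * quad_form (a x) (Du x) (Du x)) \<le> B * quad_form (a x) (Du x) (Du x)" for j
      using u_pos nnq by eventually_elim (simp add: abs_mult mult_right_mono bd(1))
  qed (use mc mq in \<open>auto intro: borel_measurable_times\<close>)
  moreover have "(\<lambda>j. LINT x|Om. F (u x) * h j (u x)) \<longlonglongrightarrow> (LINT x|Om. F (u x) * h' (u x))"
    by (rule integral_dominated_convergence[OF mF H convF bdF])
  ultimately have "(LINT x|Om. p' (u x) * quad_form (a x) (Du x) (Du x)) = (LINT x|Om. F (u x) * h' (u x))"
    using adm unfolding admissible_def by (intro LIMSEQ_unique) simp_all
  moreover have "integrable Om (\<lambda>x. F (u x) * h' (u x))"
    by (rule integrable_dominated_convergence[OF mF H convF bdF])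
  ultimately show ?thesis using H1' unfolding admissible_def by blast
qed

end

lemma cutoff_continuous: "continuous_on UNIV (\<lambda>s::real. max 0 (min 1 (c - s)))"
  by (intro continuous_intros)

context elliptic_solution
begin

text \<open>
  In the variable \<open>z = tanh s\<close> the half-line becomes \<open>[0, 1)\<close> and \<open>p(s) = q(z) (1 - z\<^sup>2)\<close>, where \<open>q\<close>
  extends continuously to \<open>[0, 1]\<close> because \<open>p\<close> vanishes for large \<open>s\<close>. Polynomials close to \<open>q\<close> are
  derivatives of polynomials \<open>Q\<close> to which the case of \<open>Q(tanh u)\<close> applies.
\<close>

lemma admissible_compact_support:
  assumes p: "continuous_on UNIV p" and m: "0 < m" "\<And>s. m \<le> s \<Longrightarrow> p s = 0"
  shows "admissible (primitive p) p"
proof -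
  define T where "T = tanh m"
  have T: "0 < T" "T < 1" using m(1) by (simp_all add: T_def tanh_real_lt_1)
  \<comment> \<open>Freezing the argument at \<open>T\<close> keeps \<open>artanh\<close> finite and gives the value \<open>0\<close> from there on.\<close>
  define q where "q z = p (artanh (min z T)) / (1 - (min z T)\<^sup>2)" for z
  have sq: "z\<^sup>2 < 1" if "0 \<le> z" "z < 1" for z :: real
    using that abs_square_less_1[of z] by simp
  have "continuous_on {0..1} (\<lambda>x. artanh (min x T))"
  proof (rule continuous_on_artanh')
    show "continuous_on {0..1} (\<lambda>x. min x T)" by (intro continuous_intros)
    show "min x T \<in> {-1<..<1}" if "x \<in> {0..1}" for x using that T by auto
  qed
  then have "continuous_on {0..1} (\<lambda>x. p (artanh (min x T)))"
    by (rule continuous_on_compose2[OF p]) simp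
  then have "continuous_on {0..1} q"
    unfolding q_def
  proof (rule continuous_on_divide)
    show "continuous_on {0..1} (\<lambda>x. 1 - (min x T)\<^sup>2)" by (intro continuous_intros)
    show "\<forall>x\<in>{0..1}. 1 - (min x T)\<^sup>2 \<noteq> 0"
    proof
      fix x :: real assume "x \<in> {0..1}"
      then have "(min x T)\<^sup>2 < 1" by (intro sq) (use T in auto)
      then show "1 - (min x T)\<^sup>2 \<noteq> 0" by simp
    qed
  qed
  note cq = this
  have qp: "q (tanh s) * (1 - (tanh s)\<^sup>2) = p s" if "0 \<le> s" for s
  proof (cases "s \<le> m")
    case True
    then have "min (tanh s) T = tanh s" by (simp add: T_def min_def)
    moreover have "(tanh s)\<^sup>2 < 1" using sq that tanh_real_lt_1 by simp
    ultimately show ?thesis by (simp add: q_def artanh_tanh_real)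
  next
    case False
    then have "min (tanh s) T = T" by (simp add: T_def min_def)
    then show ?thesis using m(2)[of m] m(2)[of s] False by (simp add: q_def T_def artanh_tanh_real)
  qed
  have "compact (q ` {0..1})" by (intro compact_continuous_image cq) simp
  then obtain Bq where Bq: "\<And>y. y \<in> q ` {0..1} \<Longrightarrow> norm y \<le> Bq"
    using compact_imp_bounded bounded_iff by metis
  define B where "B = Bq + 1"
  have "\<exists>Q. poly Q 0 = 0 \<and> (\<forall>z\<in>{0..1}. \<bar>q z - poly (pderiv Q) z\<bar> < 1 / real (Suc j))" for j
  proof -
    obtain g where g: "real_polynomial_function g" "\<And>z. z \<in> {0..1} \<Longrightarrow> \<bar>q z - g z\<bar> < 1 / real (Suc j)"
      by (rule Stone_Weierstrass_real_polynomial_function[OF compact_Icc cq, of "1 / real (Suc j)"]) auto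
    obtain c n where c: "g = (\<lambda>x. \<Sum>i\<le>n. c i * x ^ i)"
      using g(1) unfolding real_polynomial_function_iff_sum by blast
    obtain Q where Q: "pderiv Q = (\<Sum>i\<le>n. monom (c i) i)" "poly Q 0 = 0"
      using poly_antiderivative by blast
    have "poly (pderiv Q) z = g z" for z by (simp add: Q(1) c poly_sum poly_monom)
    with g(2) Q(2) show ?thesis by (intro exI[of _ Q]) simp
  qed
  then have "\<exists>Q. \<forall>j. poly (Q j) 0 = 0 \<and> (\<forall>z\<in>{0..1}. \<bar>q z - poly (pderiv (Q j)) z\<bar> < 1 / real (Suc j))"
    by (intro choice allI)
  then obtain Q where Q0: "\<And>j. poly (Q j) 0 = 0"
    and Q: "\<And>j z. z \<in> {0..1} \<Longrightarrow> \<bar>q z - poly (pderiv (Q j)) z\<bar> < 1 / real (Suc j)" by blast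
  define h where "h j s = poly (Q j) (tanh s)" for j and s :: real
  define p' where "p' j s = poly (pderiv (Q j) * [:1, 0, -1:]) (tanh s)" for j and s :: real
  have p'_eq: "p' j s = poly (pderiv (Q j)) (tanh s) * (1 - (tanh s)\<^sup>2)" for j s
    by (simp add: p'_def power2_eq_square algebra_simps)
  have ran: "tanh s \<in> {0..1}" if "0 \<le> s" for s :: real
    using that tanh_real_lt_1[of s] by simp
  have Qb: "\<bar>poly (pderiv (Q j)) z\<bar> \<le> B" if "z \<in> {0..1}" for j z
  proof -
    have "\<bar>q z\<bar> \<le> Bq" using Bq[of "q z"] that by auto
    moreover have "1 / real (Suc j) \<le> 1" by simp
    ultimately show ?thesis using Q[OF that, of j] unfolding B_def by linarith
  qed
  have B0: "0 \<le> B" using Qb[of 0 0] by (auto intro: order_trans[OF abs_ge_zero])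
  have one: "0 \<le> 1 - (tanh s)\<^sup>2" "1 - (tanh s)\<^sup>2 \<le> 1" if "0 \<le> s" for s :: real
    using sq[of "tanh s"] that tanh_real_lt_1[of s] by simp_all
  have hder: "(h j has_real_derivative p' j s) (at s within {0..})" for j s
    unfolding h_def p'_def by (rule DERIV_subset[OF has_real_derivative_poly_tanh]) simp
  have pb: "\<bar>p' j s\<bar> \<le> B" if "0 \<le> s" for j s
    using mult_mono[OF Qb[OF ran[OF that], of j] one(2)[OF that]] B0 one(1)[OF that]
    by (simp add: p'_eq abs_mult)
  have hb: "\<bar>h j s\<bar> \<le> B * s" if "0 \<le> s" for j s
    by (rule derivative_bound_nonneg_axis[OF hder pb _ that]) (simp_all add: h_def Q0)
  have hb': "\<bar>h j s\<bar> \<le> B" if "0 \<le> s" for j s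
  proof -
    have "\<bar>poly (Q j) (tanh s)\<bar> \<le> B * tanh s"
    proof -
      have "norm (poly (Q j) (tanh s) - poly (Q j) 0) \<le> B * norm (tanh s - 0)"
      proof (rule field_differentiable_bound[of "{0..1}" "poly (Q j)" "poly (pderiv (Q j))"])
        show "(poly (Q j) has_field_derivative poly (pderiv (Q j)) z) (at z within {0..1})" for z
          by (rule DERIV_subset[OF poly_DERIV]) simp
      qed (use Qb ran[OF that] in auto)
      then show ?thesis using that by (simp add: Q0)
    qed
    also have "\<dots> \<le> B * 1" using B0 ran[OF that] by (intro mult_left_mono) simp_all
    finally show ?thesis by (simp add: h_def)
  qed
  have inv: "(\<lambda>j. 1 / real (Suc j)) \<longlonglongrightarrow> 0"
    using LIMSEQ_Suc[OF lim_1_over_n[where 'a = real]] by simp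
  have dp: "\<bar>p' j s - p s\<bar> \<le> 1 / real (Suc j)" if "0 \<le> s" for j s
  proof -
    have "\<bar>p' j s - p s\<bar> = \<bar>q (tanh s) - poly (pderiv (Q j)) (tanh s)\<bar> * (1 - (tanh s)\<^sup>2)"
      using one(1)[OF that] unfolding p'_eq qp[OF that, symmetric]
      by (simp add: left_diff_distrib[symmetric] abs_mult abs_minus_commute)
    also have "\<dots> \<le> 1 / real (Suc j) * 1"
      using Q[OF ran[OF that], of j] one[OF that] by (intro mult_mono) auto
    finally show ?thesis by simp
  qed
  have dh: "\<bar>h j s - primitive p s\<bar> \<le> 1 / real (Suc j) * s" if "0 \<le> s" for j s
  proof (rule derivative_bound_nonneg_axis[of "\<lambda>s. h j s - primitive p s" "\<lambda>s. p' j s - p s", OF _ dp _ that])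
    show "((\<lambda>s. h j s - primitive p s) has_real_derivative p' j z - p z) (at z within {0..})" if "0 \<le> z" for z
      by (rule DERIV_diff[OF hder primitive_has_derivative[OF p that]])
  qed (simp_all add: h_def Q0)
  have c: "continuous_on UNIV (h j)" "continuous_on UNIV (p' j)" for j
    unfolding h_def p'_def by (intro continuous_intros; simp)+
  show ?thesis
  proof (rule admissible_limit[where h = h and p = p' and B = B and H = "\<lambda>_. B"])
    show "admissible (h j) (p' j)" for j
      unfolding h_def p'_def by (rule admissible_poly_tanh[OF Q0])
    show "(\<lambda>j. h j s) \<longlonglongrightarrow> primitive p s" if "0 < s" for s
    proof (rule LIM_zero_cancel, rule Lim_null_comparison)
      show "\<forall>\<^sub>F j in sequentially. norm (h j s - primitive p s) \<le> 1 / real (Suc j) * s"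
        using dh that by simp
      show "(\<lambda>j. 1 / real (Suc j) * s) \<longlonglongrightarrow> 0" by (rule tendsto_mult_left_zero[OF inv])
    qed
    show "(\<lambda>j. p' j s) \<longlonglongrightarrow> p s" if "0 < s" for s
    proof (rule LIM_zero_cancel, rule Lim_null_comparison)
      show "\<forall>\<^sub>F j in sequentially. norm (p' j s - p s) \<le> 1 / real (Suc j)"
        using dp that by simp
    qed (rule inv)
    show "integrable Om (\<lambda>x. F (u x) * B)" using F_integrable by simp
  qed (use pb hb hb' c p primitive_continuous[OF p] in \<open>simp_all add: borel_measurable_continuous_onI\<close>)
qed

lemma admissible_cutoff:
  fixes j :: nat
  assumes p: "continuous_on UNIV p"
  shows "admissible (primitive (\<lambda>s. p s * max 0 (min 1 (real (Suc j) - s)))) (\<lambda>s. p s * max 0 (min 1 (real (Suc j) - s)))"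
  by (rule admissible_compact_support[where m = "real (Suc j)"])
    (use p cutoff_continuous in \<open>auto intro!: continuous_on_mult\<close>)

lemma quad_Du_integrable: "integrable Om (\<lambda>x. quad_form (a x) (Du x) (Du x))"
  by (rule quad_integrable[OF sq_u(2) sq_u(2)])

lemma cutoff_eventually:
  assumes "0 \<le> s"
  shows "\<forall>\<^sub>F j::nat in sequentially. p s * max 0 (min 1 (real (Suc j) - s)) = p s"
    and "\<forall>\<^sub>F j::nat in sequentially. primitive (\<lambda>s. p s * max 0 (min 1 (real (Suc j) - s))) s = primitive p s"
proof -
  obtain n :: nat where n: "s \<le> real n" using real_arch_simple by blast
  have 1: "max 0 (min 1 (real (Suc j) - t)) = 1" if "n \<le> j" "t \<le> s" for j t
  proof -
    have "real n \<le> real j" using that(1) by simp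
    then have "1 \<le> real (Suc j) - t" using that n by simp
    then show ?thesis by simp
  qed
  show "\<forall>\<^sub>F j::nat in sequentially. p s * max 0 (min 1 (real (Suc j) - s)) = p s"
    using eventually_ge_at_top[of n] by eventually_elim (use 1 in simp)
  show "\<forall>\<^sub>F j::nat in sequentially. primitive (\<lambda>s. p s * max 0 (min 1 (real (Suc j) - s))) s = primitive p s"
    using eventually_ge_at_top[of n]
  proof eventually_elim
    case (elim j)
    show ?case by (rule primitive_cong[OF assms]) (use 1[OF elim] in simp)
  qed
qed

text \<open>
  Slopes cut off at infinity have primitives increasing to the identity, and the equation bounds
  \<open>\<integral> F(u) h(u)\<close> for each of them by the energy of \<open>u\<close>.
\<close>

lemma F_times_u_integrable: "integrable Om (\<lambda>x. F (u x) * u x)"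
proof (rule Fatou_integrable(1))
  let ?p = "\<lambda>j s. 1 * max 0 (min 1 (real (Suc j) - s))"
  have adm: "admissible (primitive (?p j)) (?p j)" for j :: nat
    by (rule admissible_cutoff) simp
  show "integrable Om (\<lambda>x. F (u x) * primitive (?p j) (u x))" for j :: nat
    using adm[of j] by (simp add: admissible_def)
  have "continuous_on UNIV (?p j)" for j :: nat using cutoff_continuous by simp
  then show "AE x in Om. 0 \<le> F (u x) * primitive (?p j) (u x)" for j :: nat
    by (intro AE_I2 mult_nonneg_nonneg F_nonneg primitive_nonneg) simp_all
  show "AE x in Om. (\<lambda>j. F (u x) * primitive (?p j) (u x)) \<longlonglongrightarrow> F (u x) * u x"
  proof (rule eventually_mono[OF u_pos])
    fix x assume "0 < u x"
    then have "(\<lambda>j. primitive (?p j) (u x)) \<longlonglongrightarrow> u x"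
      using tendsto_eventually[OF cutoff_eventually(2)[of "u x" "\<lambda>_. 1"]] primitive_1[of "u x"] by simp
    then show "(\<lambda>j. F (u x) * primitive (?p j) (u x)) \<longlonglongrightarrow> F (u x) * u x"
      by (rule tendsto_mult_left)
  qed
  show "(\<lambda>x. F (u x) * u x) \<in> borel_measurable Om" by measurable
  show "(LINT x|Om. F (u x) * primitive (?p j) (u x)) \<le> (LINT x|Om. quad_form (a x) (Du x) (Du x))" for j :: nat
  proof -
    have m: "(\<lambda>s. ?p j s) \<in> borel_measurable borel" by measurable
    have pm: "(\<lambda>x. ?p j (u x)) \<in> borel_measurable Om" by measurable
    have le: "?p j (u x) * quad_form (a x) (Du x) (Du x) \<le> quad_form (a x) (Du x) (Du x)"
      "0 \<le> ?p j (u x) * quad_form (a x) (Du x) (Du x)" if "x \<in> \<Omega>" for x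
      using a_nonneg[OF that, of "Du x"] by (simp_all add: mult_left_le_one_le)
    have int: "integrable Om (\<lambda>x. ?p j (u x) * quad_form (a x) (Du x) (Du x))"
      by (rule Bochner_Integration.integrable_bound[OF quad_Du_integrable borel_measurable_times[OF pm borel_measurable_integrable[OF quad_Du_integrable]]])
        (use le a_nonneg in \<open>auto intro!: AE_I2\<close>)
    have "(LINT x|Om. F (u x) * primitive (?p j) (u x)) = (LINT x|Om. ?p j (u x) * quad_form (a x) (Du x) (Du x))"
      using adm[of j] by (simp add: admissible_def)
    also have "\<dots> \<le> (LINT x|Om. quad_form (a x) (Du x) (Du x))"
      using le by (intro integral_mono int quad_Du_integrable) simp
    finally show ?thesis .
  qed
qed (rule tendsto_const)

lemma admissible_bounded:
  assumes p: "continuous_on UNIV p" and B: "\<And>s. 0 \<le> s \<Longrightarrow> \<bar>p s\<bar> \<le> B"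
  shows "admissible (primitive p) p"
proof (rule admissible_limit)
  let ?p = "\<lambda>j s. p s * max 0 (min 1 (real (Suc j) - s))"
  show "admissible (primitive (?p j)) (?p j)" for j :: nat by (rule admissible_cutoff[OF p])
  have cp: "continuous_on UNIV (?p j)" for j :: nat
    using p cutoff_continuous by (intro continuous_on_mult)
  show "primitive p \<in> borel_measurable borel" "p \<in> borel_measurable borel"
    "primitive (?p j) \<in> borel_measurable borel" "?p j \<in> borel_measurable borel" for j :: nat
    by (intro borel_measurable_continuous_onI primitive_continuous p cp)+
  show "(\<lambda>j. primitive (?p j) s) \<longlonglongrightarrow> primitive p s" "(\<lambda>j. ?p j s) \<longlonglongrightarrow> p s" if "0 < s" for s
    using tendsto_eventually[OF cutoff_eventually(2)[of s p]] tendsto_eventually[OF cutoff_eventually(1)[of s p]] that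
    by simp_all
  have pb: "\<bar>?p j s\<bar> \<le> B" if "0 \<le> s" for j :: nat and s
  proof -
    have "\<bar>?p j s\<bar> \<le> \<bar>p s\<bar> * 1"
      unfolding abs_mult by (intro mult_left_mono) auto
    then show ?thesis using B[OF that] by simp
  qed
  then show "\<bar>?p j s\<bar> \<le> B" if "0 < s" for j :: nat and s using that by simp
  show bd: "\<bar>primitive (?p j) s\<bar> \<le> B * s" if "0 < s" for j :: nat and s
    by (rule derivative_bound_nonneg_axis[OF primitive_has_derivative[OF cp] pb]) (use that in simp_all)
  show "\<bar>primitive (?p j) s\<bar> \<le> B * s" if "0 < s" for j :: nat and s
    by (rule bd[OF that])
  show "integrable Om (\<lambda>x. F (u x) * (B * u x))"
    using integrable_mult_right[OF F_times_u_integrable, of B] by (simp add: mult_ac)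
qed

text \<open>
  The truncation \<open>(u - k)\<^sup>+\<close> is reached with the slopes \<open>min 1 (max 0 (j (s - k)))\<close>, which are
  continuous and converge to the indicator of \<open>s > k\<close>.
\<close>

lemma admissible_pos_part:
  assumes k: "0 \<le> k"
  shows "admissible (\<lambda>s. max 0 (s - k)) (\<lambda>s. if k < s then 1 else 0)"
proof (rule admissible_limit)
  let ?p = "\<lambda>j s. min 1 (max 0 (real j * (s - k)))"
  have cp: "continuous_on UNIV (?p j)" for j :: nat by (intro continuous_intros)
  have pb: "\<bar>?p j s\<bar> \<le> 1" for j :: nat and s by simp
  show "admissible (primitive (?p j)) (?p j)" for j :: nat by (rule admissible_bounded[OF cp pb])
  show "(\<lambda>s. max 0 (s - k)) \<in> borel_measurable borel" "(\<lambda>s. if k < s then 1 else 0 :: real) \<in> borel_measurable borel"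
    by measurable
  show "primitive (?p j) \<in> borel_measurable borel" "?p j \<in> borel_measurable borel" for j :: nat
    by (intro borel_measurable_continuous_onI primitive_continuous cp)+
  have plim: "(\<lambda>j. ?p j s) \<longlonglongrightarrow> (if k < s then 1 else 0)" for s
  proof (cases "k < s")
    case True
    obtain n :: nat where n: "inverse (s - k) \<le> real n" using real_arch_simple by blast
    have "\<forall>\<^sub>F j in sequentially. ?p j s = 1"
      using eventually_ge_at_top[of n]
    proof eventually_elim
      case (elim j)
      then have "inverse (s - k) * (s - k) \<le> real j * (s - k)"
        using n True by (intro mult_right_mono) simp_all
      then show ?case using True by simp
    qed
    then show ?thesis using True by (simp add: tendsto_eventually)
  next
    case False
    then have "real j * (s - k) \<le> 0" for j :: nat by (intro mult_nonneg_nonpos) simp_all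
    then have "?p j s = 0" for j :: nat by simp
    then show ?thesis using False by simp
  qed
  then show "(\<lambda>j. ?p j s) \<longlonglongrightarrow> (if k < s then 1 else 0)" for s .
  show "(\<lambda>j. primitive (?p j) s) \<longlonglongrightarrow> max 0 (s - k)" if "0 < s" for s
  proof -
    let ?g = "\<lambda>t. if k < t then 1 else 0 :: real"
    have "(\<lambda>j. integral {0..s} (?p j)) \<longlonglongrightarrow> integral {0..s} ?g"
    proof (rule dominated_convergence(2))
      show "?p j integrable_on {0..s}" for j :: nat
        by (intro integrable_continuous_real continuous_on_subset[OF cp]) simp
      show "(\<lambda>_. 1::real) integrable_on {0..s}" by (rule integrable_const_ivl)
      show "(\<lambda>j. ?p j t) \<longlonglongrightarrow> ?g t" if "t \<in> {0..s}" for t by (rule plim)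
    qed simp
    moreover have "(?g has_integral max 0 (s - k)) {0..s}"
    proof (cases "s \<le> k")
      case True
      then have "(?g has_integral 0) {0..s}" by (intro has_integral_is_0) auto
      with True show ?thesis by simp
    next
      case False
      have "(?g has_integral 0) {0..k}" by (intro has_integral_is_0) auto
      moreover have "(?g has_integral (s - k)) {k..s}"
      proof (rule has_integral_spike_finite[of "{k}"])
        show "((\<lambda>_. 1::real) has_integral (s - k)) {k..s}"
          using has_integral_const_real[of "1::real" k s] False by simp
      qed auto
      ultimately have "(?g has_integral (0 + (s - k))) {0..s}"
        using k False by (intro has_integral_combine[of 0 k s]) auto
      with False show ?thesis by simp
    qed
    then have "integral {0..s} ?g = max 0 (s - k)" by (rule integral_unique)
    ultimately show ?thesis using that by (simp add: primitive_def max_def)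
  qed
  show "\<bar>?p j s\<bar> \<le> 1" for j :: nat and s by (rule pb)
  show bd: "\<bar>primitive (?p j) s\<bar> \<le> 1 * s" if "0 < s" for j :: nat and s
    by (rule derivative_bound_nonneg_axis[OF primitive_has_derivative[OF cp] pb]) (use that in simp_all)
  show "\<bar>primitive (?p j) s\<bar> \<le> s" if "0 < s" for j :: nat and s
    using bd[OF that] by simp
qed (rule F_times_u_integrable)

end

section \<open>A trace inequality for potentials of Morrey type\<close>

text \<open>
  The fundamental theorem of calculus along the ray from \<open>x\<close> in the direction \<open>y\<close>, up to a point where
  \<open>\<phi>\<close> vanishes.
\<close>

lemma test_function_ray_bound:
  assumes \<phi>: "test_function \<Omega> \<phi>" and T: "0 \<le> T" "\<phi> (x + T *\<^sub>R y) = 0" and L: "norm y \<le> L"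
  shows "ennreal \<bar>\<phi> x\<bar> \<le> (\<integral>\<^sup>+t. ennreal (L * norm (gradient \<phi> (x + t *\<^sub>R y))) * indicator {0..T} t \<partial>lborel)"
proof -
  let ?f = "\<lambda>t. gradient \<phi> (x + t *\<^sub>R y) \<bullet> y"
  have der: "((\<lambda>t. \<phi> (x + t *\<^sub>R y)) has_real_derivative ?f t) (at t)" for t
  proof -
    have "((\<lambda>t::real. x + t *\<^sub>R y) has_derivative (\<lambda>t. t *\<^sub>R y)) (at t)"
      by (auto intro!: derivative_eq_intros)
    from has_derivative_compose[OF this test_function_has_derivative[OF \<phi>]]
    show ?thesis by (simp add: has_field_derivative_def mult_commute_abs)
  qed
  have "continuous_on UNIV (\<lambda>t. gradient \<phi> (x + t *\<^sub>R y))"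
    by (rule continuous_on_compose2[OF test_function_continuous(2)[OF \<phi>]]) (auto intro!: continuous_intros)
  then have "continuous_on UNIV ?f" by (rule continuous_on_inner[OF _ continuous_on_const])
  then have cont: "isCont ?f t" for t by (simp add: continuous_on_eq_continuous_at)
  have FTC: "has_bochner_integral lborel (\<lambda>t. ?f t * indicator {0..T} t) (\<phi> (x + T *\<^sub>R y) - \<phi> (x + 0 *\<^sub>R y))"
    by (rule has_bochner_integral_FTC_Icc_real[OF T(1) der cont])
  then have int: "integrable lborel (\<lambda>t. ?f t * indicator {0..T} t)"
    and eq: "(LINT t|lborel. ?f t * indicator {0..T} t) = - \<phi> x"
    using T(2) by (simp_all add: has_bochner_integral_iff)
  have "ennreal (norm (LINT t|lborel. ?f t * indicator {0..T} t)) \<le> (\<integral>\<^sup>+t. norm (?f t * indicator {0..T} t) \<partial>lborel)"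
    by (rule integral_norm_bound_ennreal[OF int])
  also have "\<dots> \<le> (\<integral>\<^sup>+t. ennreal (L * norm (gradient \<phi> (x + t *\<^sub>R y))) * indicator {0..T} t \<partial>lborel)"
  proof (rule nn_integral_mono)
    fix t
    have "\<bar>?f t\<bar> \<le> L * norm (gradient \<phi> (x + t *\<^sub>R y))"
      using Cauchy_Schwarz_ineq2[of "gradient \<phi> (x + t *\<^sub>R y)" y]
        mult_left_mono[OF L norm_ge_zero[of "gradient \<phi> (x + t *\<^sub>R y)"]] by (simp add: mult.commute)
    then show "ennreal (norm (?f t * indicator {0..T} t)) \<le> ennreal (L * norm (gradient \<phi> (x + t *\<^sub>R y))) * indicator {0..T} t"
      by (auto simp: indicator_def intro: ennreal_leI)
  qed
  finally show ?thesis by (simp add: eq)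
qed

lemma nn_integral_powr_Icc:
  assumes "-1 < e" "0 \<le> T"
  shows "(\<integral>\<^sup>+t. ennreal (t powr e) * indicator {0..T} t \<partial>lborel) = ennreal (T powr (e + 1) / (e + 1))"
  by (rule nn_integral_has_integral_lebesgue'[OF _ has_integral_powr_from_0]) (use assms in auto)

lemma nn_integral_weighted_Cauchy_Schwarz:
  fixes g :: "real \<Rightarrow> real"
  assumes g: "g \<in> borel_measurable borel" "\<And>t. 0 \<le> g t" and b: "b < 1" and T: "0 \<le> T"
  shows "(\<integral>\<^sup>+t. ennreal (g t) * indicator {0..T} t \<partial>lborel)\<^sup>2
    \<le> ennreal (T powr (1 - b) / (1 - b)) * (\<integral>\<^sup>+t. ennreal (t powr b) * indicator {0..T} t * ennreal ((g t)\<^sup>2) \<partial>lborel)"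
proof -
  note [measurable] = g(1)
  \<comment> \<open>Split \<open>g = t powr (- b / 2) * (t powr (b / 2) * g)\<close>; \<open>t powr (- b)\<close> is integrable at \<open>0\<close> as \<open>b < 1\<close>.\<close>
  let ?f1 = "\<lambda>t. ennreal (t powr (- b / 2)) * indicator {0..T} t :: ennreal"
  let ?f2 = "\<lambda>t. ennreal (t powr (b / 2)) * indicator {0..T} t * ennreal (g t)"
  have sq: "(ennreal (t powr (c / 2)))\<^sup>2 = ennreal (t powr c)" for t c :: real
  proof -
    have "(t powr (c / 2))\<^sup>2 = t powr c"
      unfolding power2_eq_square powr_add[symmetric] field_sum_of_halves ..
    then show ?thesis by (simp only: ennreal_power[OF powr_ge_zero])
  qed
  have "(\<integral>\<^sup>+t. ennreal (g t) * indicator {0..T} t \<partial>lborel) = (\<integral>\<^sup>+t. ?f1 t * ?f2 t \<partial>lborel)"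
  proof (rule nn_integral_cong_AE, rule eventually_mono[OF AE_lborel_singleton[of 0]])
    fix t :: real assume "t \<noteq> 0"
    then have "ennreal (t powr (- b / 2)) * (ennreal (t powr (b / 2)) * ennreal (g t)) = ennreal (g t)" if "0 \<le> t"
      using that g(2)[of t] by (simp add: ennreal_mult[symmetric] powr_add[symmetric] mult.assoc[symmetric])
    then show "ennreal (g t) * indicator {0..T} t = ?f1 t * ?f2 t"
      by (auto simp: indicator_def)
  qed
  moreover have "(\<integral>\<^sup>+t. ?f1 t * ?f2 t \<partial>lborel)\<^sup>2 \<le> (\<integral>\<^sup>+t. (?f1 t)\<^sup>2 \<partial>lborel) * (\<integral>\<^sup>+t. (?f2 t)\<^sup>2 \<partial>lborel)"
    by (rule Cauchy_Schwarz_nn_integral) measurable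
  moreover have "(\<integral>\<^sup>+t. (?f1 t)\<^sup>2 \<partial>lborel) = (\<integral>\<^sup>+t. ennreal (t powr (- b)) * indicator {0..T} t \<partial>lborel)"
  proof (rule nn_integral_cong)
    show "(?f1 t)\<^sup>2 = ennreal (t powr (- b)) * indicator {0..T} t" for t
      by (cases "t \<in> {0..T}") (simp_all only: power_mult_distrib sq indicator_simps mult_1_right mult_zero_right power_one power_zero_numeral simp_thms)
  qed
  moreover have "(\<integral>\<^sup>+t. ennreal (t powr (- b)) * indicator {0..T} t \<partial>lborel) = ennreal (T powr (1 - b) / (1 - b))"
    using nn_integral_powr_Icc[of "- b" T] b T by simp
  moreover have "(\<integral>\<^sup>+t. (?f2 t)\<^sup>2 \<partial>lborel) = (\<integral>\<^sup>+t. ennreal (t powr b) * indicator {0..T} t * ennreal ((g t)\<^sup>2) \<partial>lborel)"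
  proof (rule nn_integral_cong)
    fix t
    have "(ennreal (t powr (b / 2)) * ennreal (g t))\<^sup>2 = ennreal (t powr b) * ennreal ((g t)\<^sup>2)"
      by (simp only: power_mult_distrib sq ennreal_power[OF g(2)])
    then show "(?f2 t)\<^sup>2 = ennreal (t powr b) * indicator {0..T} t * ennreal ((g t)\<^sup>2)"
      by (cases "t \<in> {0..T}") simp_all
  qed
  ultimately show ?thesis by (simp only:)
qed

text \<open>
  Directions of length at least \<open>1\<close>, so that rays leave a bounded set in bounded time; the cube has
  measure \<open>1\<close>, so that integrating over it is averaging.
\<close>

definition shift_cube :: "(real ^ 'n) set" where
  "shift_cube = cbox 1 2"

lemma shift_cube_norm:
  fixes y :: "real ^ 'n"
  assumes "y \<in> shift_cube"
  shows "1 \<le> norm y" "norm y \<le> 2 * real CARD('n)"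
proof -
  have y: "1 \<le> y $ i" "y $ i \<le> 2" for i
    using assms by (auto simp: shift_cube_def mem_box_cart)
  show "1 \<le> norm y"
    using component_le_norm_cart[of y undefined] y(1)[of undefined] by linarith
  have "(\<Sum>i\<in>UNIV. \<bar>y $ i\<bar>) \<le> (\<Sum>i\<in>(UNIV::'n set). 2)"
    by (rule sum_mono) (use y in \<open>smt (verit)\<close>)
  then show "norm y \<le> 2 * real CARD('n)"
    using norm_le_l1_cart[of y] by simp
qed

lemma shift_cube_measure: "emeasure lborel (shift_cube :: (real ^ 'n) set) = 1"
proof -
  have "((2::real^'n) - 1) \<bullet> b = 1" "(1::real^'n) \<bullet> b \<le> 2 \<bullet> b" if "b \<in> Basis" for b :: "real ^ 'n"
    using that by (auto simp: Basis_vec_def inner_axis)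
  then show ?thesis
    by (simp add: shift_cube_def emeasure_lborel_cbox_eq)
qed

lemma nn_integral_lborel_shift:
  fixes f :: "'a::euclidean_space \<Rightarrow> ennreal"
  assumes [measurable]: "f \<in> borel_measurable borel"
  shows "(\<integral>\<^sup>+x. f (c + x) \<partial>lborel) = (\<integral>\<^sup>+x. f x \<partial>lborel)"
proof -
  have "(\<integral>\<^sup>+x. f x \<partial>lborel) = (\<integral>\<^sup>+x. f x \<partial>distr lborel borel ((+) c))"
    unfolding lborel_distr_plus ..
  also have "\<dots> = (\<integral>\<^sup>+x. f (c + x) \<partial>lborel)"
    by (rule nn_integral_distr) measurable
  finally show ?thesis ..
qed

text \<open>
  Along every ray leaving \<open>\<Omega>\<close> in a direction
  \<open>y\<close> of the cube, \<open>\<phi> x = - \<integral>\<nabla>\<phi>(x + t y) \<bullet> y dt\<close>; Cauchy-Schwarz with the weight \<open>t\<^sup>b\<close>,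
  \<open>b = \<sigma> / 2\<close>, averaging over \<open>y\<close>, and moving the translation from \<open>\<nabla>\<phi>\<close> to \<open>V\<close> leave the integral of
  \<open>t powr (b - \<sigma>)\<close>, which converges at \<open>0\<close> because \<open>\<sigma> < 2\<close>.
\<close>

lemma trace_inequality_test_function:
  fixes V :: "real ^ 'n \<Rightarrow> ennreal" and \<Omega> :: "(real ^ 'n) set"
  assumes \<phi>: "test_function \<Omega> \<phi>" and R: "0 \<le> R" "\<Omega> \<subseteq> ball 0 R"
    and V[measurable]: "V \<in> borel_measurable borel" and \<sigma>: "\<sigma> < 2"
    and morrey: "\<And>z t. 0 < t \<Longrightarrow> t \<le> 2 * R + 1 \<Longrightarrow>
      (\<integral>\<^sup>+y. V (z - t *\<^sub>R y) * indicator shift_cube y \<partial>lborel) \<le> N * ennreal (t powr (- \<sigma>))"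
  defines "K \<equiv> (2 * R + 1) powr (1 - \<sigma> / 2) / (1 - \<sigma> / 2)"
  shows "(\<integral>\<^sup>+x. V x * ennreal ((\<phi> x)\<^sup>2) \<partial>lborel)
    \<le> ennreal (K\<^sup>2 * (2 * real CARD('n))\<^sup>2) * N * (\<integral>\<^sup>+x. ennreal ((norm (gradient \<phi> x))\<^sup>2) \<partial>lborel)"
proof -
  define T where "T = 2 * R + 1"
  define b where "b = \<sigma> / 2"
  define L where "L = 2 * real CARD('n)"
  define g where "g x = norm (gradient \<phi> x)" for x
  define \<tau> :: "real \<Rightarrow> ennreal" where "\<tau> t = ennreal (t powr b) * indicator {0..T} t" for t
  have T: "0 < T" "0 \<le> T" using R by (simp_all add: T_def)
  have L: "0 \<le> L" by (simp add: L_def)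
  have b: "b < 1" using \<sigma> by (simp add: b_def)
  have K: "K = T powr (1 - b) / (1 - b)" "0 \<le> K" using b by (simp_all add: K_def T_def b_def)
  note [measurable] = test_function_borel[OF \<phi>]
  have gm[measurable]: "g \<in> borel_measurable borel" unfolding g_def by measurable
  have \<tau>m[measurable]: "\<tau> \<in> borel_measurable borel" unfolding \<tau>_def by measurable
  have Qm[measurable]: "(shift_cube :: (real^'n) set) \<in> sets borel" by (simp add: shift_cube_def)
  have zero: "\<phi> x = 0" if "x \<notin> \<Omega>" for x
    using test_function_support[OF \<phi>] that by (metis subsetD)
  let ?G = "\<lambda>x y. \<integral>\<^sup>+t. \<tau> t * ennreal ((g (x + t *\<^sub>R y))\<^sup>2) \<partial>lborel"
  have point: "ennreal ((\<phi> x)\<^sup>2) \<le> ennreal (K * L\<^sup>2) * ?G x y" if y: "y \<in> shift_cube" for x y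
  proof (cases "x \<in> \<Omega>")
    case True
    have "x + T *\<^sub>R y \<notin> \<Omega>"
    proof
      assume "x + T *\<^sub>R y \<in> \<Omega>"
      then have "norm (x + T *\<^sub>R y) < R" "norm x < R" using R(2) True by auto
      moreover have "T \<le> norm (T *\<^sub>R y)" using shift_cube_norm(1)[OF y] T by simp
      moreover have "norm (T *\<^sub>R y) \<le> norm (x + T *\<^sub>R y) + norm x"
        using norm_triangle_ineq4[of "x + T *\<^sub>R y" x] by simp
      ultimately show False by (simp add: T_def)
    qed
    then have "ennreal \<bar>\<phi> x\<bar> \<le> (\<integral>\<^sup>+t. ennreal (L * g (x + t *\<^sub>R y)) * indicator {0..T} t \<partial>lborel)"
      unfolding g_def using shift_cube_norm(2)[OF y] T zero by (intro test_function_ray_bound[OF \<phi>]) (simp_all add: L_def)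
    then have "(ennreal \<bar>\<phi> x\<bar>)\<^sup>2 \<le> (\<integral>\<^sup>+t. ennreal (L * g (x + t *\<^sub>R y)) * indicator {0..T} t \<partial>lborel)\<^sup>2"
      by (rule power_mono) simp
    also have "\<dots> \<le> ennreal K * (\<integral>\<^sup>+t. \<tau> t * ennreal ((L * g (x + t *\<^sub>R y))\<^sup>2) \<partial>lborel)"
      unfolding K(1) \<tau>_def using L by (intro nn_integral_weighted_Cauchy_Schwarz b T) (simp_all add: g_def)
    also have "\<dots> = ennreal K * (\<integral>\<^sup>+t. ennreal (L\<^sup>2) * (\<tau> t * ennreal ((g (x + t *\<^sub>R y))\<^sup>2)) \<partial>lborel)"
      by (simp add: power_mult_distrib ennreal_mult mult_ac)
    also have "\<dots> = ennreal (K * L\<^sup>2) * ?G x y"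
      using K(2) by (subst nn_integral_cmult) (simp_all add: ennreal_mult mult.assoc)
    finally show ?thesis by (simp add: ennreal_power)
  next
    case False
    then show ?thesis by (simp add: zero)
  qed
  let ?I = "\<integral>\<^sup>+x. V x * ennreal ((\<phi> x)\<^sup>2) \<partial>lborel"
  have ray: "?I \<le> ennreal (K * L\<^sup>2) * (\<integral>\<^sup>+t. \<tau> t * (\<integral>\<^sup>+z. V (z - t *\<^sub>R y) * ennreal ((g z)\<^sup>2) \<partial>lborel) \<partial>lborel)"
    if y: "y \<in> shift_cube" for y
  proof -
    have "?I \<le> (\<integral>\<^sup>+x. ennreal (K * L\<^sup>2) * (\<integral>\<^sup>+t. V x * (\<tau> t * ennreal ((g (x + t *\<^sub>R y))\<^sup>2)) \<partial>lborel) \<partial>lborel)"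
    proof (rule nn_integral_mono)
      fix x
      have "V x * ennreal ((\<phi> x)\<^sup>2) \<le> V x * (ennreal (K * L\<^sup>2) * ?G x y)"
        by (intro mult_left_mono point[OF y]) simp
      also have "\<dots> = ennreal (K * L\<^sup>2) * (\<integral>\<^sup>+t. V x * (\<tau> t * ennreal ((g (x + t *\<^sub>R y))\<^sup>2)) \<partial>lborel)"
        by (subst nn_integral_cmult) (simp_all add: mult_ac)
      finally show "V x * ennreal ((\<phi> x)\<^sup>2) \<le> ennreal (K * L\<^sup>2) * (\<integral>\<^sup>+t. V x * (\<tau> t * ennreal ((g (x + t *\<^sub>R y))\<^sup>2)) \<partial>lborel)" .
    qed
    also have "\<dots> = ennreal (K * L\<^sup>2) * (\<integral>\<^sup>+x. (\<integral>\<^sup>+t. V x * (\<tau> t * ennreal ((g (x + t *\<^sub>R y))\<^sup>2)) \<partial>lborel) \<partial>lborel)"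
      by (rule nn_integral_cmult) measurable
    also have "(\<integral>\<^sup>+x. (\<integral>\<^sup>+t. V x * (\<tau> t * ennreal ((g (x + t *\<^sub>R y))\<^sup>2)) \<partial>lborel) \<partial>lborel)
        = (\<integral>\<^sup>+t. (\<integral>\<^sup>+x. V x * (\<tau> t * ennreal ((g (x + t *\<^sub>R y))\<^sup>2)) \<partial>lborel) \<partial>lborel)"
      by (rule lborel_pair.Fubini'[symmetric]) measurable
    also have "\<dots> = (\<integral>\<^sup>+t. \<tau> t * (\<integral>\<^sup>+z. V (z - t *\<^sub>R y) * ennreal ((g z)\<^sup>2) \<partial>lborel) \<partial>lborel)"
    proof (rule nn_integral_cong)
      fix t
      have "(\<integral>\<^sup>+x. V x * (\<tau> t * ennreal ((g (x + t *\<^sub>R y))\<^sup>2)) \<partial>lborel)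
          = (\<integral>\<^sup>+x. \<tau> t * (V ((t *\<^sub>R y + x) - t *\<^sub>R y) * ennreal ((g (t *\<^sub>R y + x))\<^sup>2)) \<partial>lborel)"
        by (simp add: mult_ac add.commute)
      also have "\<dots> = \<tau> t * (\<integral>\<^sup>+x. V ((t *\<^sub>R y + x) - t *\<^sub>R y) * ennreal ((g (t *\<^sub>R y + x))\<^sup>2) \<partial>lborel)"
        by (rule nn_integral_cmult) measurable
      also have "(\<integral>\<^sup>+x. V ((t *\<^sub>R y + x) - t *\<^sub>R y) * ennreal ((g (t *\<^sub>R y + x))\<^sup>2) \<partial>lborel)
          = (\<integral>\<^sup>+z. V (z - t *\<^sub>R y) * ennreal ((g z)\<^sup>2) \<partial>lborel)"
        by (rule nn_integral_lborel_shift[of "\<lambda>z. V (z - t *\<^sub>R y) * ennreal ((g z)\<^sup>2)"]) measurable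
      finally show "(\<integral>\<^sup>+x. V x * (\<tau> t * ennreal ((g (x + t *\<^sub>R y))\<^sup>2)) \<partial>lborel)
          = \<tau> t * (\<integral>\<^sup>+z. V (z - t *\<^sub>R y) * ennreal ((g z)\<^sup>2) \<partial>lborel)" .
    qed
    finally show ?thesis .
  qed
  let ?D = "\<integral>\<^sup>+x. ennreal ((g x)\<^sup>2) \<partial>lborel"
  have inner: "(\<integral>\<^sup>+y. indicator shift_cube y * (\<integral>\<^sup>+z. V (z - t *\<^sub>R y) * ennreal ((g z)\<^sup>2) \<partial>lborel) \<partial>lborel)
      \<le> N * ennreal (t powr (- \<sigma>)) * ?D" if t: "0 < t" "t \<le> T" for t
  proof -
    have "(\<integral>\<^sup>+y. indicator shift_cube y * (\<integral>\<^sup>+z. V (z - t *\<^sub>R y) * ennreal ((g z)\<^sup>2) \<partial>lborel) \<partial>lborel)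
        = (\<integral>\<^sup>+y. (\<integral>\<^sup>+z. indicator shift_cube y * (V (z - t *\<^sub>R y) * ennreal ((g z)\<^sup>2)) \<partial>lborel) \<partial>lborel)"
      by (rule nn_integral_cong, rule nn_integral_cmult[symmetric]) measurable
    also have "\<dots> = (\<integral>\<^sup>+z. (\<integral>\<^sup>+y. indicator shift_cube y * (V (z - t *\<^sub>R y) * ennreal ((g z)\<^sup>2)) \<partial>lborel) \<partial>lborel)"
      by (rule lborel_pair.Fubini'[symmetric]) measurable
    also have "\<dots> = (\<integral>\<^sup>+z. (\<integral>\<^sup>+y. V (z - t *\<^sub>R y) * indicator shift_cube y \<partial>lborel) * ennreal ((g z)\<^sup>2) \<partial>lborel)"
      by (rule nn_integral_cong, subst nn_integral_multc[symmetric]) (auto intro!: nn_integral_cong simp: mult_ac)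
    also have "\<dots> \<le> (\<integral>\<^sup>+z. (N * ennreal (t powr (- \<sigma>))) * ennreal ((g z)\<^sup>2) \<partial>lborel)"
      by (intro nn_integral_mono mult_right_mono morrey) (use t in \<open>simp_all add: T_def\<close>)
    also have "\<dots> = N * ennreal (t powr (- \<sigma>)) * ?D"
      by (rule nn_integral_cmult) measurable
    finally show ?thesis .
  qed
  have "?I = (\<integral>\<^sup>+y. ?I * indicator shift_cube y \<partial>(lborel :: (real^'n) measure))"
    by (simp add: nn_integral_cmult_indicator shift_cube_measure)
  also have "\<dots> \<le> (\<integral>\<^sup>+y. ennreal (K * L\<^sup>2) * (\<integral>\<^sup>+t. \<tau> t * (indicator shift_cube y * (\<integral>\<^sup>+z. V (z - t *\<^sub>R y) * ennreal ((g z)\<^sup>2) \<partial>lborel)) \<partial>lborel) \<partial>lborel)"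
    by (rule nn_integral_mono) (use ray in \<open>auto simp: indicator_def\<close>)
  also have "\<dots> = ennreal (K * L\<^sup>2) * (\<integral>\<^sup>+y. (\<integral>\<^sup>+t. \<tau> t * (indicator shift_cube y * (\<integral>\<^sup>+z. V (z - t *\<^sub>R y) * ennreal ((g z)\<^sup>2) \<partial>lborel)) \<partial>lborel) \<partial>lborel)"
    by (rule nn_integral_cmult) measurable
  also have "(\<integral>\<^sup>+y. (\<integral>\<^sup>+t. \<tau> t * (indicator shift_cube y * (\<integral>\<^sup>+z. V (z - t *\<^sub>R y) * ennreal ((g z)\<^sup>2) \<partial>lborel)) \<partial>lborel) \<partial>lborel)
      = (\<integral>\<^sup>+t. (\<integral>\<^sup>+y. \<tau> t * (indicator shift_cube y * (\<integral>\<^sup>+z. V (z - t *\<^sub>R y) * ennreal ((g z)\<^sup>2) \<partial>lborel)) \<partial>lborel) \<partial>lborel)"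
    by (rule lborel_pair.Fubini'[symmetric]) measurable
  also have "\<dots> = (\<integral>\<^sup>+t. \<tau> t * (\<integral>\<^sup>+y. indicator shift_cube y * (\<integral>\<^sup>+z. V (z - t *\<^sub>R y) * ennreal ((g z)\<^sup>2) \<partial>lborel) \<partial>lborel) \<partial>lborel)"
    by (rule nn_integral_cong, rule nn_integral_cmult) measurable
  also have "\<dots> \<le> (\<integral>\<^sup>+t. (N * ?D) * (ennreal (t powr (- b)) * indicator {0..T} t) \<partial>lborel)"
  proof (rule nn_integral_mono_AE, rule eventually_mono[OF AE_lborel_singleton[of 0]])
    fix t :: real assume t0: "t \<noteq> 0"
    show "\<tau> t * (\<integral>\<^sup>+y. indicator shift_cube y * (\<integral>\<^sup>+z. V (z - t *\<^sub>R y) * ennreal ((g z)\<^sup>2) \<partial>lborel) \<partial>lborel)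
        \<le> (N * ?D) * (ennreal (t powr (- b)) * indicator {0..T} t)"
    proof (cases "t \<in> {0..T}")
      case True
      then have t: "0 < t" "t \<le> T" using t0 by auto
      have pw: "ennreal (t powr b) * ennreal (t powr (- \<sigma>)) = ennreal (t powr (- b))"
        using t by (simp add: ennreal_mult[symmetric] powr_add[symmetric] b_def)
      have "\<tau> t * (\<integral>\<^sup>+y. indicator shift_cube y * (\<integral>\<^sup>+z. V (z - t *\<^sub>R y) * ennreal ((g z)\<^sup>2) \<partial>lborel) \<partial>lborel)
          \<le> ennreal (t powr b) * (N * ennreal (t powr (- \<sigma>)) * ?D)"
        using True by (simp add: \<tau>_def) (intro mult_left_mono inner t zero_le)
      also have "\<dots> = (N * ?D) * (ennreal (t powr b) * ennreal (t powr (- \<sigma>)))"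
        by (simp only: mult_ac)
      finally show ?thesis using True by (simp add: pw)
    qed (simp add: \<tau>_def)
  qed
  also have "\<dots> = (N * ?D) * ennreal K"
    using nn_integral_powr_Icc[of "- b" T] b T by (subst nn_integral_cmult) (simp_all add: K)
  finally have "?I \<le> ennreal (K * L\<^sup>2) * ((N * ?D) * ennreal K)"
    by (simp add: mult_left_mono)
  also have "\<dots> = ennreal (K\<^sup>2 * L\<^sup>2) * N * ?D"
    using K(2) by (simp add: ennreal_mult power2_eq_square[of K] mult_ac)
  finally show ?thesis by (simp add: L_def g_def)
qed

section \<open>Calculus of the nonlinearity\<close>

lemma primitive_eqI:
  assumes "0 \<le> s" "\<And>t. 0 \<le> t \<Longrightarrow> t \<le> s \<Longrightarrow> (D has_real_derivative p t) (at t within {0..s})"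
  shows "primitive p s = D s - D 0"
proof -
  have "(p has_integral (D s - D 0)) {0..s}"
    using assms by (intro fundamental_theorem_of_calculus)
      (simp_all add: has_real_derivative_iff_has_vector_derivative[symmetric])
  then show ?thesis using assms(1) by (simp add: primitive_def max_def integral_unique)
qed

lemma primitive_affine_tail:
  assumes p: "continuous_on UNIV p" and s: "0 \<le> m" "m \<le> s" and c: "\<And>t. m \<le> t \<Longrightarrow> p t = c"
  shows "primitive p s = primitive p m + c * (s - m)"
proof -
  have "integral {0..m} p + integral {m..s} p = integral {0..s} p"
    by (rule Henstock_Kurzweil_Integration.integral_combine[OF s integrable_continuous_real[OF continuous_on_subset[OF p]]]) simp
  moreover have "integral {m..s} p = integral {m..s} (\<lambda>_. c)"
    by (rule integral_cong) (use c in simp)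
  ultimately show ?thesis using s by (simp add: primitive_def max_def mult.commute)
qed

locale convex_nonlinearity =
  fixes f f' f'' :: "real \<Rightarrow> real"
  assumes f_deriv: "\<And>t. 0 \<le> t \<Longrightarrow> (f has_real_derivative f' t) (at t within {0..})"
    and f'_deriv: "\<And>t. 0 \<le> t \<Longrightarrow> (f' has_real_derivative f'' t) (at t within {0..})"
    and f_convex: "convex_on {0..} f"
    and f0_pos: "0 < f 0"
    and f'_nonneg: "\<And>t. 0 \<le> t \<Longrightarrow> 0 \<le> f' t"
    and superlinear: "filterlim (\<lambda>s. f s / s) at_top at_top"
begin

lemma deriv_at:
  assumes "0 < t"
  shows "(f has_real_derivative f' t) (at t)" "(f' has_real_derivative f'' t) (at t)"
proof -
  have "at t within {0..} = at t"
    using assms by (intro at_within_interior) (simp add: interior_real_atLeast)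
  then show "(f has_real_derivative f' t) (at t)" "(f' has_real_derivative f'' t) (at t)"
    using f_deriv[of t] f'_deriv[of t] assms by simp_all
qed

lemma continuous_nonneg_axis: "continuous_on {0..} f" "continuous_on {0..} f'"
  using f_deriv f'_deriv by (auto intro: DERIV_continuous_on)

lemma tangent: "0 < c \<Longrightarrow> 0 \<le> x \<Longrightarrow> f' c * (x - c) \<le> f x - f c"
  by (rule convex_on_imp_above_tangent[OF f_convex _ _ _ f_deriv]) (simp_all add: interior_real_atLeast)

lemma f''_nonneg:
  assumes "0 < t"
  shows "0 \<le> f'' t"
proof (rule mono_on_imp_deriv_nonneg[of "{0<..}" f'])
  show "mono_on {0<..} f'"
  proof (rule mono_onI)
    fix r s :: real assume rs: "r \<in> {0<..}" "s \<in> {0<..}" "r \<le> s"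
    show "f' r \<le> f' s"
    proof (cases "r = s")
      case False
      have "f' r * (s - r) + f' s * (r - s) \<le> 0"
        using tangent[of r s] tangent[of s r] rs by simp
      then have "f' r * (s - r) \<le> f' s * (s - r)" by (simp add: algebra_simps)
      then show ?thesis using False rs by simp
    qed simp
  qed
qed (use assms deriv_at in \<open>simp_all add: interior_open\<close>)

lemma f'_mono:
  assumes "0 \<le> r" "r \<le> s"
  shows "f' r \<le> f' s"
proof (rule DERIV_nonneg_imp_increasing_open[OF assms(2)])
  show "\<exists>y. (f' has_real_derivative y) (at x) \<and> 0 \<le> y" if "r < x" "x < s" for x
    using deriv_at(2)[of x] f''_nonneg[of x] that assms(1) by auto
  show "continuous_on {r..s} f'"
    by (rule continuous_on_subset[OF continuous_nonneg_axis(2)]) (use assms in auto)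
qed

lemma f_mono:
  assumes "0 \<le> r" "r \<le> s"
  shows "f r \<le> f s"
proof (rule DERIV_nonneg_imp_increasing_open[OF assms(2)])
  show "\<exists>y. (f has_real_derivative y) (at x) \<and> 0 \<le> y" if "r < x" "x < s" for x
    using deriv_at(1)[of x] f'_nonneg[of x] that assms(1) by auto
  show "continuous_on {r..s} f"
    by (rule continuous_on_subset[OF continuous_nonneg_axis(1)]) (use assms in auto)
qed

lemma f_pos: "0 \<le> t \<Longrightarrow> 0 < f t"
  using f_mono[of 0 t] f0_pos by simp

lemma f_le: "0 \<le> t \<Longrightarrow> f t - f 0 \<le> t * f' t"
  using tangent[of t 0] by (cases "t = 0") (auto simp: algebra_simps)

lemma f_over_large: "\<exists>t0>0. \<forall>t\<ge>t0. C \<le> f t / t"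
proof -
  have "\<forall>\<^sub>F t in at_top. C \<le> f t / t"
    using superlinear by (simp add: filterlim_at_top)
  then obtain t0 where "\<forall>t\<ge>t0. C \<le> f t / t" by (auto simp: eventually_at_top_linorder)
  then show ?thesis by (intro exI[of _ "max 1 t0"]) auto
qed

lemma f'_large: "\<exists>t0>0. \<forall>t\<ge>t0. C \<le> f' t"
proof -
  obtain t0 where t0: "0 < t0" "\<And>t. t \<ge> t0 \<Longrightarrow> C + f 0 \<le> f t / t" using f_over_large by metis
  have "C \<le> f' t" if "t \<ge> max 1 t0" for t
  proof -
    have t: "1 \<le> t" "t0 \<le> t" using that by auto
    have "(f t - f 0) / t \<le> f' t"
      using f_le[of t] t by (simp add: divide_le_eq mult.commute)
    then have "f t / t - f' t \<le> f 0 / t" by (simp add: diff_divide_distrib)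
    also have "\<dots> \<le> f 0" using t f0_pos by (simp add: divide_le_eq)
    finally show ?thesis using t0(2)[OF t(2)] by linarith
  qed
  then show ?thesis by (intro exI[of _ "max 1 t0"]) auto
qed

lemma f_large: "\<exists>t0>0. \<forall>t\<ge>t0. C \<le> f t"
proof -
  obtain t0 where t0: "0 < t0" "\<And>t. t \<ge> t0 \<Longrightarrow> \<bar>C\<bar> \<le> f t / t" using f_over_large by metis
  have "C \<le> f t" if "t \<ge> max 1 t0" for t
  proof -
    have t: "1 \<le> t" "t0 \<le> t" using that by auto
    then have "\<bar>C\<bar> * t \<le> f t" using t0(2)[OF t(2)] by (simp add: le_divide_eq)
    moreover have "\<bar>C\<bar> * 1 \<le> \<bar>C\<bar> * t" using t by (intro mult_left_mono) simp_all
    ultimately show ?thesis by linarith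
  qed
  then show ?thesis by (intro exI[of _ "max 1 t0"]) auto
qed

lemma f'_ext_continuous: "continuous_on UNIV (\<lambda>s. f' (max 0 s))"
  by (rule continuous_on_compose2[OF continuous_nonneg_axis(2)]) (auto intro!: continuous_intros)

text \<open>
  \<open>K\<close> is the integral of \<open>f'\<^sup>2\<close> from \<open>0\<close>, and \<open>G\<close> that of \<open>f'' (f - f 0)\<close> after integration by parts.
\<close>

definition K :: "real \<Rightarrow> real" where "K = primitive (\<lambda>s. (f' (max 0 s))\<^sup>2)"

definition G :: "real \<Rightarrow> real" where "G t = f' t * (f t - f 0) - K t"

lemma K_deriv: "0 < t \<Longrightarrow> (K has_real_derivative (f' t)\<^sup>2) (at t)"
  using primitive_has_derivative[OF continuous_on_power[OF f'_ext_continuous], of t 2]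
    at_within_interior[of t "{0..}"]
  by (simp add: K_def interior_real_atLeast)

lemma K_mono: "0 \<le> K s" "0 \<le> r \<Longrightarrow> r \<le> s \<Longrightarrow> K r \<le> K s"
proof -
  have c: "continuous_on UNIV (\<lambda>s. (f' (max 0 s))\<^sup>2)" by (intro continuous_on_power f'_ext_continuous)
  show "0 \<le> K s" unfolding K_def by (rule primitive_nonneg[OF c]) simp
  show "K r \<le> K s" if "0 \<le> r" "r \<le> s"
  proof (rule DERIV_nonneg_imp_increasing_open[OF that(2)])
    show "\<exists>y. (K has_real_derivative y) (at x) \<and> 0 \<le> y" if "r < x" "x < s" for x
      using K_deriv[of x] that \<open>0 \<le> r\<close> by (intro exI[of _ "(f' x)\<^sup>2"]) simp
    show "continuous_on {r..s} K"
      unfolding K_def by (rule continuous_on_subset[OF primitive_continuous[OF c]]) simp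
  qed
qed

lemma G_deriv: "0 < t \<Longrightarrow> (G has_real_derivative f'' t * (f t - f 0)) (at t)"
  unfolding G_def by (rule derivative_eq_intros deriv_at K_deriv refl | assumption)+
    (simp add: power2_eq_square algebra_simps)

text \<open>
  The derivative \<open>f'' (f - f 0)\<close> of \<open>G\<close> exceeds that of \<open>4 f(0) f'\<close> once \<open>f\<close> is large, and half of
  \<open>4 f(0) f'\<close>, which is unbounded, makes up for the constant of integration.
\<close>

lemma G_large: "\<exists>t0>0. \<forall>t\<ge>t0. 2 * f 0 * f' t \<le> G t"
proof -
  \<comment> \<open>From \<open>\<tau>\<close> on, \<open>G' = f'' (f - f 0)\<close> is at least \<open>4 f 0 f''\<close>.\<close>
  obtain \<tau> where \<tau>: "0 < \<tau>" "\<And>t. t \<ge> \<tau> \<Longrightarrow> 5 * f 0 \<le> f t" using f_large by metis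
  define E where "E = 4 * f 0 * f' \<tau> - G \<tau>"
  obtain t1 where t1: "0 < t1" "\<And>t. t \<ge> t1 \<Longrightarrow> E / (2 * f 0) \<le> f' t" using f'_large by metis
  have "2 * f 0 * f' t \<le> G t" if "t \<ge> max \<tau> t1" for t
  proof -
    have "G \<tau> - 4 * f 0 * f' \<tau> \<le> G t - 4 * f 0 * f' t"
    proof (rule DERIV_nonneg_imp_nondecreasing[where f = "\<lambda>t. G t - 4 * f 0 * f' t"])
      fix x assume x: "\<tau> \<le> x" "x \<le> t"
      then have x0: "0 < x" using \<tau>(1) by simp
      have "((\<lambda>t. G t - 4 * f 0 * f' t) has_real_derivative f'' x * (f x - f 0) - 4 * f 0 * f'' x) (at x)"
        by (rule derivative_eq_intros deriv_at[OF x0] G_deriv[OF x0] refl)+ simp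
      moreover have "0 \<le> f'' x * (f x - f 0) - 4 * f 0 * f'' x"
        using mult_nonneg_nonneg[OF f''_nonneg[OF x0], of "f x - 5 * f 0"] \<tau>(2)[OF x(1)] by (simp add: algebra_simps)
      ultimately show "\<exists>y. ((\<lambda>t. G t - 4 * f 0 * f' t) has_real_derivative y) (at x) \<and> 0 \<le> y" by blast
    qed (use that in simp)
    moreover have "E \<le> 2 * f 0 * f' t"
      using t1(2)[of t] that f0_pos by (simp add: divide_le_eq mult.commute)
    ultimately show ?thesis by (simp add: E_def)
  qed
  then show ?thesis using \<tau>(1) by (intro exI[of _ "max \<tau> t1"]) auto
qed

text \<open>
  The slope used to test semistability: that of \<open>f\<close> up to the level \<open>m\<close>, continued by a constant,
  so that it is bounded and the corresponding primitive is an admissible test function.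
\<close>

definition slope :: "real \<Rightarrow> real \<Rightarrow> real" where
  "slope m s = f' (max 0 (min s m))"

lemma slope_continuous: "continuous_on UNIV (slope m)"
  unfolding slope_def
  by (rule continuous_on_compose2[OF continuous_nonneg_axis(2)]) (auto intro!: continuous_intros)

lemma slope_bounds: "0 \<le> m \<Longrightarrow> 0 \<le> slope m s \<and> slope m s \<le> f' m"
  unfolding slope_def by (auto intro!: f'_mono f'_nonneg)

lemma primitive_slope_below:
  assumes "0 \<le> s" "s \<le> m"
  shows "primitive (slope m) s = f s - f 0" "primitive (\<lambda>s. (slope m s)\<^sup>2) s = K s"
proof -
  show "primitive (slope m) s = f s - f 0"
  proof (rule primitive_eqI[OF assms(1)])
    fix t assume t: "0 \<le> t" "t \<le> s"
    then have "slope m t = f' t" using assms by (simp add: slope_def)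
    then show "(f has_real_derivative slope m t) (at t within {0..s})"
      using DERIV_subset[OF f_deriv[OF t(1)], of "{0..s}"] by simp
  qed
  show "primitive (\<lambda>s. (slope m s)\<^sup>2) s = K s"
    unfolding K_def by (rule primitive_cong[OF assms(1)]) (use assms in \<open>simp add: slope_def\<close>)
qed

lemma primitive_slope_above:
  assumes "0 \<le> m" "m \<le> s"
  shows "primitive (slope m) s = f m - f 0 + f' m * (s - m)"
    "primitive (\<lambda>s. (slope m s)\<^sup>2) s = K m + (f' m)\<^sup>2 * (s - m)"
proof -
  have c: "slope m t = f' m" if "m \<le> t" for t using that assms by (simp add: slope_def)
  show "primitive (slope m) s = f m - f 0 + f' m * (s - m)"
    using primitive_affine_tail[OF slope_continuous assms c] primitive_slope_below(1)[OF assms(1) order_refl] by simp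
  show "primitive (\<lambda>s. (slope m s)\<^sup>2) s = K m + (f' m)\<^sup>2 * (s - m)"
    using primitive_affine_tail[OF continuous_on_power[OF slope_continuous] assms, of m 2 "(f' m)\<^sup>2"]
      primitive_slope_below(2)[OF assms(1) order_refl] c by simp
qed

text \<open>
  Write \<open>g\<close> and \<open>H\<close> for the primitives of the slope and of its square. Below the level \<open>m\<close> the
  right-hand side is \<open>f G - f(0) f' (f - f(0))\<close>, and half of \<open>f G\<close> absorbs the loss because
  \<open>G \<ge> 2 f(0) f'\<close>. Above \<open>m\<close>, where \<open>g\<close> is affine, \<open>H = f'(m) g - G(m)\<close>; the convexity estimate
  \<open>f(s) \<le> f(m) + f'(s) (s - m)\<close> leaves at worst \<open>- f(0) f'(m) g\<close>, and \<open>f(s) G(m)\<close> makes up for it.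
\<close>

lemma semistability_gain:
  obtains t1 C where "0 < t1" "0 \<le> C" "\<And>t. t1 \<le> t \<Longrightarrow> 2 * f 0 * f' t \<le> G t"
    "\<And>m s. t1 \<le> m \<Longrightarrow> 0 < s \<Longrightarrow>
      (if t1 \<le> s \<and> s \<le> m then f s * G s / 2 else 0) - C
      \<le> f' s * (primitive (slope m) s)\<^sup>2 - f s * primitive (\<lambda>s. (slope m s)\<^sup>2) s"
proof -
  obtain t1 where t1: "0 < t1" "\<And>t. t1 \<le> t \<Longrightarrow> 2 * f 0 * f' t \<le> G t" using G_large by blast
  define C where "C = f t1 * K t1"
  have C: "0 \<le> C" using f_pos[of t1] K_mono(1) t1 by (simp add: C_def)
  have "(if t1 \<le> s \<and> s \<le> m then f s * G s / 2 else 0) - C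
      \<le> f' s * (primitive (slope m) s)\<^sup>2 - f s * primitive (\<lambda>s. (slope m s)\<^sup>2) s"
    if m: "t1 \<le> m" and s: "0 < s" for m s
  proof (cases "s \<le> m")
    case True
    have g: "primitive (slope m) s = f s - f 0" "primitive (\<lambda>s. (slope m s)\<^sup>2) s = K s"
      using primitive_slope_below[of s m] True s by simp_all
    show ?thesis
    proof (cases "t1 \<le> s")
      case True
      have "f' s * (f s - f 0)\<^sup>2 - f s * K s = f s * G s - f 0 * f' s * (f s - f 0)"
        by (simp add: G_def power2_eq_square algebra_simps)
      moreover have "f 0 * f' s * (f s - f 0) \<le> f 0 * f' s * f s"
        using f0_pos f'_nonneg[of s] s by (intro mult_left_mono) simp_all
      moreover have "f s * (2 * f 0 * f' s) \<le> f s * G s"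
        using t1(2)[OF True] f_pos[of s] s by (intro mult_left_mono) simp_all
      ultimately have "f s * G s / 2 \<le> f' s * (f s - f 0)\<^sup>2 - f s * K s"
        by (simp add: algebra_simps)
      then show ?thesis using C True \<open>s \<le> m\<close> by (simp add: g)
    next
      case False
      have "f s * K s \<le> f t1 * K t1"
        using False s f_mono[of s t1] K_mono(2)[of s t1] K_mono(1) f_pos[of t1] t1(1) by (intro mult_mono) simp_all
      moreover have "0 \<le> f' s * (f s - f 0)\<^sup>2" using f'_nonneg[of s] s by simp
      ultimately show ?thesis using False by (simp add: g C_def)
    qed
  next
    case False
    have m0: "0 < m" using m t1 by simp
    define g where "g = f m - f 0 + f' m * (s - m)"
    have g: "primitive (slope m) s = g" "primitive (\<lambda>s. (slope m s)\<^sup>2) s = f' m * g - G m"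
      using primitive_slope_above[of m s] False m0 by (simp_all add: g_def G_def power2_eq_square algebra_simps)
    have fm: "f 0 \<le> f m" using f_mono[of 0 m] m0 by simp
    have g0: "0 \<le> g" using fm f'_nonneg[of m] m0 False by (simp add: g_def)
    have gf: "g \<le> f s" using tangent[of m s] m0 s f0_pos by (simp add: g_def)
    have f'm: "f' m \<le> f' s" using f'_mono[of m s] False m0 by simp
    have fs: "0 < f s" using f_pos s by simp
    have "f s \<le> f m + f' s * (s - m)"
      using tangent[of s m] s m0 by (simp add: algebra_simps)
    from mult_left_mono[OF this f'_nonneg[of m]] m0
    have "f s * f' m \<le> f m * f' m + f' s * (f' m * (s - m))" by (simp add: algebra_simps)
    also have "f' m * (s - m) = g - (f m - f 0)" by (simp add: g_def)
    finally have "f' s * (f m - f 0) - f m * f' m \<le> f' s * g - f s * f' m" by (simp add: algebra_simps)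
    moreover have "f' m * (f m - f 0) \<le> f' s * (f m - f 0)" using fm f'm by (intro mult_right_mono) simp_all
    ultimately have "- (f 0 * f' m) \<le> f' s * g - f s * f' m" by (simp add: algebra_simps)
    from mult_right_mono[OF this g0]
    have "- (f 0 * f' m * g) \<le> f' s * g\<^sup>2 - f s * (f' m * g)" by (simp add: power2_eq_square algebra_simps)
    moreover have "f 0 * f' m * g \<le> f 0 * f' m * f s"
      using gf f0_pos f'_nonneg[of m] m0 by (intro mult_left_mono) simp_all
    moreover have "f s * (2 * f 0 * f' m) \<le> f s * G m"
      using t1(2)[OF m] fs by (intro mult_left_mono) simp_all
    moreover have "0 \<le> f s * (f 0 * f' m)" using fs f0_pos f'_nonneg[of m] m0 by simp
    ultimately have "0 \<le> f' s * g\<^sup>2 - f s * (f' m * g - G m)" by (simp add: algebra_simps)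
    then show ?thesis using False C by (simp add: g)
  qed
  with t1 C that show thesis by blast
qed

text \<open>
  The function \<open>Y = (f - f(0))\<^sup>p t\<^sup>-\<^sup>p\<^sup>-\<^sup>1\<close> satisfies \<open>Y' \<le> p f'\<^sup>p / t\<^sup>2\<close>, because \<open>f - f(0) \<le> t f'\<close>, while
  \<open>G' = f'' (f - f(0)) \<ge> (c / 2) f'\<^sup>p / t\<^sup>2\<close> for large \<open>t\<close>, by hypothesis. So \<open>Y\<close> is at most a multiple of \<open>G\<close> plus a
  constant, and \<open>G\<close> is unbounded.
\<close>

lemma G_growth:
  assumes p: "1 < p" and c: "0 < c" and T: "\<And>t. T \<le> t \<Longrightarrow> c * f' t powr p \<le> t\<^sup>2 * f t * f'' t"
  obtains t2 c2 where "0 < t2" "0 < c2" "\<And>t. t2 \<le> t \<Longrightarrow> c2 * (f t / t) powr (p + 1) \<le> f t * G t / 2"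
proof -
  obtain t1 where t1: "0 < t1" "\<And>t. t1 \<le> t \<Longrightarrow> 2 * f 0 * f' t \<le> G t" using G_large by blast
  obtain t3 where t3: "0 < t3" "\<And>t. t3 \<le> t \<Longrightarrow> 2 * f 0 \<le> f t" using f_large by metis
  define S where "S = max 1 (max T (max t1 t3))"
  define Y where "Y t = (f t - f 0) powr p * t powr (- p - 1)" for t
  define A where "A = 2 * p / c"
  have A: "0 < A" using p c by (simp add: A_def)
  define E where "E = Y S - A * G S"
  obtain t4 where t4: "0 < t4" "\<And>t. t4 \<le> t \<Longrightarrow> E / (2 * f 0) \<le> f' t" using f'_large by metis
  define t2 where "t2 = max S t4"
  define c2 where "c2 = (1 / 2) powr p / (2 * (A + 1))"
  have Y_le: "Y t \<le> (A + 1) * G t" if t: "t2 \<le> t" for t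
  proof -
    have "A * G S - Y S \<le> A * G t - Y t"
    proof (rule DERIV_nonneg_imp_nondecreasing[where f = "\<lambda>t. A * G t - Y t"])
      show "S \<le> t" using t by (simp add: t2_def)
      fix x assume x: "S \<le> x" "x \<le> t"
      then have x0: "0 < x" and xT: "T \<le> x" and x3: "t3 \<le> x" by (simp_all add: S_def)
      define d where "d = f x - f 0"
      have d: "0 < d" "f x / 2 \<le> d" using t3(2)[OF x3] f0_pos by (simp_all add: d_def)
      have f'x: "0 \<le> f' x" using f'_nonneg x0 by simp
      have fpos: "0 < f' x"
      proof (rule ccontr)
        assume "\<not> 0 < f' x"
        then have "x * f' x \<le> 0" using x0 by (simp add: mult_nonneg_nonpos)
        then show False using f_le[of x] x0 d(1) by (simp add: d_def)
      qed
      let ?DY = "d powr p * ((- p - 1) * x powr (- p - 1 - 1)) + p * d powr (p - 1) * f' x * x powr (- p - 1)"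
      have dY: "(Y has_real_derivative ?DY) (at x)"
      proof -
        have "((\<lambda>t. (f t - f 0) powr p) has_real_derivative p * (f x - f 0) powr (p - 1) * f' x) (at x)"
          using DERIV_fun_powr[of "\<lambda>t. f t - f 0" "f' x" x p] d(1) DERIV_diff[OF deriv_at(1)[OF x0] DERIV_const]
          by (simp add: d_def)
        from DERIV_mult[OF this has_real_derivative_powr[OF x0, of "- p - 1"]]
        show ?thesis unfolding Y_def[abs_def] d_def by (simp add: algebra_simps)
      qed
      have "d powr p * ((- p - 1) * x powr (- p - 1 - 1)) \<le> 0"
        using p by (intro mult_nonneg_nonpos mult_nonpos_nonneg) simp_all
      moreover have "p * d powr (p - 1) * f' x * x powr (- p - 1) \<le> p * (f' x powr p / x\<^sup>2)"
      proof -
        have "d powr (p - 1) \<le> (x * f' x) powr (p - 1)"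
          using f_le[of x] x0 d p by (intro powr_mono2) (simp_all add: d_def)
        also have "\<dots> = x powr (p - 1) * f' x powr (p - 1)" using x0 f'x by (simp add: powr_mult)
        finally have "d powr (p - 1) * (f' x * x powr (- p - 1))
            \<le> x powr (p - 1) * f' x powr (p - 1) * (f' x * x powr (- p - 1))"
          using f'x by (intro mult_right_mono) simp_all
        also have "\<dots> = (f' x powr (p - 1) * f' x powr 1) * (x powr (p - 1) * x powr (- p - 1))"
          using fpos by simp
        also have "\<dots> = f' x powr p * x powr (- 2)" unfolding powr_add[symmetric] by simp
        also have "\<dots> = f' x powr p / x\<^sup>2" using x0 by (simp add: powr_minus divide_inverse)
        finally have "p * (d powr (p - 1) * (f' x * x powr (- p - 1))) \<le> p * (f' x powr p / x\<^sup>2)"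
          using p by (intro mult_left_mono) simp_all
        then show ?thesis by (simp only: mult.assoc)
      qed
      ultimately have DY_le: "?DY \<le> p * (f' x powr p / x\<^sup>2)" by linarith
      have "c * (f' x powr p / x\<^sup>2) \<le> f'' x * f x"
        using T[OF xT] x0 by (simp add: field_simps)
      also have "f'' x * f x \<le> 2 * (f'' x * d)"
        using mult_left_mono[OF d(2) f''_nonneg[OF x0]] by simp
      finally have "p * (f' x powr p / x\<^sup>2) \<le> A * (f'' x * d)"
        using p c mult_left_mono[of "c * (f' x powr p / x\<^sup>2)" "2 * (f'' x * d)" "p / c"] by (simp add: A_def mult_ac)
      then have "0 \<le> A * (f'' x * d) - ?DY" using DY_le by linarith
      moreover have "((\<lambda>t. A * G t - Y t) has_real_derivative A * (f'' x * d) - ?DY) (at x)"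
        using DERIV_diff[OF DERIV_cmult[OF G_deriv[OF x0], of A] dY] by (simp add: d_def)
      ultimately show "\<exists>y. ((\<lambda>t. A * G t - Y t) has_real_derivative y) (at x) \<and> 0 \<le> y" by blast
    qed
    moreover have "E \<le> G t"
    proof -
      have "E \<le> 2 * f 0 * f' t" using t4(2)[of t] t f0_pos by (simp add: t2_def divide_le_eq mult.commute)
      also have "\<dots> \<le> G t" using t1(2)[of t] t by (simp add: t2_def S_def)
      finally show ?thesis .
    qed
    ultimately show ?thesis by (simp add: E_def algebra_simps)
  qed
  have "c2 * (f t / t) powr (p + 1) \<le> f t * G t / 2" if t: "t2 \<le> t" for t
  proof -
    have t0: "0 < t" "t3 \<le> t" using t by (simp_all add: t2_def S_def)
    have ft: "0 < f t" using f_pos t0 by simp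
    have "(f t / 2) powr p \<le> (f t - f 0) powr p"
      using t3(2)[OF t0(2)] ft p by (intro powr_mono2) simp_all
    then have "f t * ((f t / 2) powr p * t powr (- p - 1)) \<le> f t * Y t"
      unfolding Y_def using ft by (intro mult_left_mono mult_right_mono) simp_all
    also have "\<dots> \<le> f t * ((A + 1) * G t)" using Y_le[OF t] ft by (intro mult_left_mono) simp_all
    finally have 1: "f t * ((f t / 2) powr p * t powr (- p - 1)) \<le> (A + 1) * (f t * G t)" by (simp add: mult_ac)
    have "(f t / t) powr (p + 1) = (f t powr p * f t) * t powr (- p - 1)"
    proof -
      have "(f t / t) powr (p + 1) = f t powr (p + 1) / t powr (p + 1)"
        by (rule powr_divide)
      moreover have "f t powr (p + 1) = f t powr p * f t" using ft by (simp add: powr_add)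
      moreover have "t powr (- p - 1) = inverse (t powr (p + 1))"
        unfolding powr_minus[symmetric] by simp
      ultimately show ?thesis by (simp only: divide_inverse)
    qed
    moreover have "(f t / 2) powr p = (1 / 2) powr p * f t powr p"
      using ft by (simp add: powr_mult[symmetric])
    ultimately have "(1 / 2) powr p * (f t / t) powr (p + 1) = f t * ((f t / 2) powr p * t powr (- p - 1))"
      by (simp add: mult_ac)
    with 1 have "(1 / 2) powr p * (f t / t) powr (p + 1) \<le> (A + 1) * (f t * G t)" by simp
    then show ?thesis using A by (simp add: c2_def field_simps)
  qed
  moreover have "0 < t2" "0 < c2" using A by (simp_all add: t2_def S_def c2_def)
  ultimately show thesis using that by blast
qed

lemma semistability_lower_bound:
  assumes p: "1 < p" and c: "0 < c" and T: "\<And>t. T \<le> t \<Longrightarrow> c * f' t powr p \<le> t\<^sup>2 * f t * f'' t"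
  obtains t2 c2 C where "0 < t2" "0 < c2" "0 \<le> C"
    "\<And>m s. t2 \<le> m \<Longrightarrow> 0 < s \<Longrightarrow>
      (if t2 \<le> s \<and> s \<le> m then c2 * (f s / s) powr (p + 1) else 0) - C
      \<le> f' s * (primitive (slope m) s)\<^sup>2 - f s * primitive (\<lambda>s. (slope m s)\<^sup>2) s"
proof -
  obtain t1 C where t1: "0 < t1" "0 \<le> C" "\<And>t. t1 \<le> t \<Longrightarrow> 2 * f 0 * f' t \<le> G t"
    "\<And>m s. t1 \<le> m \<Longrightarrow> 0 < s \<Longrightarrow>
      (if t1 \<le> s \<and> s \<le> m then f s * G s / 2 else 0) - C
      \<le> f' s * (primitive (slope m) s)\<^sup>2 - f s * primitive (\<lambda>s. (slope m s)\<^sup>2) s"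
    by (rule semistability_gain) blast
  obtain t2 c2 where t2: "0 < t2" "0 < c2" "\<And>t. t2 \<le> t \<Longrightarrow> c2 * (f t / t) powr (p + 1) \<le> f t * G t / 2"
    by (rule G_growth[OF p c T]) blast+
  show thesis
  proof (rule that[of "max t1 t2" c2 C])
    fix m s :: real assume m: "max t1 t2 \<le> m" and s: "0 < s"
    have "0 \<le> f s * G s / 2" if "t1 \<le> s"
    proof -
      have "0 \<le> 2 * f 0 * f' s" using f0_pos f'_nonneg s by simp
      then have "0 \<le> G s" using t1(3)[OF that] by (rule order_trans)
      then show ?thesis using f_pos[of s] s by simp
    qed
    then have "(if max t1 t2 \<le> s \<and> s \<le> m then c2 * (f s / s) powr (p + 1) else 0)
        \<le> (if t1 \<le> s \<and> s \<le> m then f s * G s / 2 else 0)"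
      using t2(3)[of s] by auto
    with t1(4)[of m s] m s
    show "(if max t1 t2 \<le> s \<and> s \<le> m then c2 * (f s / s) powr (p + 1) else 0) - C
        \<le> f' s * (primitive (slope m) s)\<^sup>2 - f s * primitive (\<lambda>s. (slope m s)\<^sup>2) s" by simp
  qed (use t1 t2 in simp_all)
qed

end

section \<open>The integral estimate from semistability, and De Giorgi's iteration\<close>

text \<open>
  The nonlinearity is extended to negative arguments by the constant \<open>f 0\<close>.
\<close>

locale semistable_solution =
  elliptic_solution \<Omega> a "\<lambda>s. f (max 0 s)" u Du M\<^sub>0 + convex_nonlinearity f f' f''
  for \<Omega> :: "(real ^ 'n) set" and a u Du M\<^sub>0 f f' f'' +
  assumes stable: "semistable \<Omega> a f' u"
begin

abbreviation "F \<equiv> (\<lambda>s. f (max 0 s))"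

text \<open>
  Semistability is tested with \<open>g(u)\<close>, \<open>g' = slope m\<close>. Its right-hand side \<open>\<integral> g'(u)\<^sup>2 a(Du, Du)\<close> is turned
  into \<open>\<integral> F(u) H(u)\<close>, \<open>H' = g'\<^sup>2\<close>, by testing the equation with \<open>H(u)\<close>.
\<close>

lemma semistability_tested:
  assumes "0 \<le> m"
  shows "integrable Om (\<lambda>x. f' (u x) * (primitive (slope m) (u x))\<^sup>2)"
    and "integrable Om (\<lambda>x. F (u x) * primitive (\<lambda>s. (slope m s)\<^sup>2) (u x))"
    and "(LINT x|Om. f' (u x) * (primitive (slope m) (u x))\<^sup>2)
      \<le> (LINT x|Om. F (u x) * primitive (\<lambda>s. (slope m s)\<^sup>2) (u x))"
proof -
  have b: "\<bar>slope m s\<bar> \<le> f' m" for s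
    using slope_bounds[OF assms, of s] by simp
  have adm: "admissible (primitive (slope m)) (slope m)"
    by (rule admissible_bounded[OF slope_continuous b])
  have b2: "\<bar>(slope m s)\<^sup>2\<bar> \<le> (f' m)\<^sup>2" for s
    using power_mono[OF b[of s], of 2] by simp
  have adm2: "admissible (primitive (\<lambda>s. (slope m s)\<^sup>2)) (\<lambda>s. (slope m s)\<^sup>2)"
    by (rule admissible_bounded[OF continuous_on_power[OF slope_continuous] b2])
  have H: "H1_0 \<Omega> (\<lambda>x. primitive (slope m) (u x)) (\<lambda>x. slope m (u x) *\<^sub>R Du x)"
    using adm by (simp add: admissible_def)
  show "integrable Om (\<lambda>x. f' (u x) * (primitive (slope m) (u x))\<^sup>2)"
    using stable H unfolding semistable_def by blast
  show "integrable Om (\<lambda>x. F (u x) * primitive (\<lambda>s. (slope m s)\<^sup>2) (u x))"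
    using adm2 unfolding admissible_def by blast
  have "(LINT x|Om. f' (u x) * (primitive (slope m) (u x))\<^sup>2)
      \<le> (LINT x|Om. quad_form (a x) (slope m (u x) *\<^sub>R Du x) (slope m (u x) *\<^sub>R Du x))"
    using stable H unfolding semistable_def by blast
  also have "\<dots> = (LINT x|Om. (slope m (u x))\<^sup>2 * quad_form (a x) (Du x) (Du x))"
    by (simp only: quad_form_scaleR power2_eq_square mult.assoc)
  also have "\<dots> = (LINT x|Om. F (u x) * primitive (\<lambda>s. (slope m s)\<^sup>2) (u x))"
    using adm2 unfolding admissible_def by blast
  finally show "(LINT x|Om. f' (u x) * (primitive (slope m) (u x))\<^sup>2)
      \<le> (LINT x|Om. F (u x) * primitive (\<lambda>s. (slope m s)\<^sup>2) (u x))" .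
qed

text \<open>
  The bound is uniform in the level \<open>m\<close> at which the slope is frozen, so \<open>m \<rightarrow> \<infinity>\<close> by Fatou's lemma.
\<close>

lemma potential_bound:
  assumes t2: "0 < t\<^sub>2" "0 < c\<^sub>2" "0 \<le> C"
    and lower: "\<And>m s. t\<^sub>2 \<le> m \<Longrightarrow> 0 < s \<Longrightarrow>
      (if t\<^sub>2 \<le> s \<and> s \<le> m then c\<^sub>2 * (f s / s) powr q else 0) - C
      \<le> f' s * (primitive (slope m) s)\<^sup>2 - f s * primitive (\<lambda>s. (slope m s)\<^sup>2) s"
  defines "W \<equiv> \<lambda>s. if t\<^sub>2 \<le> s then (F s / s) powr q else 0"
  shows "integrable Om (\<lambda>x. W (u x))" "(LINT x|Om. W (u x)) \<le> C * measure Om \<Omega> / c\<^sub>2"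
proof -
  define Wk where "Wk k s = (if s \<le> t\<^sub>2 + real k then W s else 0)" for k :: nat and s
  have Wm[measurable]: "W \<in> borel_measurable borel"
    unfolding W_def by measurable
  have Wkm[measurable]: "Wk k \<in> borel_measurable borel" for k
    unfolding Wk_def by measurable
  have W_nonneg: "0 \<le> W s" for s by (simp add: W_def)
  have Wk_nonneg: "0 \<le> Wk k s" for k s by (simp add: Wk_def W_nonneg)
  let ?R = "\<lambda>k x. f' (u x) * (primitive (slope (t\<^sub>2 + real k)) (u x))\<^sup>2
      - F (u x) * primitive (\<lambda>s. (slope (t\<^sub>2 + real k) s)\<^sup>2) (u x)"
  have intR: "integrable Om (?R k)" for k :: nat
    using semistability_tested(1,2)[of "t\<^sub>2 + real k"] t2 by simp
  have le: "AE x in Om. c\<^sub>2 * Wk k (u x) \<le> ?R k x + C" for k :: nat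
  proof (rule eventually_mono[OF u_pos])
    fix x assume "0 < u x"
    then show "c\<^sub>2 * Wk k (u x) \<le> ?R k x + C"
      using lower[of "t\<^sub>2 + real k" "u x"] by (auto simp: Wk_def W_def max_def)
  qed
  have intW: "integrable Om (\<lambda>x. Wk k (u x))" for k
  proof -
    have "integrable Om (\<lambda>x. c\<^sub>2 * Wk k (u x))"
    proof (rule Bochner_Integration.integrable_bound)
      show "integrable Om (\<lambda>x. ?R k x + C)" using intR by simp
      show "AE x in Om. norm (c\<^sub>2 * Wk k (u x)) \<le> norm (?R k x + C)"
      proof (rule eventually_mono[OF le])
        fix x assume le: "c\<^sub>2 * Wk k (u x) \<le> ?R k x + C"
        moreover have "0 \<le> c\<^sub>2 * Wk k (u x)" using t2 Wk_nonneg by simp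
        ultimately show "norm (c\<^sub>2 * Wk k (u x)) \<le> norm (?R k x + C)" by simp
      qed
    qed measurable
    then show ?thesis using t2 by simp
  qed
  have bd: "(LINT x|Om. Wk k (u x)) \<le> C * measure Om \<Omega> / c\<^sub>2" for k
  proof -
    have "c\<^sub>2 * (LINT x|Om. Wk k (u x)) = (LINT x|Om. c\<^sub>2 * Wk k (u x))" by simp
    also have "\<dots> \<le> (LINT x|Om. ?R k x + C)"
      using intW intR le by (intro integral_mono_AE) simp_all
    also have "\<dots> = (LINT x|Om. ?R k x) + C * measure Om \<Omega>"
      using intR by (subst Bochner_Integration.integral_add) simp_all
    also have "(LINT x|Om. ?R k x) \<le> 0"
      using semistability_tested[of "t\<^sub>2 + real k"] t2 by (subst Bochner_Integration.integral_diff) simp_all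
    finally show ?thesis using t2 by (simp add: le_divide_eq mult.commute)
  qed
  have lim: "(\<lambda>k. Wk k s) \<longlonglongrightarrow> W s" for s
  proof (rule tendsto_eventually)
    obtain n :: nat where n: "s - t\<^sub>2 \<le> real n" using real_arch_simple by blast
    show "\<forall>\<^sub>F k in sequentially. Wk k s = W s"
      using eventually_ge_at_top[of n]
    proof eventually_elim
      case (elim k)
      then have "s \<le> t\<^sub>2 + real k" using n by (simp add: le_diff_eq)
      then show ?case by (simp add: Wk_def)
    qed
  qed
  have m: "(\<lambda>x. W (u x)) \<in> borel_measurable Om" by measurable
  have nn: "AE x in Om. 0 \<le> Wk k (u x)" for k using Wk_nonneg by simp
  have l: "AE x in Om. (\<lambda>k. Wk k (u x)) \<longlonglongrightarrow> W (u x)" using lim by simp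
  show "integrable Om (\<lambda>x. W (u x))" "(LINT x|Om. W (u x)) \<le> C * measure Om \<Omega> / c\<^sub>2"
    by (rule Fatou_integrable[OF intW nn l m bd tendsto_const])+
qed

end

text \<open>
  De Giorgi's fast geometric convergence along the levels \<open>k\<^sub>0 (2 - 2\<^sup>-\<^sup>j)\<close>: the superlinear power
  \<open>1 + \<delta>\<close> beats the geometric factor once the initial value is small.
\<close>

lemma de_giorgi_iteration:
  fixes m :: "real \<Rightarrow> real"
  assumes k0: "0 < k\<^sub>0" and B: "0 \<le> B" and \<delta>: "0 < \<delta>"
    and nonneg: "\<And>k. 0 \<le> m k" and anti: "\<And>k h. k\<^sub>0 \<le> k \<Longrightarrow> k \<le> h \<Longrightarrow> m h \<le> m k"
    and step: "\<And>k h. k\<^sub>0 \<le> k \<Longrightarrow> k < h \<Longrightarrow> m h \<le> B * (k / (h - k))\<^sup>2 * m k powr (1 + \<delta>)"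
    and small: "16 * B * m k\<^sub>0 powr \<delta> \<le> 4 powr (- 1 / \<delta>)"
  shows "m (2 * k\<^sub>0) = 0"
proof -
  define \<mu> :: real where "\<mu> = 4 powr (- 1 / \<delta>)"
  define k where "k j = k\<^sub>0 * (2 - (1/2) ^ j)" for j :: nat
  have \<mu>: "0 < \<mu>" "\<mu> < 1"
    using \<delta> powr_less_mono[of "- 1 / \<delta>" 0 4] by (simp_all add: \<mu>_def)
  have \<mu>_pow: "4 * \<mu> powr \<delta> = 1"
    unfolding \<mu>_def powr_powr using \<delta> by simp
  have half: "(1/2::real) ^ j \<le> 1" for j by (simp add: power_le_one)
  have kge: "k\<^sub>0 \<le> k j" and kle: "k j \<le> 2 * k\<^sub>0" for j
    using mult_left_mono[of 1 "2 - (1/2)^j" k\<^sub>0] half[of j] k0 by (simp_all add: k_def)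
  have kdiff: "k (Suc j) - k j = k\<^sub>0 * (1/2) ^ Suc j" for j
    by (simp add: k_def algebra_simps)
  have ratio: "(k j / (k (Suc j) - k j))\<^sup>2 \<le> 16 * 4 ^ j" for j
  proof -
    have "k j / (k (Suc j) - k j) \<le> 2 * k\<^sub>0 / (k\<^sub>0 * (1/2) ^ Suc j)"
      unfolding kdiff using kle[of j] k0 by (intro divide_right_mono) simp_all
    also have "\<dots> = 4 * 2 ^ j" using k0 by (simp add: power_divide field_simps)
    finally have "k j / (k (Suc j) - k j) \<le> 4 * 2 ^ j" .
    moreover have "0 \<le> k j / (k (Suc j) - k j)"
      unfolding kdiff using kge[of j] k0 by (intro divide_nonneg_nonneg) simp_all
    ultimately have "(k j / (k (Suc j) - k j))\<^sup>2 \<le> (4 * 2 ^ j)\<^sup>2" by (intro power_mono)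
    also have "(4 * 2 ^ j :: real)\<^sup>2 = 16 * 4 ^ j"
      by (simp add: power_mult_distrib power_mult[symmetric] mult.commute[of _ 2] power_mult)
    finally show ?thesis .
  qed
  have decay: "m (k j) \<le> m k\<^sub>0 * \<mu> ^ j" for j
  proof (induction j)
    case 0
    then show ?case by (simp add: k_def)
  next
    case (Suc j)
    have lt: "k j < k (Suc j)" 
    proof -
      have "0 < k (Suc j) - k j" unfolding kdiff using k0 by simp
      then show ?thesis by simp
    qed
    have "m (k (Suc j)) \<le> B * (k j / (k (Suc j) - k j))\<^sup>2 * m (k j) powr (1 + \<delta>)"
      by (rule step[OF kge lt])
    also have "\<dots> \<le> B * (16 * 4 ^ j) * (m k\<^sub>0 * \<mu> ^ j) powr (1 + \<delta>)"
      using Suc.IH nonneg B ratio[of j] \<delta> by (intro mult_mono powr_mono2) simp_all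
    also have "\<dots> = (16 * B * m k\<^sub>0 powr \<delta>) * (m k\<^sub>0 * \<mu> ^ j) * (4 ^ j * (\<mu> ^ j) powr \<delta>)"
    proof -
      have "x powr (1 + \<delta>) = x * x powr \<delta>" if "0 \<le> x" for x :: real
        using that by (cases "x = 0") (simp_all add: powr_add)
      then have "(m k\<^sub>0 * \<mu> ^ j) powr (1 + \<delta>) = (m k\<^sub>0 * \<mu> ^ j) * (m k\<^sub>0 * \<mu> ^ j) powr \<delta>"
        using nonneg[of k\<^sub>0] \<mu> by simp
      moreover have "(m k\<^sub>0 * \<mu> ^ j) powr \<delta> = m k\<^sub>0 powr \<delta> * (\<mu> ^ j) powr \<delta>"
        using nonneg[of k\<^sub>0] \<mu> by (simp add: powr_mult)
      ultimately show ?thesis by (simp only: mult_ac)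
    qed
    also have "4 ^ j * (\<mu> ^ j) powr \<delta> = 1"
    proof -
      have "(\<mu> ^ j) powr \<delta> = (\<mu> powr \<delta>) ^ j"
        using \<mu> by (simp add: powr_realpow[symmetric] powr_powr mult.commute)
      then have "4 ^ j * (\<mu> ^ j) powr \<delta> = (4 * \<mu> powr \<delta>) ^ j" by (simp add: power_mult_distrib)
      then show ?thesis by (simp add: \<mu>_pow)
    qed
    also have "(16 * B * m k\<^sub>0 powr \<delta>) * (m k\<^sub>0 * \<mu> ^ j) * 1 \<le> \<mu> * (m k\<^sub>0 * \<mu> ^ j) * 1"
      using small nonneg[of k\<^sub>0] \<mu> by (intro mult_right_mono) (simp_all add: \<mu>_def)
    finally show ?case by (simp add: mult_ac)
  qed
  have "(\<lambda>j. m k\<^sub>0 * \<mu> ^ j) \<longlonglongrightarrow> 0"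
    using \<mu> by (intro tendsto_mult_right_zero LIMSEQ_realpow_zero) simp_all
  moreover have "m (2 * k\<^sub>0) \<le> m k\<^sub>0 * \<mu> ^ j" for j
    using anti[OF kge kle, of j] decay[of j] by (rule order_trans)
  ultimately have "m (2 * k\<^sub>0) \<le> 0"
    by (intro LIMSEQ_le_const) auto
  then show ?thesis using nonneg[of "2 * k\<^sub>0"] by simp
qed

section \<open>Morrey bounds from integrability\<close>

lemma nn_integral_lborel_reflect_scale:
  fixes g :: "'a::euclidean_space \<Rightarrow> ennreal"
  assumes [measurable]: "g \<in> borel_measurable borel" and t: "0 < t"
  shows "(\<integral>\<^sup>+y. g (z - t *\<^sub>R y) \<partial>lborel) = ennreal (t powr (- real DIM('a))) * (\<integral>\<^sup>+x. g x \<partial>lborel)"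
proof -
  let ?T = "\<lambda>x::'a. z + (- t) *\<^sub>R x"
  have "(\<integral>\<^sup>+x. g x \<partial>lborel) = (\<integral>\<^sup>+x. g x \<partial>density (distr lborel borel ?T) (\<lambda>_. ennreal (\<bar>- t\<bar> ^ DIM('a))))"
    using lborel_affine[of "- t" z] t by simp
  also have "\<dots> = (\<integral>\<^sup>+x. ennreal (t ^ DIM('a)) * g x \<partial>distr lborel borel ?T)"
    using t by (subst nn_integral_density) simp_all
  also have "\<dots> = (\<integral>\<^sup>+x. ennreal (t ^ DIM('a)) * g (?T x) \<partial>lborel)"
    by (rule nn_integral_distr) measurable
  also have "\<dots> = ennreal (t ^ DIM('a)) * (\<integral>\<^sup>+x. g (z - t *\<^sub>R x) \<partial>lborel)"
    by (subst nn_integral_cmult) simp_all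
  finally have "ennreal (t powr (- real DIM('a))) * (\<integral>\<^sup>+x. g x \<partial>lborel)
      = (ennreal (t powr (- real DIM('a))) * ennreal (t ^ DIM('a))) * (\<integral>\<^sup>+x. g (z - t *\<^sub>R x) \<partial>lborel)"
    by (simp only: mult.assoc)
  also have "ennreal (t powr (- real DIM('a))) * ennreal (t ^ DIM('a)) = 1"
    using t by (simp add: ennreal_mult[symmetric] powr_minus powr_realpow)
  finally show ?thesis by simp
qed

text \<open>
  Hoelder's inequality on cubes is replaced by the pointwise bound \<open>v \<le> s + s powr (1 - q) * w\<close>,
  which holds for \<open>w = v powr q\<close>, used for the optimal \<open>s = t powr (- n / q)\<close>;
  interpolation with the trivial bound by the total mass \<open>\<mu>\<close> makes the constant small with \<open>\<mu>\<close>.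
\<close>

lemma morrey_bound:
  fixes v w :: "real ^ 'n \<Rightarrow> real"
  assumes [measurable]: "v \<in> borel_measurable borel" "w \<in> borel_measurable borel"
    and nonneg: "\<And>x. 0 \<le> v x" "\<And>x. 0 \<le> w x"
    and young: "\<And>s x. 0 < s \<Longrightarrow> v x \<le> s + s powr (1 - q) * w x"
    and q: "1 < q" and w: "(\<integral>\<^sup>+x. ennreal (w x) \<partial>lborel) \<le> ennreal C\<^sub>1" "0 \<le> C\<^sub>1"
    and v: "(\<integral>\<^sup>+x. ennreal (v x) \<partial>lborel) \<le> ennreal \<mu>" "0 \<le> \<mu>"
    and \<delta>: "0 < \<delta>" "\<delta> < 1" and t: "0 < t"
  defines "n \<equiv> real CARD('n)"
  shows "(\<integral>\<^sup>+y. ennreal (v (z - t *\<^sub>R y)) * indicator shift_cube y \<partial>lborel)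
    \<le> ennreal (\<mu> powr \<delta> * (1 + C\<^sub>1) powr (1 - \<delta>)) * ennreal (t powr (- (n * \<delta> + n / q * (1 - \<delta>))))"
proof -
  have Qm[measurable]: "(shift_cube :: (real^'n) set) \<in> sets borel" by (simp add: shift_cube_def)
  let ?A = "\<integral>\<^sup>+y. ennreal (v (z - t *\<^sub>R y)) * indicator shift_cube y \<partial>lborel"
  define X1 where "X1 = t powr (- n) * \<mu>"
  define X2 where "X2 = t powr (- n / q) * (1 + C\<^sub>1)"
  \<comment> \<open>This choice balances the two terms \<open>l\<close> and \<open>l powr (1 - q) * t powr (- n)\<close> of the Young bound.\<close>
  define l where "l = t powr (- n / q)"
  have l: "0 < l" using t by (simp add: l_def)
  have X: "0 \<le> X1" "0 \<le> X2" using v(2) w(2) by (simp_all add: X1_def X2_def)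
  have "?A \<le> (\<integral>\<^sup>+y. ennreal (v (z - t *\<^sub>R y)) \<partial>lborel)"
    by (rule nn_integral_mono) (simp add: indicator_def)
  also have "\<dots> = ennreal (t powr (- n)) * (\<integral>\<^sup>+x. ennreal (v x) \<partial>lborel)"
    using nn_integral_lborel_reflect_scale[of "\<lambda>x. ennreal (v x)" t z] t by (simp add: n_def)
  also have "\<dots> \<le> ennreal (t powr (- n)) * ennreal \<mu>"
    by (rule mult_left_mono[OF v(1)]) simp
  also have "\<dots> = ennreal X1" by (simp add: X1_def ennreal_mult v(2))
  finally have A1: "?A \<le> ennreal X1" .
  have "?A \<le> (\<integral>\<^sup>+y. ennreal l * indicator shift_cube y + ennreal (l powr (1 - q)) * ennreal (w (z - t *\<^sub>R y)) \<partial>lborel)"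
  proof (rule nn_integral_mono)
    fix y
    have "ennreal (v (z - t *\<^sub>R y)) \<le> ennreal (l + l powr (1 - q) * w (z - t *\<^sub>R y))"
      by (rule ennreal_leI[OF young[OF l]])
    also have "\<dots> = ennreal l + ennreal (l powr (1 - q)) * ennreal (w (z - t *\<^sub>R y))"
      using l nonneg(2) by (simp add: ennreal_plus ennreal_mult)
    finally show "ennreal (v (z - t *\<^sub>R y)) * indicator shift_cube y
        \<le> ennreal l * indicator shift_cube y + ennreal (l powr (1 - q)) * ennreal (w (z - t *\<^sub>R y))"
      by (simp add: indicator_def)
  qed
  also have "\<dots> = ennreal l + ennreal (l powr (1 - q)) * (\<integral>\<^sup>+y. ennreal (w (z - t *\<^sub>R y)) \<partial>lborel)"
    by (subst nn_integral_add) (simp_all add: nn_integral_cmult nn_integral_cmult_indicator shift_cube_measure)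
  also have "(\<integral>\<^sup>+y. ennreal (w (z - t *\<^sub>R y)) \<partial>lborel) = ennreal (t powr (- n)) * (\<integral>\<^sup>+x. ennreal (w x) \<partial>lborel)"
    using nn_integral_lborel_reflect_scale[of "\<lambda>x. ennreal (w x)" t z] t by (simp add: n_def)
  also have "ennreal l + ennreal (l powr (1 - q)) * (ennreal (t powr (- n)) * (\<integral>\<^sup>+x. ennreal (w x) \<partial>lborel))
      \<le> ennreal l + ennreal (l powr (1 - q)) * (ennreal (t powr (- n)) * ennreal C\<^sub>1)"
    by (intro add_left_mono mult_left_mono w) simp_all
  also have "\<dots> = ennreal (l + (l powr (1 - q) * t powr (- n)) * C\<^sub>1)"
    using w(2) l by (simp add: ennreal_mult ennreal_plus mult.assoc)
  also have "l powr (1 - q) * t powr (- n) = l"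
    using q by (simp add: l_def powr_powr powr_add[symmetric] field_simps)
  also have "l + l * C\<^sub>1 = X2" by (simp add: l_def X2_def algebra_simps)
  finally have A2: "?A \<le> ennreal X2" .
  define x where "x = enn2real ?A"
  have Ax: "?A = ennreal x"
    using A1 unfolding x_def by (metis ennreal_enn2real ennreal_less_top order_le_less_trans)
  have x: "0 \<le> x" "x \<le> X1" "x \<le> X2"
    using A1 A2 X unfolding Ax by (simp_all add: x_def ennreal_le_iff)
  \<comment> \<open>Interpolation between the bound by the mass and the bound by the \<open>L\<^sup>q\<close> norm.\<close>
  have "x = x powr \<delta> * x powr (1 - \<delta>)"
    using x(1) by (cases "x = 0") (simp_all add: powr_add[symmetric])
  also have "\<dots> \<le> X1 powr \<delta> * X2 powr (1 - \<delta>)"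
    using x \<delta> by (intro mult_mono powr_mono2) simp_all
  also have "\<dots> = (\<mu> powr \<delta> * (1 + C\<^sub>1) powr (1 - \<delta>)) * (t powr (- n * \<delta>) * t powr (- n / q * (1 - \<delta>)))"
    using v(2) w(2) by (simp add: X1_def X2_def powr_mult powr_powr)
  also have "t powr (- n * \<delta>) * t powr (- n / q * (1 - \<delta>)) = t powr (- (n * \<delta> + n / q * (1 - \<delta>)))"
    unfolding powr_add[symmetric] by (simp add: algebra_simps)
  finally show ?thesis
    unfolding Ax using ennreal_leI by (simp add: ennreal_mult[symmetric])
qed

text \<open>
  Fatou's lemma along approximating test functions; the factor \<open>2\<close> comes from estimating the energies
  of the approximations by \<open>2 |\<nabla>\<phi> - Dw|\<^sup>2 + 2 |Dw|\<^sup>2\<close>.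
\<close>

lemma trace_inequality_H1_0:
  fixes v :: "real ^ 'n \<Rightarrow> real" and \<Omega> :: "(real ^ 'n) set"
  assumes \<Omega>: "open \<Omega>" "\<Omega> \<in> lmeasurable" and R: "0 \<le> R" "\<Omega> \<subseteq> ball 0 R"
    and H: "H1_0 \<Omega> w Dw"
    and vm[measurable]: "v \<in> borel_measurable borel" and v: "\<And>x. 0 \<le> v x"
    and \<sigma>: "\<sigma> < 2" and N: "0 \<le> N"
    and morrey: "\<And>z t. 0 < t \<Longrightarrow>
      (\<integral>\<^sup>+y. ennreal (v (z - t *\<^sub>R y)) * indicator shift_cube y \<partial>lborel) \<le> ennreal N * ennreal (t powr (- \<sigma>))"
  defines "K \<equiv> (2 * R + 1) powr (1 - \<sigma> / 2) / (1 - \<sigma> / 2)"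
  shows "integrable (lebesgue_on \<Omega>) (\<lambda>x. v x * (w x)\<^sup>2)"
    and "(LINT x|lebesgue_on \<Omega>. v x * (w x)\<^sup>2)
      \<le> 2 * (K\<^sup>2 * (2 * real CARD('n))\<^sup>2) * N * (LINT x|lebesgue_on \<Omega>. (norm (Dw x))\<^sup>2)"
proof -
  define c where "c = K\<^sup>2 * (2 * real CARD('n))\<^sup>2"
  have c: "0 \<le> c" by (simp add: c_def)
  obtain \<phi> where \<phi>: "\<And>k::nat. test_function \<Omega> (\<phi> k)"
    and l2: "(\<lambda>k. LINT x|lebesgue_on \<Omega>. (norm (gradient (\<phi> k) x - Dw x))\<^sup>2) \<longlonglongrightarrow> 0"
    and ae: "AE x in lebesgue_on \<Omega>. (\<lambda>k. \<phi> k x) \<longlonglongrightarrow> w x"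
    by (rule H1_0_approx_AE[OF H \<Omega>(2)]) blast
  have sqD: "square_integrable \<Omega> Dw" and wm: "w \<in> borel_measurable (lebesgue_on \<Omega>)"
    using H by (simp_all add: H1_0_def square_integrable_def)
  note [measurable] = wm borel_measurable_lebesgue_onI[OF vm]
  note sq\<phi> = test_function_square_integrable(2)[OF \<phi> \<Omega>(2)]
  have test: "integrable (lebesgue_on \<Omega>) (\<lambda>x. v x * (\<phi> k x)\<^sup>2)"
    "(LINT x|lebesgue_on \<Omega>. v x * (\<phi> k x)\<^sup>2) \<le> c * N * (LINT x|lebesgue_on \<Omega>. (norm (gradient (\<phi> k) x))\<^sup>2)" for k
  proof -
    note [measurable] = test_function_borel[OF \<phi>]
    have m\<phi>: "(\<lambda>x. v x * (\<phi> k x)\<^sup>2) \<in> borel_measurable borel" by measurable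
    obtain S where S: "compact S" "S \<subseteq> \<Omega>" "\<And>x. x \<notin> S \<Longrightarrow> gradient (\<phi> k) x = 0"
      using test_function_support[OF \<phi>[of k]] by metis
    have "continuous_on UNIV (\<lambda>x. (norm (gradient (\<phi> k) x))\<^sup>2)"
      by (rule continuous_on_power[OF continuous_on_norm[OF test_function_continuous(2)[OF \<phi>]]])
    then have gi: "integrable lborel (\<lambda>x. (norm (gradient (\<phi> k) x))\<^sup>2)"
      by (rule continuous_compact_support_integrable[OF _ S(1)]) (use S in simp)
    have gO: "(LINT x|lebesgue_on \<Omega>. (norm (gradient (\<phi> k) x))\<^sup>2) = (LINT x|lborel. (norm (gradient (\<phi> k) x))\<^sup>2)"
      by (rule integral_lebesgue_on_eq_lborel[OF _ \<Omega>(1)]) (use S in \<open>auto dest: subsetD\<close>)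
    have "(\<integral>\<^sup>+x. ennreal (v x * (\<phi> k x)\<^sup>2) \<partial>lebesgue_on \<Omega>) \<le> (\<integral>\<^sup>+x. ennreal (v x * (\<phi> k x)\<^sup>2) \<partial>lebesgue)"
      using \<Omega>(1) by (subst nn_integral_restrict_space) (auto intro!: nn_integral_mono simp: indicator_def)
    also have "\<dots> = (\<integral>\<^sup>+x. ennreal (v x) * ennreal ((\<phi> k x)\<^sup>2) \<partial>lborel)"
      by (simp add: nn_integral_completion ennreal_mult v)
    also have "\<dots> \<le> ennreal c * ennreal N * (\<integral>\<^sup>+x. ennreal ((norm (gradient (\<phi> k) x))\<^sup>2) \<partial>lborel)"
      unfolding c_def K_def by (rule trace_inequality_test_function[OF \<phi> R _ \<sigma> morrey]) measurable
    also have "\<dots> = ennreal (c * N * (LINT x|lebesgue_on \<Omega>. (norm (gradient (\<phi> k) x))\<^sup>2))"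
      using c N by (simp add: gO nn_integral_eq_integral[OF gi] ennreal_mult)
    finally have bd: "(\<integral>\<^sup>+x. ennreal (v x * (\<phi> k x)\<^sup>2) \<partial>lebesgue_on \<Omega>)
        \<le> ennreal (c * N * (LINT x|lebesgue_on \<Omega>. (norm (gradient (\<phi> k) x))\<^sup>2))" .
    show int: "integrable (lebesgue_on \<Omega>) (\<lambda>x. v x * (\<phi> k x)\<^sup>2)"
      using bd v by (intro integrableI_nonneg borel_measurable_lebesgue_onI[OF m\<phi>])
        (auto intro: order_le_less_trans ennreal_less_top)
    show "(LINT x|lebesgue_on \<Omega>. v x * (\<phi> k x)\<^sup>2) \<le> c * N * (LINT x|lebesgue_on \<Omega>. (norm (gradient (\<phi> k) x))\<^sup>2)"
      using bd v c N by (subst (asm) nn_integral_eq_integral[OF int]) (auto simp: ennreal_le_iff)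
  qed
  have bd: "(LINT x|lebesgue_on \<Omega>. v x * (\<phi> k x)\<^sup>2)
      \<le> c * N * (2 * (LINT x|lebesgue_on \<Omega>. (norm (gradient (\<phi> k) x - Dw x))\<^sup>2) + 2 * (LINT x|lebesgue_on \<Omega>. (norm (Dw x))\<^sup>2))" for k
  proof -
    have "(LINT x|lebesgue_on \<Omega>. (norm (gradient (\<phi> k) x))\<^sup>2)
        \<le> 2 * (LINT x|lebesgue_on \<Omega>. (norm (gradient (\<phi> k) x - Dw x))\<^sup>2) + 2 * (LINT x|lebesgue_on \<Omega>. (norm (Dw x))\<^sup>2)"
      using square_integrable_add(2)[OF square_integrable_diff(1)[OF sq\<phi> sqD] sqD] by simp
    from mult_left_mono[OF this mult_nonneg_nonneg[OF c N]] show ?thesis by (rule order_trans[OF test(2)])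
  qed
  have lim: "(\<lambda>k. c * N * (2 * (LINT x|lebesgue_on \<Omega>. (norm (gradient (\<phi> k) x - Dw x))\<^sup>2) + 2 * (LINT x|lebesgue_on \<Omega>. (norm (Dw x))\<^sup>2)))
      \<longlonglongrightarrow> c * N * (2 * 0 + 2 * (LINT x|lebesgue_on \<Omega>. (norm (Dw x))\<^sup>2))"
    by (intro tendsto_intros l2)
  have nn: "AE x in lebesgue_on \<Omega>. 0 \<le> v x * (\<phi> k x)\<^sup>2" for k using v by simp
  have conv: "AE x in lebesgue_on \<Omega>. (\<lambda>k. v x * (\<phi> k x)\<^sup>2) \<longlonglongrightarrow> v x * (w x)\<^sup>2"
    by (rule eventually_mono[OF ae]) (intro tendsto_intros)
  have m: "(\<lambda>x. v x * (w x)\<^sup>2) \<in> borel_measurable (lebesgue_on \<Omega>)" by measurable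
  note Fatou = Fatou_integrable[OF test(1) nn conv m bd lim]
  show "integrable (lebesgue_on \<Omega>) (\<lambda>x. v x * (w x)\<^sup>2)" by (rule Fatou(1))
  show "(LINT x|lebesgue_on \<Omega>. v x * (w x)\<^sup>2)
      \<le> 2 * (K\<^sup>2 * (2 * real CARD('n))\<^sup>2) * N * (LINT x|lebesgue_on \<Omega>. (norm (Dw x))\<^sup>2)"
    using Fatou(2) by (simp add: c_def mult_ac)
qed

section \<open>Decay of the level sets\<close>

context semistable_solution
begin

text \<open>
  The potential \<open>V = f(u)/u\<close> restricted to the level set \<open>{u > k}\<close>, as a function of the value of \<open>u\<close>.
\<close>

definition level_potential :: "real \<Rightarrow> real \<Rightarrow> real" where
  "level_potential k s = (if k < s then F s / s else 0)"

lemma level_potential_meas[measurable]: "level_potential k \<in> borel_measurable borel"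
  unfolding level_potential_def by measurable

lemma level_potential_nonneg: "0 \<le> k \<Longrightarrow> 0 \<le> level_potential k s"
  using F_nonneg[of s] by (simp add: level_potential_def)

lemma level_potential_integrable:
  assumes "0 < k"
  shows "integrable Om (\<lambda>x. level_potential k (u x))"
proof (rule Bochner_Integration.integrable_bound[OF integrable_mult_right[OF F_integrable, of "1 / k"]])
  show "AE x in Om. norm (level_potential k (u x)) \<le> norm (1 / k * F (u x))"
  proof (rule AE_I2)
    fix x
    have "F s / s \<le> F s / k" if "k < s" for s
      using that assms F_nonneg[of s] by (intro divide_left_mono) simp_all
    then show "norm (level_potential k (u x)) \<le> norm (1 / k * F (u x))"
      using assms F_nonneg[of "u x"] by (auto simp: level_potential_def)
  qed
qed measurable

text \<open>
  With \<open>w = (u - k)\<^sup>+\<close>, on \<open>{u > k}\<close> one has \<open>f(u) w = V (w\<^sup>2 + k w) \<le> V (3/2 w\<^sup>2 + k\<^sup>2/2)\<close>.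
\<close>

lemma pos_part_energy:
  assumes coercive: "0 < c\<^sub>0" "\<And>x \<xi>. x \<in> \<Omega> \<Longrightarrow> c\<^sub>0 * (norm \<xi>)\<^sup>2 \<le> quad_form (a x) \<xi> \<xi>"
    and k: "0 < k"
  shows "H1_0 \<Omega> (\<lambda>x. max 0 (u x - k)) (\<lambda>x. (if k < u x then 1 else 0) *\<^sub>R Du x)"
    and "integrable Om (\<lambda>x. level_potential k (u x) * (max 0 (u x - k))\<^sup>2)"
    and "c\<^sub>0 * (LINT x|Om. (norm ((if k < u x then 1 else 0) *\<^sub>R Du x))\<^sup>2)
      \<le> 3 / 2 * (LINT x|Om. level_potential k (u x) * (max 0 (u x - k))\<^sup>2)
        + k\<^sup>2 / 2 * (LINT x|Om. level_potential k (u x))"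
proof -
  let ?w = "\<lambda>x. max 0 (u x - k)" and ?v = "\<lambda>x. level_potential k (u x)"
  let ?p = "\<lambda>x. if k < u x then 1 else 0 :: real"
  have adm: "admissible (\<lambda>s. max 0 (s - k)) (\<lambda>s. if k < s then 1 else 0)"
    using k by (intro admissible_pos_part) simp
  then show H: "H1_0 \<Omega> ?w (\<lambda>x. ?p x *\<^sub>R Du x)" unfolding admissible_def by blast
  have iF: "integrable Om (\<lambda>x. F (u x) * ?w x)"
    and eq: "(LINT x|Om. ?p x * quad_form (a x) (Du x) (Du x)) = (LINT x|Om. F (u x) * ?w x)"
    using adm unfolding admissible_def by blast+
  have vw: "?v x * (?w x)\<^sup>2 \<le> F (u x) * ?w x" for x
  proof (cases "k < u x")
    case True
    then have "?v x * (?w x)\<^sup>2 = F (u x) * ?w x * (?w x / u x)"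
      by (simp add: level_potential_def power2_eq_square)
    also have "\<dots> \<le> F (u x) * ?w x * 1"
      using True k F_nonneg[of "u x"] by (intro mult_left_mono) simp_all
    finally show ?thesis by simp
  qed (simp add: level_potential_def)
  have vnn: "0 \<le> ?v x" for x using level_potential_nonneg k by simp
  show iY: "integrable Om (\<lambda>x. ?v x * (?w x)\<^sup>2)"
  proof (rule Bochner_Integration.integrable_bound[OF iF])
    show "AE x in Om. norm (?v x * (?w x)\<^sup>2) \<le> norm (F (u x) * ?w x)"
      using vw vnn F_nonneg by (intro AE_I2) (simp add: abs_mult)
  qed measurable
  have iD: "integrable Om (\<lambda>x. (norm (?p x *\<^sub>R Du x))\<^sup>2)"
    using H by (simp add: H1_0_def square_integrable_def)
  have iq: "integrable Om (\<lambda>x. ?p x * quad_form (a x) (Du x) (Du x))"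
  proof (rule Bochner_Integration.integrable_bound[OF quad_Du_integrable])
    have "?p \<in> borel_measurable Om" by measurable
    then show "(\<lambda>x. ?p x * quad_form (a x) (Du x) (Du x)) \<in> borel_measurable Om"
      by (intro borel_measurable_times quad_meas u_meas)
  qed simp
  have "c\<^sub>0 * (LINT x|Om. (norm (?p x *\<^sub>R Du x))\<^sup>2) = (LINT x|Om. c\<^sub>0 * (norm (?p x *\<^sub>R Du x))\<^sup>2)" by simp
  also have "\<dots> \<le> (LINT x|Om. ?p x * quad_form (a x) (Du x) (Du x))"
    using iD iq coercive by (intro integral_mono) auto
  also have "\<dots> = (LINT x|Om. F (u x) * ?w x)" by (rule eq)
  also have "\<dots> \<le> (LINT x|Om. 3 / 2 * (?v x * (?w x)\<^sup>2) + k\<^sup>2 / 2 * ?v x)"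
  proof (rule integral_mono)
    show "integrable Om (\<lambda>x. 3 / 2 * (?v x * (?w x)\<^sup>2) + k\<^sup>2 / 2 * ?v x)"
      using iY level_potential_integrable[OF k] by simp
    show "F (u x) * ?w x \<le> 3 / 2 * (?v x * (?w x)\<^sup>2) + k\<^sup>2 / 2 * ?v x" for x
    proof (cases "k < u x")
      case True
      have "F (u x) * ?w x = ?v x * ((?w x + k) * ?w x)"
        using True k by (simp add: level_potential_def)
      also have "\<dots> \<le> ?v x * (3 / 2 * (?w x)\<^sup>2 + k\<^sup>2 / 2)"
        using sum_squares_bound[of k "?w x"] by (intro mult_left_mono vnn) (simp add: power2_eq_square algebra_simps)
      finally show ?thesis by (simp add: algebra_simps)
    qed (use vnn in simp)
  qed (rule iF)
  also have "\<dots> = 3 / 2 * (LINT x|Om. ?v x * (?w x)\<^sup>2) + k\<^sup>2 / 2 * (LINT x|Om. ?v x)"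
    using iY level_potential_integrable[OF k] by (subst Bochner_Integration.integral_add) simp_all
  finally show "c\<^sub>0 * (LINT x|Om. (norm (?p x *\<^sub>R Du x))\<^sup>2)
      \<le> 3 / 2 * (LINT x|Om. ?v x * (?w x)\<^sup>2) + k\<^sup>2 / 2 * (LINT x|Om. ?v x)" .
qed

text \<open>
  Translations and Tonelli's theorem require Borel functions on the whole space.
\<close>

lemma borel_version:
  obtains U where "U \<in> borel_measurable borel" "AE x in Om. u x = U x"
    "\<And>h :: real \<Rightarrow> real. h \<in> borel_measurable borel \<Longrightarrow>
      (\<integral>\<^sup>+x. ennreal (indicator \<Omega> x * h (U x)) \<partial>lborel) = (\<integral>\<^sup>+x. ennreal (h (u x)) \<partial>Om)"
proof -
  have s\<Omega>: "\<Omega> \<in> sets lebesgue" "\<Omega> \<in> sets borel" using open_dom by simp_all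
  have "(\<lambda>x. u x * indicator \<Omega> x) \<in> borel_measurable lebesgue"
    using u_meas(1) s\<Omega> by (subst (asm) borel_measurable_restrict_space_iff) (simp_all add: mult.commute)
  then obtain U where U: "U \<in> borel_measurable lborel" "AE x in lborel. u x * indicator \<Omega> x = U x"
    using completion_ex_borel_measurable_real by blast
  have Um[measurable]: "U \<in> borel_measurable borel" using U(1) by simp
  have "AE x in lebesgue. u x * indicator \<Omega> x = U x" using U(2) by (rule AE_completion)
  then have ae: "AE x in Om. u x = U x"
    using s\<Omega>(1) by (subst AE_restrict_space_iff) (auto elim: eventually_mono)
  have eq: "(\<integral>\<^sup>+x. ennreal (indicator \<Omega> x * h (U x)) \<partial>lborel) = (\<integral>\<^sup>+x. ennreal (h (u x)) \<partial>Om)"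
    if [measurable]: "h \<in> borel_measurable borel" for h :: "real \<Rightarrow> real"
  proof -
    have "(\<integral>\<^sup>+x. ennreal (h (u x)) \<partial>Om) = (\<integral>\<^sup>+x. ennreal (h (U x)) \<partial>Om)"
      by (rule nn_integral_cong_AE, rule eventually_mono[OF ae]) simp
    also have "\<dots> = (\<integral>\<^sup>+x. ennreal (h (U x)) * indicator \<Omega> x \<partial>lebesgue)"
      using s\<Omega>(1) by (intro nn_integral_restrict_space) simp
    also have "\<dots> = (\<integral>\<^sup>+x. ennreal (indicator \<Omega> x * h (U x)) \<partial>lborel)"
      unfolding nn_integral_completion by (rule nn_integral_cong) (simp add: indicator_def)
    finally show ?thesis ..
  qed
  show thesis by (rule that[OF Um ae eq])
qed

text \<open>
  Let \<open>m k\<close> be the integral of \<open>f(u)/u\<close> over \<open>{u > k}\<close>, where the equation reads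
  \<open>- L u = V u\<close> with the potential \<open>V = f(u)/u\<close>; testing it with \<open>(u - k)\<^sup>+\<close> and absorbing
  \<open>\<integral> V ((u - k)\<^sup>+)\<^sup>2\<close> through the trace inequality gives the superlinear recursion in \<open>m\<close> that
  De Giorgi's iteration needs.
\<close>

lemma essentially_bounded:
  assumes R: "0 \<le> R" "\<Omega> \<subseteq> ball 0 R"
    and coercive: "0 < c\<^sub>0" "\<And>x \<xi>. x \<in> \<Omega> \<Longrightarrow> c\<^sub>0 * (norm \<xi>)\<^sup>2 \<le> quad_form (a x) \<xi> \<xi>"
    and q: "1 < q" "real CARD('n) / q < 2" and t2: "0 < t\<^sub>2"
  defines "W \<equiv> \<lambda>s. if t\<^sub>2 \<le> s then (F s / s) powr q else 0"
  assumes W: "integrable Om (\<lambda>x. W (u x))" "(LINT x|Om. W (u x)) \<le> C\<^sub>1" "0 \<le> C\<^sub>1"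
    and k0: "t\<^sub>2 \<le> k\<^sub>0" and large: "0 < \<Lambda>" "\<And>s. k\<^sub>0 \<le> s \<Longrightarrow> \<Lambda> \<le> f s / s"
  defines "n \<equiv> real CARD('n)"
  defines "\<delta> \<equiv> (2 - n / q) / (2 * n)"
  defines "\<sigma> \<equiv> n * \<delta> + n / q * (1 - \<delta>)"
  defines "K' \<equiv> (2 * R + 1) powr (1 - \<sigma> / 2) / (1 - \<sigma> / 2)"
  defines "\<kappa> \<equiv> 2 * (K'\<^sup>2 * (2 * n)\<^sup>2) * (1 + C\<^sub>1) powr (1 - \<delta>)"
  assumes small: "3 * \<kappa> * (\<Lambda> powr (1 - q) * C\<^sub>1) powr \<delta> \<le> c\<^sub>0"
    "16 * (\<kappa> / c\<^sub>0) * (\<Lambda> powr (1 - q) * C\<^sub>1) powr \<delta> \<le> 4 powr (- 1 / \<delta>)"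
  shows "AE x in Om. u x \<le> 2 * k\<^sub>0"
proof -
  have n: "1 \<le> n" unfolding n_def by (simp add: Suc_le_eq)
  have nq: "0 < n / q" "n / q < 2" using n q by (simp_all add: n_def)
  have \<delta>: "0 < \<delta>" "\<delta> < 1"
  proof -
    show "0 < \<delta>" using nq n by (simp add: \<delta>_def)
    have "2 - n / q < 2 * n" using nq n by linarith
    then show "\<delta> < 1" using n by (simp add: \<delta>_def)
  qed
  \<comment> \<open>\<open>\<delta>\<close> is chosen so that \<open>n \<delta> = 1 - n / (2 q)\<close>, which leaves \<open>\<sigma> \<le> 1 + n / (2 q) < 2\<close>.\<close>
  have "\<sigma> < 2"
  proof -
    have "n * \<delta> = 1 - n / q / 2" using n by (simp add: \<delta>_def field_simps)
    moreover have "n / q * (1 - \<delta>) \<le> n / q * 1" using nq \<delta> by (intro mult_left_mono) simp_all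
    ultimately have "\<sigma> \<le> (1 - n / q / 2) + n / q * 1"
      unfolding \<sigma>_def by (intro add_mono) simp_all
    then show ?thesis using nq by simp
  qed
  have \<kappa>: "0 \<le> \<kappa>" by (simp add: \<kappa>_def)
  have k0_pos: "0 < k\<^sub>0" using t2 k0 by simp
  let ?v = level_potential
  \<comment> \<open>The guard makes \<open>m\<close> nonnegative for every argument; only levels \<open>k \<ge> k\<^sub>0\<close> matter.\<close>
  define m where "m k = (if 0 < k then LINT x|Om. ?v k (u x) else 0)" for k
  have m_nonneg: "0 \<le> m k" for k
    using level_potential_nonneg[of k] by (simp add: m_def integral_nonneg_AE)
  have vW: "?v k s \<le> \<Lambda> powr (1 - q) * W s" if "k\<^sub>0 \<le> k" for k s
  proof (cases "k < s")
    case True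
    define y where "y = F s / s"
    have s: "0 < s" "t\<^sub>2 \<le> s" using True that k0 t2 by simp_all
    have y: "\<Lambda> \<le> y" using large(2)[of s] True that s by (simp add: y_def max_def)
    have "y powr (1 - q) \<le> \<Lambda> powr (1 - q)"
      using large(1) y q by (intro powr_mono2') simp_all
    then have "y powr (1 - q) * y powr q \<le> \<Lambda> powr (1 - q) * y powr q" by (intro mult_right_mono) simp_all
    moreover have "y powr (1 - q) * y powr q = y" using y large(1) by (simp add: powr_add[symmetric])
    ultimately show ?thesis using True s by (simp add: level_potential_def W_def y_def)
  qed (simp add: level_potential_def W_def)
  have young: "?v k s \<le> r + r powr (1 - q) * W s" if "0 < r" "k\<^sub>0 \<le> k" for r k s
  proof (cases "k < s \<and> r < F s / s")
    case True
    define y where "y = F s / s"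
    have s: "0 < s" "t\<^sub>2 \<le> s" using True that k0 t2 by simp_all
    have y: "r \<le> y" using True by (simp add: y_def)
    have "y powr (1 - q) \<le> r powr (1 - q)"
      using that y q by (intro powr_mono2') simp_all
    then have "y powr (1 - q) * y powr q \<le> r powr (1 - q) * y powr q" by (intro mult_right_mono) simp_all
    moreover have "y powr (1 - q) * y powr q = y" using y that(1) by (simp add: powr_add[symmetric])
    ultimately show ?thesis using True s that(1) by (simp add: level_potential_def W_def y_def)
  next
    case False
    then have "?v k s \<le> r" using that by (auto simp: level_potential_def)
    moreover have "0 \<le> r powr (1 - q) * W s" by (simp add: W_def)
    ultimately show ?thesis by linarith
  qed
  have Wm[measurable]: "W \<in> borel_measurable borel" unfolding W_def by measurable
  have W_nonneg: "0 \<le> W s" for s by (simp add: W_def)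
  have m_le: "m k \<le> \<Lambda> powr (1 - q) * C\<^sub>1" if "k\<^sub>0 \<le> k" for k
  proof -
    have k: "0 < k" using that k0_pos by simp
    have "m k \<le> (LINT x|Om. \<Lambda> powr (1 - q) * W (u x))"
    proof -
      have "(LINT x|Om. ?v k (u x)) \<le> (LINT x|Om. \<Lambda> powr (1 - q) * W (u x))"
        by (rule integral_mono[OF level_potential_integrable[OF k] integrable_mult_right[OF W(1)] vW[OF that]])
      then show ?thesis using k by (simp only: m_def if_True)
    qed
    also have "\<dots> = \<Lambda> powr (1 - q) * (LINT x|Om. W (u x))" by simp
    also have "\<dots> \<le> \<Lambda> powr (1 - q) * C\<^sub>1" using W(2) by (intro mult_left_mono) simp_all
    finally show ?thesis .
  qed
  obtain U where Um[measurable]: "U \<in> borel_measurable borel" and ae: "AE x in Om. u x = U x"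
    and transfer: "\<And>h :: real \<Rightarrow> real. h \<in> borel_measurable borel \<Longrightarrow>
      (\<integral>\<^sup>+x. ennreal (indicator \<Omega> x * h (U x)) \<partial>lborel) = (\<integral>\<^sup>+x. ennreal (h (u x)) \<partial>Om)"
    by (rule borel_version) blast
  have \<Omega>b[measurable]: "\<Omega> \<in> sets borel" using open_dom by simp
  define V where "V k x = indicator \<Omega> x * ?v k (U x)" for k x
  have Vm: "V k \<in> borel_measurable borel" for k unfolding V_def by measurable
  have V_nonneg: "0 \<le> V k x" if "0 < k" for k x using level_potential_nonneg[of k] that by (simp add: V_def)
  have morrey: "(\<integral>\<^sup>+y. ennreal (V k (z - t *\<^sub>R y)) * indicator shift_cube y \<partial>lborel)
      \<le> ennreal (m k powr \<delta> * (1 + C\<^sub>1) powr (1 - \<delta>)) * ennreal (t powr (- \<sigma>))"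
    if k: "k\<^sub>0 \<le> k" and t: "0 < t" for k z t
    unfolding \<sigma>_def n_def
  proof (rule morrey_bound[OF Vm _ _ _ _ q(1) _ W(3) _ m_nonneg \<delta> t])
    have kp: "0 < k" using k k0_pos by simp
    show "(\<lambda>x. indicator \<Omega> x * W (U x)) \<in> borel_measurable borel" by measurable
    show "0 \<le> V k x" for x using V_nonneg kp by simp
    show "0 \<le> indicator \<Omega> x * W (U x)" for x using W_nonneg by simp
    show "V k x \<le> s + s powr (1 - q) * (indicator \<Omega> x * W (U x))" if "0 < s" for s x
      using young[OF that k, of "U x"] that by (simp add: V_def indicator_def)
    have "(\<integral>\<^sup>+x. ennreal (indicator \<Omega> x * W (U x)) \<partial>lborel) = ennreal (LINT x|Om. W (u x))"
      using W_nonneg by (simp add: transfer nn_integral_eq_integral[OF W(1)])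
    then show "(\<integral>\<^sup>+x. ennreal (indicator \<Omega> x * W (U x)) \<partial>lborel) \<le> ennreal C\<^sub>1"
      using W(2) by (simp add: ennreal_leI)
    have "(\<integral>\<^sup>+x. ennreal (V k x) \<partial>lborel) = (\<integral>\<^sup>+x. ennreal (?v k (u x)) \<partial>Om)"
      unfolding V_def by (rule transfer) measurable
    also have "\<dots> = ennreal (m k)"
      using level_potential_nonneg kp by (simp add: m_def nn_integral_eq_integral[OF level_potential_integrable[OF kp]])
    finally show "(\<integral>\<^sup>+x. ennreal (V k x) \<partial>lborel) \<le> ennreal (m k)" by simp
  qed
  \<comment> \<open>The smallness of \<open>m k\<close> lets the term with \<open>Y\<close> on the right of the energy estimate be absorbed.\<close>
  have caccioppoli: "(LINT x|Om. ?v k (u x) * (max 0 (u x - k))\<^sup>2) \<le> \<kappa> / c\<^sub>0 * k\<^sup>2 * m k powr (1 + \<delta>)"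
    if k: "k\<^sub>0 \<le> k" for k
  proof -
    have kp: "0 < k" using k k0_pos by simp
    note E = pos_part_energy[OF coercive kp]
    let ?w = "\<lambda>x. max 0 (u x - k)"
    define Y where "Y = (LINT x|Om. ?v k (u x) * (?w x)\<^sup>2)"
    define D where "D = (LINT x|Om. (norm ((if k < u x then 1 else 0) *\<^sub>R Du x))\<^sup>2)"
    have Y0: "0 \<le> Y" unfolding Y_def using level_potential_nonneg[of k] kp by (intro integral_nonneg_AE) simp
    have "0 \<le> m k powr \<delta> * (1 + C\<^sub>1) powr (1 - \<delta>)" by simp
    from trace_inequality_H1_0(2)[OF open_dom lmeas_dom R E(1) Vm V_nonneg[OF kp] \<open>\<sigma> < 2\<close> this morrey[OF k]]
    have "(LINT x|Om. V k x * (?w x)\<^sup>2) \<le> \<kappa> * m k powr \<delta> * D"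
      by (simp add: \<kappa>_def K'_def n_def D_def mult_ac)
    moreover have "(LINT x|Om. V k x * (?w x)\<^sup>2) = Y"
      unfolding Y_def
    proof (rule integral_cong_AE)
      have m1: "V k \<in> borel_measurable Om" by (rule borel_measurable_lebesgue_onI[OF Vm])
      have m2: "(\<lambda>x. (?w x)\<^sup>2) \<in> borel_measurable Om" "(\<lambda>x. ?v k (u x)) \<in> borel_measurable Om" by measurable
      show "(\<lambda>x. V k x * (?w x)\<^sup>2) \<in> borel_measurable Om" by (rule borel_measurable_times[OF m1 m2(1)])
      show "(\<lambda>x. ?v k (u x) * (?w x)\<^sup>2) \<in> borel_measurable Om" by (rule borel_measurable_times[OF m2(2) m2(1)])
      have "AE x in Om. x \<in> \<Omega>" by (rule AE_I2) simp
      with ae show "AE x in Om. V k x * (?w x)\<^sup>2 = ?v k (u x) * (?w x)\<^sup>2"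
        by eventually_elim (simp add: V_def)
    qed
    ultimately have YD: "Y \<le> \<kappa> * m k powr \<delta> * D" by simp
    have ED: "c\<^sub>0 * D \<le> 3 / 2 * Y + k\<^sup>2 / 2 * m k"
      using E(3) kp by (simp add: D_def Y_def m_def)
    define \<theta> where "\<theta> = \<kappa> * m k powr \<delta>"
    have \<theta>0: "0 \<le> \<theta>" using \<kappa> by (simp add: \<theta>_def)
    have "m k powr \<delta> \<le> (\<Lambda> powr (1 - q) * C\<^sub>1) powr \<delta>"
      using m_le[OF k] m_nonneg \<delta> by (intro powr_mono2) simp_all
    from mult_left_mono[OF this, of "3 * \<kappa>"] small(1) \<kappa>
    have \<theta>1: "3 * \<theta> \<le> c\<^sub>0" by (simp add: \<theta>_def)
    have "c\<^sub>0 * Y \<le> \<theta> * (c\<^sub>0 * D)"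
      using mult_left_mono[OF YD, of c\<^sub>0] coercive(1) by (simp add: \<theta>_def mult_ac)
    also have "\<dots> \<le> \<theta> * (3 / 2 * Y + k\<^sup>2 / 2 * m k)" by (rule mult_left_mono[OF ED \<theta>0])
    also have "\<dots> = (3 * \<theta>) * Y / 2 + \<theta> * k\<^sup>2 * m k / 2" by (simp add: algebra_simps)
    finally have "c\<^sub>0 * Y \<le> \<theta> * k\<^sup>2 * m k"
      using mult_right_mono[OF \<theta>1 Y0] by linarith
    then have "Y \<le> \<theta> * k\<^sup>2 * m k / c\<^sub>0" using coercive(1) by (simp add: le_divide_eq mult.commute)
    also have "\<dots> = \<kappa> / c\<^sub>0 * k\<^sup>2 * (m k powr \<delta> * m k)" by (simp add: \<theta>_def)
    also have "m k powr \<delta> * m k = m k powr (1 + \<delta>)"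
      using m_nonneg[of k] by (cases "m k = 0") (simp_all add: powr_add)
    finally show ?thesis by (simp add: Y_def)
  qed
  \<comment> \<open>Chebyshev: \<open>(u - k)\<^sup>+\<close> exceeds \<open>h - k\<close> on \<open>{u > h}\<close>.\<close>
  have step: "m h \<le> \<kappa> / c\<^sub>0 * (k / (h - k))\<^sup>2 * m k powr (1 + \<delta>)" if k: "k\<^sub>0 \<le> k" "k < h" for k h
  proof -
    have kp: "0 < k" "0 < h" using k k0_pos by simp_all
    have "(h - k)\<^sup>2 * m h = (LINT x|Om. (h - k)\<^sup>2 * ?v h (u x))" using kp by (simp add: m_def)
    also have "\<dots> \<le> (LINT x|Om. ?v k (u x) * (max 0 (u x - k))\<^sup>2)"
    proof (rule integral_mono)
      show "integrable Om (\<lambda>x. (h - k)\<^sup>2 * ?v h (u x))" using level_potential_integrable[OF kp(2)] by simp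
      show "integrable Om (\<lambda>x. ?v k (u x) * (max 0 (u x - k))\<^sup>2)" by (rule pos_part_energy(2)[OF coercive kp(1)])
      show "(h - k)\<^sup>2 * ?v h (u x) \<le> ?v k (u x) * (max 0 (u x - k))\<^sup>2" for x
      proof (cases "h < u x")
        case True
        have "(h - k)\<^sup>2 \<le> (u x - k)\<^sup>2" using True k by (intro power_mono) simp_all
        from mult_right_mono[OF this level_potential_nonneg[of k "u x"]] kp
        show ?thesis using True k by (simp add: level_potential_def mult.commute)
      next
        case False
        then show ?thesis using level_potential_nonneg[of k "u x"] kp by (simp add: level_potential_def)
      qed
    qed
    also have "\<dots> \<le> \<kappa> / c\<^sub>0 * k\<^sup>2 * m k powr (1 + \<delta>)" by (rule caccioppoli[OF k(1)])
    finally have "m h * (h - k)\<^sup>2 \<le> \<kappa> / c\<^sub>0 * k\<^sup>2 * m k powr (1 + \<delta>)"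
      by (simp only: mult.commute)
    moreover have "0 < (h - k)\<^sup>2" using k by simp
    ultimately have "m h \<le> \<kappa> / c\<^sub>0 * k\<^sup>2 * m k powr (1 + \<delta>) / (h - k)\<^sup>2"
      by (simp only: pos_le_divide_eq)
    also have "\<dots> = \<kappa> / c\<^sub>0 * (k / (h - k))\<^sup>2 * m k powr (1 + \<delta>)" by (simp add: power_divide)
    finally show ?thesis .
  qed
  have "m (2 * k\<^sub>0) = 0"
  proof (rule de_giorgi_iteration[OF k0_pos _ \<delta>(1) m_nonneg _ step])
    show "0 \<le> \<kappa> / c\<^sub>0" using \<kappa> coercive(1) by simp
    show "m h \<le> m k" if kh: "k\<^sub>0 \<le> k" "k \<le> h" for k h
    proof -
      have kp: "0 < k" "0 < h" using kh k0_pos by simp_all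
      have "?v h s \<le> ?v k s" for s
        using kh kp F_nonneg[of s] by (auto simp: level_potential_def)
      then show ?thesis
        using level_potential_integrable kp by (simp add: m_def integral_mono)
    qed
    have "m k\<^sub>0 powr \<delta> \<le> (\<Lambda> powr (1 - q) * C\<^sub>1) powr \<delta>"
      using m_le[OF order_refl] m_nonneg \<delta> by (intro powr_mono2) simp_all
    from mult_left_mono[OF this, of "16 * (\<kappa> / c\<^sub>0)"] small(2) \<kappa> coercive(1)
    show "16 * (\<kappa> / c\<^sub>0) * m k\<^sub>0 powr \<delta> \<le> 4 powr (- 1 / \<delta>)" by simp
  qed
  then have "(LINT x|Om. ?v (2 * k\<^sub>0) (u x)) = 0" using k0_pos by (simp add: m_def)
  then have "AE x in Om. ?v (2 * k\<^sub>0) (u x) = 0"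
    using level_potential_integrable[of "2 * k\<^sub>0"] level_potential_nonneg[of "2 * k\<^sub>0"] k0_pos
    by (subst (asm) integral_nonneg_eq_0_iff_AE) simp_all
  then show ?thesis
  proof (rule eventually_mono)
    fix x assume v0: "?v (2 * k\<^sub>0) (u x) = 0"
    show "u x \<le> 2 * k\<^sub>0"
    proof (rule ccontr)
      assume "\<not> u x \<le> 2 * k\<^sub>0"
      then have "2 * k\<^sub>0 < u x" "0 < u x" using k0_pos by simp_all
      then have "0 < ?v (2 * k\<^sub>0) (u x)" using f_pos[of "u x"] by (simp add: level_potential_def)
      with v0 show False by simp
    qed
  qed
qed

end

section \<open>The a priori bound\<close>

context convex_nonlinearity
begin

lemma f_ext_continuous: "continuous_on UNIV (\<lambda>s. f (max 0 s))"
  by (rule continuous_on_compose2[OF continuous_nonneg_axis(1)]) (auto intro!: continuous_intros)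

text \<open>
  Replacing \<open>f\<close> by its extension changes \<open>f(u)\<close> only on the null set where \<open>u\<close> is not positive. As
  nothing is known about \<open>f\<close> on the negative axis, measurability of \<open>f(u)\<close> has to come from the
  local integrability that is part of the notion of a solution.
\<close>

lemma semistable_solution_of_positive:
  fixes \<Omega> :: "(real ^ 'n) set"
  assumes \<Omega>: "open \<Omega>" "\<Omega> \<in> lmeasurable"
    and a: "\<And>i j. (\<lambda>x. a x $ i $ j) \<in> borel_measurable (lebesgue_on \<Omega>)"
      "AE x in lebesgue_on \<Omega>. \<forall>\<xi> \<zeta>. \<bar>quad_form (a x) \<xi> \<zeta>\<bar> \<le> M\<^sub>0 * (norm \<xi> * norm \<zeta>)"
      "\<And>x \<xi>. x \<in> \<Omega> \<Longrightarrow> 0 \<le> quad_form (a x) \<xi> \<xi>"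
    and u: "positive_semistable_solution \<Omega> a f f' u"
  obtains Du where "semistable_solution \<Omega> a u Du M\<^sub>0 f f' f''"
proof -
  obtain Du where H: "H1_0 \<Omega> u Du" and loc: "locally_integrable \<Omega> (\<lambda>x. f (u x))"
    and eq: "\<And>\<phi>. test_function \<Omega> \<phi> \<Longrightarrow>
           (LINT x|lebesgue_on \<Omega>. quad_form (a x) (gradient \<phi> x) (Du x)) =
           (LINT x|lebesgue_on \<Omega>. f (u x) * \<phi> x)"
    using u unfolding positive_semistable_solution_def weak_solution_def by blast
  have pos: "AE x in lebesgue_on \<Omega>. 0 < u x" and st: "semistable \<Omega> a f' u"
    using u unfolding positive_semistable_solution_def by blast+
  have s\<Omega>: "\<Omega> \<in> sets lebesgue" using \<Omega>(2) by (rule fmeasurableD)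
  have Fm[measurable]: "(\<lambda>s. f (max 0 s)) \<in> borel_measurable borel"
    by (rule borel_measurable_continuous_onI[OF f_ext_continuous])
  have um[measurable]: "u \<in> borel_measurable (lebesgue_on \<Omega>)"
    using H by (simp add: H1_0_def square_integrable_def)
  have loc': "locally_integrable \<Omega> (\<lambda>x. f (max 0 (u x)))"
    unfolding locally_integrable_def
  proof (intro allI impI)
    fix S assume S: "compact S \<and> S \<subseteq> \<Omega>"
    have sS: "S \<in> sets lebesgue" using S by (auto intro: lmeasurable_compact[THEN fmeasurableD])
    have "u \<in> borel_measurable (lebesgue_on S)"
      using H S by (auto simp: H1_0_def has_weak_gradient_def locally_integrable_def)
    then have m: "(\<lambda>x. f (max 0 (u x))) \<in> borel_measurable (lebesgue_on S)"
      by (rule measurable_compose[OF _ Fm])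
    have i: "integrable (lebesgue_on S) (\<lambda>x. f (u x))" using loc S by (simp add: locally_integrable_def)
    have "AE x in lebesgue. x \<in> \<Omega> \<longrightarrow> 0 < u x"
      using pos s\<Omega> by (subst (asm) AE_restrict_space_iff) simp_all
    then have "AE x in lebesgue. x \<in> S \<longrightarrow> 0 < u x"
      by (rule eventually_mono) (use S in blast)
    then have "AE x in lebesgue_on S. 0 < u x"
      using sS by (subst AE_restrict_space_iff) simp_all
    then have "AE x in lebesgue_on S. f (u x) = f (max 0 (u x))"
      by (rule eventually_mono) simp
    then show "integrable (lebesgue_on S) (\<lambda>x. f (max 0 (u x)))"
      using integrable_cong_AE[OF borel_measurable_integrable[OF i] m] i by blast
  qed
  have weak: "(LINT x|lebesgue_on \<Omega>. quad_form (a x) (gradient \<phi> x) (Du x)) =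
           (LINT x|lebesgue_on \<Omega>. f (max 0 (u x)) * \<phi> x)" if \<phi>: "test_function \<Omega> \<phi>" for \<phi>
  proof -
    have "(LINT x|lebesgue_on \<Omega>. f (u x) * \<phi> x) = (LINT x|lebesgue_on \<Omega>. f (max 0 (u x)) * \<phi> x)"
    proof (rule integral_cong_AE)
      show "(\<lambda>x. f (u x) * \<phi> x) \<in> borel_measurable (lebesgue_on \<Omega>)"
        "(\<lambda>x. f (max 0 (u x)) * \<phi> x) \<in> borel_measurable (lebesgue_on \<Omega>)"
        using integrable_locally_times_test_function[OF \<Omega>(1) loc \<phi>]
          integrable_locally_times_test_function[OF \<Omega>(1) loc' \<phi>]
        by (simp_all add: borel_measurable_integrable)
      show "AE x in lebesgue_on \<Omega>. f (u x) * \<phi> x = f (max 0 (u x)) * \<phi> x"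
        by (rule eventually_mono[OF pos]) simp
    qed
    then show ?thesis using eq[OF \<phi>] by simp
  qed
  have "0 \<le> f (max 0 s)" for s using f_pos[of "max 0 s"] by simp
  then have "semistable_solution \<Omega> a u Du M\<^sub>0 f f' f''"
    by (intro semistable_solution.intro elliptic_solution.intro semistable_solution_axioms.intro
        convex_nonlinearity_axioms \<Omega> a H pos f_ext_continuous loc' weak st)
  then show thesis by (rule that)
qed

text \<open>
  All constants are fixed before the
  solution: \<open>C\<^sub>1\<close> bounds the integral of \<open>(f(u)/u)\<^sup>q\<close> over \<open>{u \<ge> t\<^sub>2}\<close>, \<open>q = p + 1 > 5/2\<close>, and \<open>\<Lambda>\<close> is a
  lower bound of \<open>f(s)/s\<close> beyond \<open>k\<^sub>0\<close> which makes the mass of \<open>f(u)/u\<close> over \<open>{u > k\<^sub>0}\<close> small.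
\<close>

lemma a_priori_bound:
  fixes \<Omega> :: "(real ^ 'n) set"
  assumes dim: "CARD('n) \<le> 5" and dom: "smooth_bounded_domain \<Omega>" and ell: "uniformly_elliptic \<Omega> a"
    and p: "3 / 2 < p" and c: "0 < c" and T: "\<And>t. T \<le> t \<Longrightarrow> c * f' t powr p \<le> t\<^sup>2 * f t * f'' t"
  shows "\<exists>C::real. \<forall>u. positive_semistable_solution \<Omega> a f f' u \<longrightarrow> Linfty_norm \<Omega> u \<le> ereal C"
proof -
  have \<Omega>: "open \<Omega>" "bounded \<Omega>" using dom by (simp_all add: smooth_bounded_domain_def)
  have lm: "\<Omega> \<in> lmeasurable" using \<Omega> by (simp add: bounded_set_imp_lmeasurable)
  obtain R where "0 < R" and R: "\<Omega> \<subseteq> ball 0 R"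
    using bounded_subset_ballD[OF \<Omega>(2)] by blast
  then have R: "0 \<le> R" "\<Omega> \<subseteq> ball 0 R" by simp_all
  obtain M\<^sub>0 where M0: "AE x in lebesgue_on \<Omega>. \<forall>\<xi> \<zeta>. \<bar>quad_form (a x) \<xi> \<zeta>\<bar> \<le> M\<^sub>0 * (norm \<xi> * norm \<zeta>)"
    using uniformly_elliptic_bounded[OF ell] by blast
  obtain c\<^sub>0 where coercive: "0 < c\<^sub>0" "\<And>x \<xi>. x \<in> \<Omega> \<Longrightarrow> c\<^sub>0 * (norm \<xi>)\<^sup>2 \<le> quad_form (a x) \<xi> \<xi>"
    using ell unfolding uniformly_elliptic_def by blast
  have a_nonneg: "0 \<le> quad_form (a x) \<xi> \<xi>" if "x \<in> \<Omega>" for x \<xi>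
    by (rule order_trans[OF mult_nonneg_nonneg[OF less_imp_le[OF coercive(1)] zero_le_power2] coercive(2)[OF that]])
  have a_meas: "(\<lambda>x. a x $ i $ j) \<in> borel_measurable (lebesgue_on \<Omega>)" for i j
    using ell unfolding uniformly_elliptic_def by blast
  have p1: "1 < p" using p by simp
  obtain t\<^sub>2 c\<^sub>2 C where t2: "0 < t\<^sub>2" "0 < c\<^sub>2" "0 \<le> C"
    and lower: "\<And>m s. t\<^sub>2 \<le> m \<Longrightarrow> 0 < s \<Longrightarrow>
      (if t\<^sub>2 \<le> s \<and> s \<le> m then c\<^sub>2 * (f s / s) powr (p + 1) else 0) - C
      \<le> f' s * (primitive (slope m) s)\<^sup>2 - f s * primitive (\<lambda>s. (slope m s)\<^sup>2) s"
    by (rule semistability_lower_bound[OF p1 c T]) blast+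
  define q where "q = p + 1"
  define C\<^sub>1 where "C\<^sub>1 = C * measure (lebesgue_on \<Omega>) \<Omega> / c\<^sub>2"
  have C1: "0 \<le> C\<^sub>1" using t2 by (simp add: C\<^sub>1_def)
  define n where "n = real CARD('n)"
  define \<delta> where "\<delta> = (2 - n / q) / (2 * n)"
  define \<sigma> where "\<sigma> = n * \<delta> + n / q * (1 - \<delta>)"
  define K' where "K' = (2 * R + 1) powr (1 - \<sigma> / 2) / (1 - \<sigma> / 2)"
  define \<kappa> where "\<kappa> = 2 * (K'\<^sup>2 * (2 * n)\<^sup>2) * (1 + C\<^sub>1) powr (1 - \<delta>)"
  have q: "1 < q" "n / q < 2"
  proof -
    show "1 < q" using p by (simp add: q_def)
    have "n \<le> 5" using dim by (simp add: n_def)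
    then have "n < 2 * q" using p by (simp add: q_def)
    then show "n / q < 2" using \<open>1 < q\<close> by (simp add: divide_less_eq)
  qed
  have \<delta>: "0 < \<delta>" using q by (simp add: \<delta>_def n_def)
  have "((\<lambda>\<Lambda>. \<Lambda> powr (1 - q) * C\<^sub>1) \<longlongrightarrow> 0) at_top"
    using q by (intro tendsto_mult_left_zero tendsto_neg_powr filterlim_ident) simp
  then have lim: "((\<lambda>\<Lambda>. (\<Lambda> powr (1 - q) * C\<^sub>1) powr \<delta>) \<longlongrightarrow> 0) at_top"
    using C1 \<delta> by (intro tendsto_zero_powrI[OF _ tendsto_const]) simp_all
  have "\<forall>\<^sub>F \<Lambda> in at_top. 3 * \<kappa> * (\<Lambda> powr (1 - q) * C\<^sub>1) powr \<delta> < c\<^sub>0"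
    by (rule order_tendstoD(2)[OF tendsto_mult_right_zero[OF lim] coercive(1)])
  moreover have "\<forall>\<^sub>F \<Lambda> in at_top. 16 * (\<kappa> / c\<^sub>0) * (\<Lambda> powr (1 - q) * C\<^sub>1) powr \<delta> < 4 powr (- 1 / \<delta>)"
    by (rule order_tendstoD(2)[OF tendsto_mult_right_zero[OF lim]]) simp
  moreover have "\<forall>\<^sub>F \<Lambda>::real in at_top. 0 < \<Lambda>" by (rule eventually_gt_at_top)
  ultimately have "\<forall>\<^sub>F \<Lambda> in at_top. 0 < \<Lambda> \<and> 3 * \<kappa> * (\<Lambda> powr (1 - q) * C\<^sub>1) powr \<delta> < c\<^sub>0 \<and>
      16 * (\<kappa> / c\<^sub>0) * (\<Lambda> powr (1 - q) * C\<^sub>1) powr \<delta> < 4 powr (- 1 / \<delta>)"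
    by eventually_elim simp
  then obtain \<Lambda> where \<Lambda>: "0 < \<Lambda>" "3 * \<kappa> * (\<Lambda> powr (1 - q) * C\<^sub>1) powr \<delta> \<le> c\<^sub>0"
      "16 * (\<kappa> / c\<^sub>0) * (\<Lambda> powr (1 - q) * C\<^sub>1) powr \<delta> \<le> 4 powr (- 1 / \<delta>)"
    unfolding eventually_at_top_linorder by (metis order_refl less_imp_le)
  obtain t\<^sub>0 where t0: "\<And>t. t\<^sub>0 \<le> t \<Longrightarrow> \<Lambda> \<le> f t / t" using f_over_large by metis
  define k\<^sub>0 where "k\<^sub>0 = max t\<^sub>2 t\<^sub>0"
  have "Linfty_norm \<Omega> u \<le> ereal (2 * k\<^sub>0)" if u: "positive_semistable_solution \<Omega> a f f' u" for u
  proof -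
    obtain Du where "semistable_solution \<Omega> a u Du M\<^sub>0 f f' f''"
      by (rule semistable_solution_of_positive[OF \<Omega>(1) lm a_meas M0 a_nonneg u])
    then interpret S: semistable_solution \<Omega> a u Du M\<^sub>0 f f' f'' .
    note W = S.potential_bound[OF t2 lower]
    have "AE x in lebesgue_on \<Omega>. u x \<le> 2 * k\<^sub>0"
    proof (rule S.essentially_bounded[OF R coercive q[unfolded n_def] t2(1)])
      show "integrable (lebesgue_on \<Omega>) (\<lambda>x. if t\<^sub>2 \<le> u x then (f (max 0 (u x)) / u x) powr q else 0)"
        using W(1) by (simp only: q_def)
      show "(LINT x|lebesgue_on \<Omega>. (if t\<^sub>2 \<le> u x then (f (max 0 (u x)) / u x) powr q else 0)) \<le> C\<^sub>1"
        using W(2) by (simp only: q_def C\<^sub>1_def)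
      show "t\<^sub>2 \<le> k\<^sub>0" by (simp add: k\<^sub>0_def)
      show "\<Lambda> \<le> f s / s" if "k\<^sub>0 \<le> s" for s using t0[of s] that by (simp add: k\<^sub>0_def)
    qed (use C1 \<Lambda> in \<open>simp_all add: \<kappa>_def K'_def \<sigma>_def \<delta>_def n_def\<close>)
    with S.u_pos have "AE x in lebesgue_on \<Omega>. ereal \<bar>u x\<bar> \<le> ereal (2 * k\<^sub>0)"
      by eventually_elim simp
    moreover have "(\<lambda>x. ereal \<bar>u x\<bar>) \<in> borel_measurable (lebesgue_on \<Omega>)"
      using S.u_meas(1) by measurable
    ultimately show ?thesis unfolding Linfty_norm_def by (intro esssup_I)
  qed
  then show ?thesis by blast
qed

text \<open>
  Since \<open>f(t) \<le> 2 t f'(t)\<close> for large \<open>t\<close>, the condition with parameters \<open>\<gamma>\<close>, \<open>\<epsilon>\<close> implies the one with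
  \<open>\<gamma> = 0\<close> and \<open>\<epsilon> - \<gamma>\<close> in place of \<open>\<epsilon>\<close>.
\<close>

lemma growth_condition_normalised:
  assumes \<gamma>: "0 \<le> \<gamma>" and c: "0 < c"
    and ev: "\<forall>\<^sub>F t in at_top. c < t powr (2 - \<gamma>) * f t powr (1 + \<gamma>) * f'' t / f' t powr (1 + \<epsilon>)"
  obtains T where "\<And>t. T \<le> t \<Longrightarrow> c / 2 powr \<gamma> * f' t powr (1 + \<epsilon> - \<gamma>) \<le> t\<^sup>2 * f t * f'' t"
proof -
  obtain t\<^sub>0 where t0: "\<And>t. t\<^sub>0 \<le> t \<Longrightarrow> c < t powr (2 - \<gamma>) * f t powr (1 + \<gamma>) * f'' t / f' t powr (1 + \<epsilon>)"
    using ev unfolding eventually_at_top_linorder by blast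
  obtain t\<^sub>1 where t1: "0 < t\<^sub>1" "\<And>t. t\<^sub>1 \<le> t \<Longrightarrow> 1 \<le> f' t" using f'_large by metis
  obtain t\<^sub>2 where t2: "\<And>t. t\<^sub>2 \<le> t \<Longrightarrow> 2 * f 0 \<le> f t" using f_large by metis
  have "c / 2 powr \<gamma> * f' t powr (1 + \<epsilon> - \<gamma>) \<le> t\<^sup>2 * f t * f'' t" if "max t\<^sub>0 (max t\<^sub>1 t\<^sub>2) \<le> t" for t
  proof -
    have t: "t\<^sub>0 \<le> t" "t\<^sub>1 \<le> t" "t\<^sub>2 \<le> t" "0 < t" using that t1(1) by simp_all
    have f': "0 < f' t" using t1(2)[OF t(2)] by simp
    have ft: "0 < f t" using f_pos t by simp
    have f'': "0 \<le> f'' t" using f''_nonneg t by simp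
    have "f t \<le> 2 * (t * f' t)" using f_le[of t] t2[OF t(3)] t by simp
    then have "f t powr \<gamma> \<le> (2 * (t * f' t)) powr \<gamma>" using ft \<gamma> by (intro powr_mono2) simp_all
    also have "\<dots> = 2 powr \<gamma> * (t powr \<gamma> * f' t powr \<gamma>)" using t f' by (simp add: powr_mult)
    finally have fg: "f t powr \<gamma> \<le> 2 powr \<gamma> * (t powr \<gamma> * f' t powr \<gamma>)" .
    have "c * f' t powr (1 + \<epsilon>) \<le> t powr (2 - \<gamma>) * f t powr (1 + \<gamma>) * f'' t"
      using t0[OF t(1)] f' by (simp add: less_divide_eq)
    also have "\<dots> = (t powr (2 - \<gamma>) * f t * f'' t) * f t powr \<gamma>"
      using ft by (simp add: powr_add)
    also have "\<dots> \<le> (t powr (2 - \<gamma>) * f t * f'' t) * (2 powr \<gamma> * (t powr \<gamma> * f' t powr \<gamma>))"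
      using fg ft f'' by (intro mult_left_mono) simp_all
    also have "\<dots> = (2 powr \<gamma> * f' t powr \<gamma>) * ((t powr (2 - \<gamma>) * t powr \<gamma>) * f t * f'' t)"
      by (simp only: mult_ac)
    also have "t powr (2 - \<gamma>) * t powr \<gamma> = t\<^sup>2" using t by (simp add: powr_add[symmetric])
    finally have "c * f' t powr (1 + \<epsilon>) \<le> (2 powr \<gamma> * f' t powr \<gamma>) * (t\<^sup>2 * f t * f'' t)" .
    moreover have "f' t powr (1 + \<epsilon>) = f' t powr (1 + \<epsilon> - \<gamma>) * f' t powr \<gamma>"
      by (simp add: powr_add[symmetric])
    ultimately have "f' t powr \<gamma> * (c * f' t powr (1 + \<epsilon> - \<gamma>)) \<le> f' t powr \<gamma> * (2 powr \<gamma> * (t\<^sup>2 * f t * f'' t))"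
      by (simp only: mult_ac)
    then have "c * f' t powr (1 + \<epsilon> - \<gamma>) \<le> 2 powr \<gamma> * (t\<^sup>2 * f t * f'' t)"
      using f' by (simp only: mult_le_cancel_left_pos[of "f' t powr \<gamma>"] powr_gt_zero)
    then show ?thesis by (simp add: divide_le_eq mult.commute)
  qed
  then show thesis by (rule that)
qed

end

theorem corollary1p4:
  fixes \<Omega> :: "(real ^ 'n) set"
    and a :: "real ^ 'n \<Rightarrow> real ^ 'n ^ 'n"
    and f f' f'' :: "real \<Rightarrow> real"
  assumes "2 \<le> CARD('n)" and "CARD('n) \<le> 5"
    and "smooth_bounded_domain \<Omega>"
    and "uniformly_elliptic \<Omega> a"
    and "\<And>t. 0 \<le> t \<Longrightarrow> (f has_real_derivative f' t) (at t within {0..})"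
    and "\<And>t. 0 \<le> t \<Longrightarrow> (f' has_real_derivative f'' t) (at t within {0..})"
    and "continuous_on {0..} f''"
    and "convex_on {0..} f"
    and "0 < f 0"
    and "\<And>t. 0 \<le> t \<Longrightarrow> 0 \<le> f' t"
    and "filterlim (\<lambda>s. f s / s) at_top at_top"
  shows "(\<forall>\<gamma> \<epsilon>. 0 \<le> \<gamma> \<and> \<gamma> \<le> 2 \<and> 0 < \<epsilon> \<and> 1 / 2 < \<epsilon> - \<gamma> \<and>
           0 < Liminf at_top (\<lambda>t. ereal
                 (t powr (2 - \<gamma>) * f t powr (1 + \<gamma>) * f'' t / f' t powr (1 + \<epsilon>))) \<longrightarrow>
           (\<exists>C::real. \<forall>u. positive_semistable_solution \<Omega> a f f' u \<longrightarrow>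
              Linfty_norm \<Omega> u \<le> ereal C)) \<and>
         (\<forall>\<epsilon>. 1 / 2 < \<epsilon> \<and>
           0 < Liminf at_top (\<lambda>t. ereal (t\<^sup>2 * f t * f'' t / f' t powr (1 + \<epsilon>))) \<longrightarrow>
           (\<exists>C::real. \<forall>u. positive_semistable_solution \<Omega> a f f' u \<longrightarrow>
              Linfty_norm \<Omega> u \<le> ereal C))"
proof -
  interpret convex_nonlinearity f f' f''
    by (rule convex_nonlinearity.intro) (use assms in auto)
  have positive_liminf: "\<exists>c>0. \<forall>\<^sub>F t in at_top. c < h t" if l: "0 < Liminf at_top (\<lambda>t. ereal (h t))" for h :: "real \<Rightarrow> real"
  proof -
    obtain c :: real where c: "0 < ereal c" "ereal c < Liminf at_top (\<lambda>t. ereal (h t))"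
      using ereal_dense2[OF l] by blast
    from less_LiminfD[OF c(2)] have "\<forall>\<^sub>F t in at_top. c < h t" by simp
    with c(1) show ?thesis by auto
  qed
  have bound: "\<exists>C::real. \<forall>u. positive_semistable_solution \<Omega> a f f' u \<longrightarrow> Linfty_norm \<Omega> u \<le> ereal C"
    if \<gamma>: "0 \<le> \<gamma>" "1 / 2 < \<epsilon> - \<gamma>"
      and l: "0 < Liminf at_top (\<lambda>t. ereal (t powr (2 - \<gamma>) * f t powr (1 + \<gamma>) * f'' t / f' t powr (1 + \<epsilon>)))"
    for \<gamma> \<epsilon>
  proof -
    obtain c where c: "0 < c"
      and ev: "\<forall>\<^sub>F t in at_top. c < t powr (2 - \<gamma>) * f t powr (1 + \<gamma>) * f'' t / f' t powr (1 + \<epsilon>)"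
      using positive_liminf[OF l] by blast
    obtain T where T: "\<And>t. T \<le> t \<Longrightarrow> c / 2 powr \<gamma> * f' t powr (1 + \<epsilon> - \<gamma>) \<le> t\<^sup>2 * f t * f'' t"
      using growth_condition_normalised[OF \<gamma>(1) c ev] by blast
    show ?thesis
      by (rule a_priori_bound[OF assms(2-4) _ _ T]) (use \<gamma> c in simp_all)
  qed
  have "0 < Liminf at_top (\<lambda>t. ereal (t powr (2 - 0) * f t powr (1 + 0) * f'' t / f' t powr (1 + \<epsilon>)))"
    if "0 < Liminf at_top (\<lambda>t. ereal (t\<^sup>2 * f t * f'' t / f' t powr (1 + \<epsilon>)))" for \<epsilon>
  proof -
    have "\<forall>\<^sub>F t in at_top. ereal (t\<^sup>2 * f t * f'' t / f' t powr (1 + \<epsilon>))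
        = ereal (t powr (2 - 0) * f t powr (1 + 0) * f'' t / f' t powr (1 + \<epsilon>))"
      using eventually_gt_at_top[of "0::real"]
    proof eventually_elim
      case (elim t)
      then have "0 < f t" by (simp add: f_pos)
      with elim show ?case by simp
    qed
    from Liminf_eq[OF this] that show ?thesis by simp
  qed
  then show ?thesis using bound bound[of 0] by (intro conjI allI impI) auto
qed

end
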